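(* Let $m\ge 2$ be an integer, let $G$ be a finite simple graph on the vertex set $[n]$, and let $\Psi:\mathcal{K}\times\mathcal{G}\to\mathbb{N}_0$ be a $d$-compatible map. Then $$\mathrm{depth}(S/\mathcal{J}_{K_m,G})\ \geq\ \Psi(K_m,G).$$ Moreover, the map $\Psi:\mathcal{K}\times\mathcal{G}\to\mathbb{N}_0$ defined by $\Psi(K_m,G)=(m-2)t+f(G)+d(G)$, where $t$ denotes the number of connected components of $G$, is $d$-compatible. Hence, for every $m\ge 2$ and every finite simple graph $G$ on $[n]$ with $t$ connected components, $$\mathrm{depth}(S/\mathcal{J}_{K_m,G})\ \geq\ (m-2)t+f(G)+d(G).$$
   Context: Generalized binomial edge ideals. Let $K$ be a field, $m\ge 2$, $n\ge 1$ integers, $[n]=\{1,\dots,n\}$, and $S=K[x_{ij}: i\in[m],\, j\in[n]]$. For a finite simple graph $G$ on $[n]$ with edge set $E(G)$, the generalized binomial edge ideal of $G$ is $$\mathcal{J}_{K_m,G}=\big(x_{ik}x_{jl}-x_{il}x_{jk} : 1\le i<j\le m,\ \{k,l\}\in E(G),\ k<l\big)\subseteq S$$ (here $K_m$ is the complete graph on $m$ vertices). Depth is the depth of the graded $S$-module with respect to the homogeneous maximal ideal $\mathfrak m$ of $S$, i.e. $\mathrm{depth}(M)=\min\{i : H^i_{\mathfrak m}(M)\ne 0\}$. Graph notation. All graphs are finite and simple. $\mathcal{N}_G(v)$ is the set of vertices adjacent to $v$. A vertex $v$ is free if the induced subgraph of $G$ on $\mathcal{N}_G(v)$ is complete (in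 particular an isolated vertex is free), and non-free otherwise. $G-v$ is the induced subgraph of $G$ on $V(G)\setminus\{v\}$. $G_v$ is the graph with vertex set $V(G)$ and edge set $E(G)\cup\{\{u,w\}: u,w\in\mathcal{N}_G(v),\ u\neq w\}$; $G_v-v$ means $(G_v)-v$. $f(G)$ is the number of free vertices of $G$. If $G$ has connected components $G_1,\dots,G_t$, then $d(G)=i(G)+\sum_{j=1}^t\mathrm{diam}(G_j)$, where $i(G)$ is the number of isolated vertices of $G$ and $\mathrm{diam}(G_j)$ is the maximum of the distances $d_{G_j}(u,v)$ (length of a shortest path, $d_{G_j}(u,u)=0$) over vertices $u,v$ of $G_j$. $d$-compatible maps. $\mathcal{G}$ is the set of all finite simple graphs (on arbitrary non-empty finite sets of positive integers), $\mathcal{K}$ is the set of complete graphs $K_m$, $m\ge 2$, and $\mathbb{N}_0$ is the set of non-negative integers. A map $\Psi:\mathcal{K}\times\mathcal{G}\to\mathbb{N}_0$ is $d$-compatible if for all $K_m\in\mathcal{K}$ and $G\in\mathcal{G}$: (1) if $G=\bigsqcup_{i=1}^{t}K_{n_i}$ is a disjoint union of complete graphs (with $n_i\ge1$), then $\Psi(K_m,G)\le t(m-1)+\sum_{i=1}^t n_i$; (2) if $G$ is not a disjoint union of complete graphs, then there exists a non-free vertex $v\in V(G)$ such that (a) $\Psi(K_m,G-v)\ge\Psi(K_m,G)$, (b) $\Psi(K_m,G_v)\ge\Psi(K_m,G)$, and (c) $\Psi(K_m,G_v-v)\ge\Psi(K_m,G)-1$. *)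

theory Defs
  imports
    Complex_Main
    "HOL-Library.Extended_Nat"
    "HOL-Library.Poly_Mapping"
    "HOL-Library.Disjoint_Sets"
    "HOL-Algebra.Algebra"
begin

section \<open>Finite simple graphs\<close>

record ugraph =
  verts :: "nat set"
  edges :: "nat set set"

definition simple_graph :: "ugraph \<Rightarrow> bool" where
  "simple_graph G \<longleftrightarrow>
     finite (verts G) \<and> (\<forall>e\<in>edges G. e \<subseteq> verts G \<and> card e = 2)"

definition graph_class :: "ugraph set" where
  "graph_class = {G. simple_graph G \<and> verts G \<noteq> {} \<and> verts G \<subseteq> {1..}}"

definition complete_graph :: "nat \<Rightarrow> ugraph" where
  "complete_graph m =
     \<lparr>verts = {1..m}, edges = {{u, v} | u v. u \<in> {1..m} \<and> v \<in> {1..m} \<and> u \<noteq> v}\<rparr>"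

definition is_complete :: "ugraph \<Rightarrow> bool" where
  "is_complete G \<longleftrightarrow> (\<forall>u\<in>verts G. \<forall>v\<in>verts G. u \<noteq> v \<longrightarrow> {u, v} \<in> edges G)"

definition nbhd :: "ugraph \<Rightarrow> nat \<Rightarrow> nat set" where
  "nbhd G v = {u. {u, v} \<in> edges G}"

definition induced_graph :: "ugraph \<Rightarrow> nat set \<Rightarrow> ugraph" where
  "induced_graph G A = \<lparr>verts = verts G \<inter> A, edges = {e \<in> edges G. e \<subseteq> A}\<rparr>"

definition free_vertex :: "ugraph \<Rightarrow> nat \<Rightarrow> bool" where
  "free_vertex G v \<longleftrightarrow> is_complete (induced_graph G (nbhd G v))"

definition del_vertex :: "ugraph \<Rightarrow> nat \<Rightarrow> ugraph" where
  "del_vertex G v = induced_graph G (verts G - {v})"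

text \<open>The graph $G_v$.\<close>

definition complete_at :: "ugraph \<Rightarrow> nat \<Rightarrow> ugraph" where
  "complete_at G v =
     \<lparr>verts = verts G,
      edges = edges G \<union> {{u, w} | u w. u \<in> nbhd G v \<and> w \<in> nbhd G v \<and> u \<noteq> w}\<rparr>"

definition is_path :: "ugraph \<Rightarrow> nat list \<Rightarrow> nat \<Rightarrow> nat \<Rightarrow> bool" where
  "is_path G p u v \<longleftrightarrow>
     p \<noteq> [] \<and> hd p = u \<and> last p = v \<and> distinct p \<and> set p \<subseteq> verts G \<and>
     successively (\<lambda>a b. {a, b} \<in> edges G) p"

definition components :: "ugraph \<Rightarrow> ugraph set" where
  "components G = {induced_graph G {w. \<exists>p. is_path G p u w} | u. u \<in> verts G}"

text \<open>The length of a path is its number of edges; the distance is only used for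
  vertices of one connected component.\<close>

definition distance :: "ugraph \<Rightarrow> nat \<Rightarrow> nat \<Rightarrow> nat" where
  "distance G u v = (LEAST k. \<exists>p. is_path G p u v \<and> length p = Suc k)"

definition diam :: "ugraph \<Rightarrow> nat" where
  "diam G = Max {distance G u v | u v. u \<in> verts G \<and> v \<in> verts G}"

definition num_components :: "ugraph \<Rightarrow> nat" where
  "num_components G = card (components G)"

definition num_free :: "ugraph \<Rightarrow> nat" where
  "num_free G = card {v \<in> verts G. free_vertex G v}"

definition num_isolated :: "ugraph \<Rightarrow> nat" where
  "num_isolated G = card {v \<in> verts G. nbhd G v = {}}"

definition diam_sum :: "ugraph \<Rightarrow> nat" where
  "diam_sum G = num_isolated G + (\<Sum>H\<in>components G. diam H)"

text \<open>The graph \<open>G\<close> is the disjoint union of the complete graphs on the blocks of \<open>P\<close>.\<close>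

definition complete_union :: "ugraph \<Rightarrow> nat set set \<Rightarrow> bool" where
  "complete_union G P \<longleftrightarrow>
     partition_on (verts G) P \<and>
     edges G = {{u, v} | u v A. A \<in> P \<and> u \<in> A \<and> v \<in> A \<and> u \<noteq> v}"

text \<open>Only the values \<open>\<Psi> (complete_graph m) G\<close> with \<open>m \<ge> 2\<close> and \<open>G \<in> graph_class\<close> matter.
  Condition (c) is written without subtraction.\<close>

definition d_compatible :: "(ugraph \<Rightarrow> ugraph \<Rightarrow> nat) \<Rightarrow> bool" where
  "d_compatible \<Psi> \<longleftrightarrow>
     (\<forall>m G. 2 \<le> m \<and> G \<in> graph_class \<longrightarrow>
        (\<forall>P. complete_union G P \<longrightarrow>
           \<Psi> (complete_graph m) G \<le> card P * (m - 1) + (\<Sum>A\<in>P. card A)) \<and>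
        ((\<nexists>P. complete_union G P) \<longrightarrow>
           (\<exists>v\<in>verts G. \<not> free_vertex G v \<and>
              \<Psi> (complete_graph m) (del_vertex G v) \<ge> \<Psi> (complete_graph m) G \<and>
              \<Psi> (complete_graph m) (complete_at G v) \<ge> \<Psi> (complete_graph m) G \<and>
              \<Psi> (complete_graph m) (del_vertex (complete_at G v) v) + 1
                \<ge> \<Psi> (complete_graph m) G)))"


section \<open>Modules and local cohomology\<close>

text \<open>The module record of HOL-Algebra extends the ring record, so it has fields \<open>mult\<close> and
  \<open>one\<close> that mean nothing for a module; they have arbitrary values below.\<close>

definition ring_as_module :: "('a, 'b) ring_scheme \<Rightarrow> ('a, 'a) module" where
  "ring_as_module R =
     \<lparr>carrier = carrier R, monoid.mult = (\<otimes>\<^bsub>R\<^esub>), one = \<one>\<^bsub>R\<^esub>, ring.zero = \<zero>\<^bsub>R\<^esub>,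
      ring.add = (\<oplus>\<^bsub>R\<^esub>), smult = (\<otimes>\<^bsub>R\<^esub>)\<rparr>"

definition quotient_module :: "('a, 'm, 'c) module_scheme \<Rightarrow> 'm set \<Rightarrow> ('a, 'm set) module" where
  "quotient_module M N =
     \<lparr>carrier = a_rcosets\<^bsub>M\<^esub> N, monoid.mult = (\<lambda>_ _. N), one = N, ring.zero = N,
      ring.add = set_add M, smult = (\<lambda>r U. \<Union>x\<in>U. N +>\<^bsub>M\<^esub> (r \<odot>\<^bsub>M\<^esub> x))\<rparr>"

text \<open>The fraction \<open>u / f^a\<close>, as the set of all pairs \<open>(v, b)\<close> with \<open>v / f^b = u / f^a\<close>.\<close>

definition fraction ::
  "('a, 'b) ring_scheme \<Rightarrow> ('a, 'm, 'c) module_scheme \<Rightarrow> 'a \<Rightarrow> 'm \<Rightarrow> nat \<Rightarrow> ('m \<times> nat) set" where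
  "fraction R M f u a =
     {(v, b). v \<in> carrier M \<and>
        (\<exists>c. (f [^]\<^bsub>R\<^esub> (c + b)) \<odot>\<^bsub>M\<^esub> u = (f [^]\<^bsub>R\<^esub> (c + a)) \<odot>\<^bsub>M\<^esub> v)}"

text \<open>The localization of \<open>M\<close> at the powers of \<open>f\<close>. As usual for operations on equivalence classes,
  the unions are over all representatives and all their members are equal.\<close>

definition localization ::
  "('a, 'b) ring_scheme \<Rightarrow> ('a, 'm, 'c) module_scheme \<Rightarrow> 'a \<Rightarrow> ('a, ('m \<times> nat) set) module" where
  "localization R M f =
     \<lparr>carrier = {fraction R M f u a | u a. u \<in> carrier M},
      monoid.mult = (\<lambda>_ _. fraction R M f \<zero>\<^bsub>M\<^esub> 0), one = fraction R M f \<zero>\<^bsub>M\<^esub> 0,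
      ring.zero = fraction R M f \<zero>\<^bsub>M\<^esub> 0,
      ring.add = (\<lambda>U V. \<Union>(u, a)\<in>U. \<Union>(v, b)\<in>V.
        fraction R M f ((f [^]\<^bsub>R\<^esub> b) \<odot>\<^bsub>M\<^esub> u \<oplus>\<^bsub>M\<^esub> (f [^]\<^bsub>R\<^esub> a) \<odot>\<^bsub>M\<^esub> v) (a + b)),
      smult = (\<lambda>r U. \<Union>(u, a)\<in>U. fraction R M f (r \<odot>\<^bsub>M\<^esub> u) a)\<rparr>"

text \<open>The canonical map from the localization at \<open>f\<close> to the localization at \<open>f * g\<close>, which sends
  \<open>u / f^a\<close> to \<open>g^a u / (f * g)^a\<close>.\<close>

definition loc_map ::
  "('a, 'b) ring_scheme \<Rightarrow> ('a, 'm, 'c) module_scheme \<Rightarrow> 'a \<Rightarrow> 'a \<Rightarrow>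
     ('m \<times> nat) set \<Rightarrow> ('m \<times> nat) set" where
  "loc_map R M f g U =
     (\<Union>(u, a)\<in>U. fraction R M (f \<otimes>\<^bsub>R\<^esub> g) ((g [^]\<^bsub>R\<^esub> a) \<odot>\<^bsub>M\<^esub> u) a)"

text \<open>The Cech complex of \<open>M\<close> on a sequence \<open>xs\<close> of ring elements. Its term in degree \<open>p\<close> is the direct
  sum of the localizations of \<open>M\<close> at the products of \<open>p\<close> members of \<open>xs\<close> (at distinct positions),
  so that the term in degree \<open>0\<close> is \<open>M\<close> localized at \<open>1\<close>.\<close>

definition cech_index :: "'a list \<Rightarrow> nat \<Rightarrow> nat set set" where
  "cech_index xs p = {I. I \<subseteq> {..<length xs} \<and> card I = p}"

definition index_prod :: "('a, 'b) ring_scheme \<Rightarrow> 'a list \<Rightarrow> nat set \<Rightarrow> 'a" where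
  "index_prod R xs I = finprod R (\<lambda>i. xs ! i) I"

definition cech_term ::
  "('a, 'b) ring_scheme \<Rightarrow> 'a list \<Rightarrow> ('a, 'm, 'c) module_scheme \<Rightarrow> nat \<Rightarrow>
     ('a, nat set \<Rightarrow> ('m \<times> nat) set) module" where
  "cech_term R xs M p =
     (let L = (\<lambda>I. localization R M (index_prod R xs I));
          z = (\<lambda>I\<in>cech_index xs p. \<zero>\<^bsub>L I\<^esub>)
      in \<lparr>carrier = (\<Pi>\<^sub>E I\<in>cech_index xs p. carrier (L I)),
          monoid.mult = (\<lambda>_ _. z), one = z, ring.zero = z,
          ring.add = (\<lambda>c c'. \<lambda>I\<in>cech_index xs p. c I \<oplus>\<^bsub>L I\<^esub> c' I),
          smult = (\<lambda>r c. \<lambda>I\<in>cech_index xs p. r \<odot>\<^bsub>L I\<^esub> c I)\<rparr>)"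

definition cech_diff ::
  "('a, 'b) ring_scheme \<Rightarrow> 'a list \<Rightarrow> ('a, 'm, 'c) module_scheme \<Rightarrow> nat \<Rightarrow>
     (nat set \<Rightarrow> ('m \<times> nat) set) \<Rightarrow> (nat set \<Rightarrow> ('m \<times> nat) set)" where
  "cech_diff R xs M p c =
     (\<lambda>J\<in>cech_index xs (Suc p).
        let L = localization R M (index_prod R xs J)
        in finsum L
             (\<lambda>j. let y = loc_map R M (index_prod R xs (J - {j})) (xs ! j) (c (J - {j}))
                  in if even (card {k \<in> J. k < j}) then y else \<ominus>\<^bsub>L\<^esub> y) J)"

definition cech_cocycles ::
  "('a, 'b) ring_scheme \<Rightarrow> 'a list \<Rightarrow> ('a, 'm, 'c) module_scheme \<Rightarrow> nat \<Rightarrow>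
     (nat set \<Rightarrow> ('m \<times> nat) set) set" where
  "cech_cocycles R xs M p =
     {c \<in> carrier (cech_term R xs M p).
        cech_diff R xs M p c = \<zero>\<^bsub>cech_term R xs M (Suc p)\<^esub>}"

definition cech_coboundaries ::
  "('a, 'b) ring_scheme \<Rightarrow> 'a list \<Rightarrow> ('a, 'm, 'c) module_scheme \<Rightarrow> nat \<Rightarrow>
     (nat set \<Rightarrow> ('m \<times> nat) set) set" where
  "cech_coboundaries R xs M p =
     (case p of
        0 \<Rightarrow> {\<zero>\<^bsub>cech_term R xs M 0\<^esub>}
      | Suc q \<Rightarrow> cech_diff R xs M q ` carrier (cech_term R xs M q))"

text \<open>The local cohomology module of \<open>M\<close> in degree \<open>p\<close> with support in the ideal generated by \<open>xs\<close>,
  for a Noetherian ring \<open>R\<close>: the cohomology of the Cech complex on \<open>xs\<close>.\<close>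

definition local_cohomology ::
  "('a, 'b) ring_scheme \<Rightarrow> 'a list \<Rightarrow> ('a, 'm, 'c) module_scheme \<Rightarrow> nat \<Rightarrow>
     ('a, (nat set \<Rightarrow> ('m \<times> nat) set) set) module" where
  "local_cohomology R xs M p =
     quotient_module ((cech_term R xs M p)\<lparr>carrier := cech_cocycles R xs M p\<rparr>)
       (cech_coboundaries R xs M p)"

text \<open>The infimum is a minimum unless all local cohomology modules vanish, and then it is \<open>\<infinity>\<close>.\<close>

definition depth ::
  "('a, 'b) ring_scheme \<Rightarrow> 'a list \<Rightarrow> ('a, 'm, 'c) module_scheme \<Rightarrow> enat" where
  "depth R xs M =
     Inf {enat i | i.
       carrier (local_cohomology R xs M i) \<noteq> {\<zero>\<^bsub>local_cohomology R xs M i\<^esub>}}"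


section \<open>Generalized binomial edge ideals\<close>

text \<open>Polynomials in variables indexed by \<open>nat \<times> nat\<close>: finitely supported functions from monomials
  (exponent vectors) to coefficients, with the convolution product.\<close>

type_synonym 'k mpoly = "((nat \<times> nat) \<Rightarrow>\<^sub>0 nat) \<Rightarrow>\<^sub>0 'k"

definition xvar :: "nat \<Rightarrow> nat \<Rightarrow> 'k::field mpoly" where
  "xvar i j = Poly_Mapping.single (Poly_Mapping.single (i, j) 1) 1"

definition mpoly_ring :: "nat \<Rightarrow> nat \<Rightarrow> 'k::field mpoly ring" where
  "mpoly_ring m n =
     \<lparr>carrier = {p. \<forall>t\<in>Poly_Mapping.keys p. Poly_Mapping.keys t \<subseteq> {1..m} \<times> {1..n}},
      monoid.mult = (*), one = 1, ring.zero = 0, ring.add = (+)\<rparr>"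

text \<open>The variables of \<open>mpoly_ring m n\<close>; they generate its homogeneous maximal ideal.\<close>

definition xvars :: "nat \<Rightarrow> nat \<Rightarrow> 'k::field mpoly list" where
  "xvars m n = [xvar i j. i \<leftarrow> [1..<Suc m], j \<leftarrow> [1..<Suc n]]"

text \<open>The ideal for \<open>K_m\<close> and \<open>G\<close>, where \<open>G\<close> has vertex set \<open>{1..n}\<close>.\<close>

definition binomial_edge_ideal :: "nat \<Rightarrow> nat \<Rightarrow> ugraph \<Rightarrow> 'k::field mpoly set" where
  "binomial_edge_ideal m n G =
     Idl\<^bsub>mpoly_ring m n\<^esub>
       {xvar i k * xvar j l - xvar i l * xvar j k | i j k l.
          1 \<le> i \<and> i < j \<and> j \<le> m \<and> {k, l} \<in> edges G \<and> k < l}"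

definition edge_quotient :: "nat \<Rightarrow> nat \<Rightarrow> ugraph \<Rightarrow> ('k::field mpoly, 'k mpoly set) module" where
  "edge_quotient m n G =
     quotient_module (ring_as_module (mpoly_ring m n)) (binomial_edge_ideal m n G)"

end

theory Submission
  imports Defs
begin

text \<open>
  Why the theorem holds.

  \<^bold>\<open>Vanishing of local cohomology.\<close> A Cech cochain of \<open>S/J\<close> on the variables \<open>x\<^sub>1, \<dots>, x\<^sub>r\<close> has
  finitely many entries, so they have a common exponent \<open>N\<close> in the denominators, and the numerators
  form a cochain of the Koszul complex on \<open>x\<^sub>1\<^sup>N, \<dots>, x\<^sub>r\<^sup>N\<close>. Local cohomology is thus the limit of the
  Koszul cohomologies, and it vanishes below \<open>d\<close> as soon as every Koszul cocycle of degree less than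
  \<open>d\<close> becomes a coboundary for some larger \<open>N\<close> (\<open>cohomology_vanishes_below\<close>,
  \<open>depth_lower_bound\<close>). This condition only speaks of families of polynomials. Two rules
  estimate it: \<open>vanishes_below_intersection\<close>, which is the long exact sequence of
  \<open>0 \<rightarrow> S/(I \<inter> J) \<rightarrow> S/I \<oplus> S/J \<rightarrow> S/(I + J) \<rightarrow> 0\<close>, and \<open>vanishes_below_regular\<close>, by which a variable that is
  a nonzerodivisor modulo \<open>J\<close> raises the bound by one.

  \<^bold>\<open>The depth bound.\<close> For every vertex \<open>v\<close>, with \<open>X\<^sub>v\<close> the set of variables of column \<open>v\<close>,
  the ideal \<open>J\<^sub>G\<close> is the intersection of \<open>J(G\<^sub>v)\<close> and \<open>(X\<^sub>v) + J(G - v)\<close>, and the sum of these two ideals is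
  \<open>(X\<^sub>v) + J(G\<^sub>v - v)\<close>. Indeed, the product of a variable in \<open>X\<^sub>v\<close> with a minor on two
  neighbours of \<open>v\<close> lies in \<open>J\<^sub>G\<close>, and setting the variables in \<open>X\<^sub>v\<close> to zero maps \<open>J\<^sub>G\<close> to itself; these
  two facts give the intersection (\<open>span_intersection_by_kill\<close>). The three inequalities of a
  d-compatible map are exactly what the exact sequence asks for, so the bound follows by induction
  (\<open>vanishes_d_compatible\<close>).

  The induction ends with disjoint unions of complete graphs. There the same splitting is used for
  ideals of 2-minors of disjoint blocks \<open>A\<^sub>i \<times> B\<^sub>i\<close> (\<open>vanishes_blocks\<close>): the variable \<open>x\<^sub>a\<^sub>b\<close> of a block is a
  nonzerodivisor, because two monomials in the variables of the blocks are congruent modulo the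
  ideal exactly when they have the same row and column degrees, and the ideal together with \<open>x\<^sub>a\<^sub>b\<close> is the intersection of the ideal without row
  \<open>a\<close> and the ideal without column \<open>b\<close> of this block. By induction the depth is at least the sum of
  \<open>|A\<^sub>i| + |B\<^sub>i| - 1\<close>.

  \<^bold>\<open>The d-compatible map.\<close> The number \<open>(m - 2) t + f + d\<close> is additive over disjoint unions, and for
  complete graphs it is small enough. This leaves a connected graph of diameter \<open>D \<ge> 2\<close>; let
  \<open>f 0, \<dots>, f D\<close> be a geodesic. Its interior vertices \<open>v\<close> are not free. In \<open>G\<^sub>v\<close> free vertices stay free,
  \<open>v\<close> becomes free, and distances drop by at most one, which gives the inequalities for \<open>G\<^sub>v\<close> and
  \<open>G\<^sub>v - v\<close> for every interior \<open>v\<close>. Only \<open>G - v\<close> requires a choice of \<open>v\<close>. If \<open>G - v\<close> still connects the ends,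
  their distance has not dropped. Otherwise \<open>G - f j\<close> has a component on each side, with
  diameters at least \<open>j - 1\<close> and \<open>D - j - 1\<close>, and up to two units must be recovered. Take the least \<open>j\<close>
  for which nothing is lost on the side of \<open>f D\<close>. If the other side loses a unit, then
  the minimality of \<open>j\<close> leaves so few neighbours to \<open>f (j - 1)\<close> that it becomes a free vertex of
  \<open>G - f j\<close>, or else \<open>j = 2\<close> and \<open>f 1\<close> can be deleted instead (\<open>exists_deletable\<close>).
\<close>

abbreviation "single \<equiv> Poly_Mapping.single"
abbreviation "keys \<equiv> Poly_Mapping.keys"
abbreviation "lookup \<equiv> Poly_Mapping.lookup"

section \<open>Koszul cohomology in the limit\<close>

text \<open>Ideals are the submodules of the ring, regarded as a module over itself.\<close>

interpretation idl: Modules.module "(*) :: 'a::comm_ring_1 \<Rightarrow> 'a \<Rightarrow> 'a"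
  by unfold_locales (simp_all add: algebra_simps)

(* this rule and mult.assoc rewrite in opposite directions *)
declare idl.scale_scale [simp del]

definition koszul_sign :: "nat set \<Rightarrow> nat \<Rightarrow> 'a::comm_ring_1" where
  "koszul_sign I j = (if even (card {k \<in> I. k < j}) then 1 else -1)"

text \<open>Families indexed by all sets of positions are used instead of graded pieces: the degree of a
  cochain enters only as the cardinality of the sets at which a condition is imposed.\<close>

definition koszul_diff :: "(nat \<Rightarrow> 'a::comm_ring_1) \<Rightarrow> (nat set \<Rightarrow> 'a) \<Rightarrow> nat set \<Rightarrow> 'a" where
  "koszul_diff y u I = (\<Sum>j\<in>I. koszul_sign I j * y j * u (I - {j}))"

lemma koszul_sign_square [simp]: "koszul_sign I j * koszul_sign I j = 1"
  by (simp add: koszul_sign_def)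

lemma koszul_sign_remove_smaller:
  assumes "finite I" "j \<in> I" "j < k"
  shows "koszul_sign (I - {j}) k = - koszul_sign I k"
proof -
  have "{i \<in> I. i < k} = insert j {i \<in> I - {j}. i < k}"
    using assms by auto
  then have "card {i \<in> I. i < k} = Suc (card {i \<in> I - {j}. i < k})"
    using assms by simp
  then show ?thesis by (simp add: koszul_sign_def)
qed

lemma koszul_sign_remove_larger:
  assumes "k < j"
  shows "koszul_sign (I - {j}) k = koszul_sign I k"
proof -
  have "{i \<in> I - {j}. i < k} = {i \<in> I. i < k}"
    using assms by auto
  then show ?thesis by (simp add: koszul_sign_def)
qed

lemma koszul_sign_swap:
  assumes "finite I" "j \<in> I" "k \<in> I" "j \<noteq> k"
  shows "koszul_sign I j * koszul_sign (I - {j}) k = - (koszul_sign I k * koszul_sign (I - {k}) j :: 'a::comm_ring_1)"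
proof (cases "j < k")
  case True
  show ?thesis
    unfolding koszul_sign_remove_smaller[OF assms(1,2) True] koszul_sign_remove_larger[OF True]
    by (simp add: mult.commute)
next
  case False
  then have less: "k < j" using assms by simp
  show ?thesis
    unfolding koszul_sign_remove_smaller[OF assms(1,3) less] koszul_sign_remove_larger[OF less]
    by (simp add: mult.commute)
qed

lemma sum_antisymmetric:
  fixes g :: "'i \<Rightarrow> 'i \<Rightarrow> 'a::ab_group_add"
  assumes "finite I" "\<And>j. j \<in> I \<Longrightarrow> g j j = 0"
    and "\<And>j k. j \<in> I \<Longrightarrow> k \<in> I \<Longrightarrow> j \<noteq> k \<Longrightarrow> g j k = - g k j"
  shows "(\<Sum>j\<in>I. \<Sum>k\<in>I. g j k) = 0"
  using assms
proof (induction I rule: finite_induct)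
  case (insert i I)
  have "(\<Sum>k\<in>I. g i k) + (\<Sum>j\<in>I. g j i) = (\<Sum>k\<in>I. g i k + g k i)"
    by (simp add: sum.distrib)
  also have "\<dots> = 0"
  proof (rule sum.neutral, rule ballI)
    fix k assume "k \<in> I"
    then have "g i k = - g k i" using insert by blast
    then show "g i k + g k i = 0" by simp
  qed
  finally have cross: "(\<Sum>k\<in>I. g i k) + (\<Sum>j\<in>I. g j i) = 0" .
  have "(\<Sum>j\<in>insert i I. \<Sum>k\<in>insert i I. g j k)
      = g i i + ((\<Sum>k\<in>I. g i k) + (\<Sum>j\<in>I. g j i)) + (\<Sum>j\<in>I. \<Sum>k\<in>I. g j k)"
    using insert(1,2) by (simp add: sum.distrib add_ac)
  moreover have "g i i = 0" "(\<Sum>j\<in>I. \<Sum>k\<in>I. g j k) = 0"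
    using insert.prems by (auto intro!: insert.IH)
  ultimately show ?case by (simp only: cross add_0)
next
  case empty
  show ?case by simp
qed

lemma koszul_diff_square:
  assumes "finite I"
  shows "koszul_diff y (koszul_diff y u) I = 0"
proof -
  define g where "g j k = (if k = j then 0 else
    koszul_sign I j * koszul_sign (I - {j}) k * (y j * y k * u (I - {j} - {k})))" for j k
  have "koszul_sign I j * y j * koszul_diff y u (I - {j}) = (\<Sum>k\<in>I. g j k)" if "j \<in> I" for j
  proof -
    have "(\<Sum>k\<in>I. g j k) = (\<Sum>k\<in>I - {j}. g j k)"
      using assms that by (intro sum.mono_neutral_right) (auto simp: g_def)
    also have "\<dots> = koszul_sign I j * y j * koszul_diff y u (I - {j})"
      unfolding koszul_diff_def sum_distrib_left
      by (intro sum.cong) (auto simp: g_def mult_ac)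
    finally show ?thesis by simp
  qed
  then have "koszul_diff y (koszul_diff y u) I = (\<Sum>j\<in>I. \<Sum>k\<in>I. g j k)"
    by (subst koszul_diff_def) (rule sum.cong[OF refl])
  also have "\<dots> = 0"
  proof (rule sum_antisymmetric[OF assms])
    fix j k assume jk: "j \<in> I" "k \<in> I" "j \<noteq> k"
    have "g j k = koszul_sign I j * koszul_sign (I - {j}) k * (y j * y k * u (I - {j} - {k}))"
      using jk by (simp add: g_def)
    also have "\<dots> = - (koszul_sign I k * koszul_sign (I - {k}) j) * (y k * y j * u (I - {k} - {j}))"
      by (simp only: koszul_sign_swap[OF assms jk] mult.commute[of "y j"] Diff_insert2[symmetric] insert_commute)
    also have "\<dots> = - g k j"
      using jk by (simp add: g_def)
    finally show "g j k = - g k j" .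
  qed (simp add: g_def)
  finally show ?thesis .
qed

lemma koszul_diff_empty [simp]: "koszul_diff y u {} = 0"
  by (simp add: koszul_diff_def)

lemma koszul_diff_add: "koszul_diff y (\<lambda>I. u I + v I) I = koszul_diff y u I + koszul_diff y v I"
  by (simp add: koszul_diff_def sum.distrib algebra_simps)

lemma koszul_diff_diff: "koszul_diff y (\<lambda>I. u I - v I) I = koszul_diff y u I - koszul_diff y v I"
  by (simp add: koszul_diff_def sum_subtractf algebra_simps)

lemma koszul_diff_scale: "koszul_diff y (\<lambda>I. c * u I) I = c * koszul_diff y u I"
  by (simp add: koszul_diff_def sum_distrib_left mult_ac)

lemma koszul_diff_in_ideal:
  assumes "idl.subspace J" "\<And>j. j \<in> I \<Longrightarrow> u (I - {j}) \<in> J"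
  shows "koszul_diff y u I \<in> J"
  unfolding koszul_diff_def using assms by (intro idl.subspace_sum idl.subspace_scale)

text \<open>Contraction with position \<open>a\<close> is a homotopy from multiplication by \<open>y a\<close> to zero. Hence
  every class of the limit cohomology is killed by a power of every variable of the sequence.\<close>

lemma koszul_diff_homotopy:
  fixes u :: "nat set \<Rightarrow> 'a::comm_ring_1" and a :: nat
  assumes "finite I"
  defines "h \<equiv> \<lambda>(w :: nat set \<Rightarrow> 'a) I. if a \<in> I then 0 else koszul_sign (insert a I) a * w (insert a I)"
  shows "koszul_diff y (h u) I + h (koszul_diff y u) I = y a * u I"
proof (cases "a \<in> I")
  case True
  have "koszul_diff y (h u) I = (\<Sum>j\<in>{a}. koszul_sign I j * y j * h u (I - {j}))"
    unfolding koszul_diff_def using assms True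
    by (intro sum.mono_neutral_right) (auto simp: h_def)
  also have "\<dots> = (koszul_sign I a * koszul_sign I a) * (y a * u I)"
    using True by (simp add: h_def insert_absorb mult_ac)
  finally show ?thesis using True by (simp add: h_def)
next
  case False
  define K where "K = insert a I"
  have K: "finite K" "a \<in> K" "K - {a} = I" using False assms by (auto simp: K_def)
  have swap: "koszul_sign I j * koszul_sign (K - {j}) a = - (koszul_sign K a * koszul_sign K j :: 'a)"
    if "j \<in> I" for j
  proof -
    have "j \<in> K" "j \<noteq> a" using that False by (auto simp: K_def)
    then have "koszul_sign K j * koszul_sign (K - {j}) a = - (koszul_sign K a * koszul_sign I j :: 'a)"
      using koszul_sign_swap[of K j a, where 'a='a] K by simp
    then have "koszul_sign K j * (koszul_sign K j * koszul_sign (K - {j}) a) * koszul_sign I j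
      = - (koszul_sign K j * (koszul_sign K a * koszul_sign I j) * koszul_sign I j :: 'a)"
      by simp
    moreover have "koszul_sign K j * (koszul_sign K j * koszul_sign (K - {j}) a) * koszul_sign I j
      = (koszul_sign K j * koszul_sign K j) * (koszul_sign I j * koszul_sign (K - {j}) a :: 'a)"
      by (simp only: mult_ac)
    moreover have "koszul_sign K j * (koszul_sign K a * koszul_sign I j) * koszul_sign I j
      = (koszul_sign I j * koszul_sign I j) * (koszul_sign K a * koszul_sign K j :: 'a)"
      by (simp only: mult_ac)
    ultimately show ?thesis by simp
  qed
  have "h (koszul_diff y u) I = koszul_sign K a * koszul_diff y u K"
    using False by (simp add: h_def K_def)
  also have "koszul_diff y u K = koszul_sign K a * y a * u I
      + (\<Sum>j\<in>I. koszul_sign K j * y j * u (K - {j}))"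
    unfolding koszul_diff_def using K False assms by (simp add: sum.remove[of K a])
  finally have "h (koszul_diff y u) I = (koszul_sign K a * koszul_sign K a) * (y a * u I)
      + (\<Sum>j\<in>I. (koszul_sign K a * koszul_sign K j) * (y j * u (K - {j})))"
    by (simp only: distrib_left sum_distrib_left mult_ac)
  moreover have "koszul_diff y (h u) I = (\<Sum>j\<in>I. - (koszul_sign K a * koszul_sign K j) * (y j * u (K - {j})))"
    unfolding koszul_diff_def
  proof (rule sum.cong)
    fix j assume j: "j \<in> I"
    then have "insert a (I - {j}) = K - {j}" "a \<notin> I - {j}" using False by (auto simp: K_def)
    then have "koszul_sign I j * y j * h u (I - {j})
        = (koszul_sign I j * koszul_sign (K - {j}) a) * (y j * u (K - {j}))"
      using False by (simp add: h_def mult_ac)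
    then show "koszul_sign I j * y j * h u (I - {j}) = - (koszul_sign K a * koszul_sign K j) * (y j * u (K - {j}))"
      by (simp only: swap[OF j])
  qed simp
  ultimately show ?thesis by (simp add: sum_negf)
qed

text \<open>Multiplication of a cochain at \<open>I\<close> by a power of \<open>x\<^sub>I\<close> is the transition map between the
  Koszul complexes on \<open>x\<^sup>N\<close> and on \<open>x\<^bsup>N+e\<^esup>\<close>; it corresponds to expanding a fraction.\<close>

lemma koszul_diff_transition:
  fixes x :: "nat \<Rightarrow> 'a::comm_ring_1"
  assumes "finite I"
  shows "koszul_diff (\<lambda>j. x j ^ (N + e)) (\<lambda>I. (\<Prod>i\<in>I. x i) ^ e * u I) I
    = (\<Prod>i\<in>I. x i) ^ e * koszul_diff (\<lambda>j. x j ^ N) u I"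
  unfolding koszul_diff_def sum_distrib_left
proof (rule sum.cong)
  fix j assume "j \<in> I"
  then have "(\<Prod>i\<in>I. x i) = x j * (\<Prod>i\<in>I - {j}. x i)"
    using assms by (simp add: prod.remove)
  then have "(\<Prod>i\<in>I. x i) ^ e = x j ^ e * (\<Prod>i\<in>I - {j}. x i) ^ e"
    by (simp only: power_mult_distrib)
  then show "koszul_sign I j * x j ^ (N + e) * ((\<Prod>i\<in>I - {j}. x i) ^ e * u (I - {j}))
    = (\<Prod>i\<in>I. x i) ^ e * (koszul_sign I j * x j ^ N * u (I - {j}))"
    by (simp only: power_add mult_ac)
qed simp

text \<open>Cocycles with values in the quotient by \<open>J\<close>: all conditions are congruences modulo \<open>J\<close>
  between ring elements, so no quotient structure appears.\<close>

definition koszul_cocycle ::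
  "(nat \<Rightarrow> 'a::comm_ring_1) \<Rightarrow> nat \<Rightarrow> 'a set \<Rightarrow> nat \<Rightarrow> nat \<Rightarrow> (nat set \<Rightarrow> 'a) \<Rightarrow> bool" where
  "koszul_cocycle x r J p N u \<longleftrightarrow>
     (\<forall>I\<subseteq>{..<r}. card I = Suc p \<longrightarrow> koszul_diff (\<lambda>j. x j ^ N) u I \<in> J)"

text \<open>The class of \<open>u\<close> vanishes in the direct limit over \<open>N\<close>. For \<open>p = 0\<close> the differential
  contributes nothing and the condition says that \<open>u\<close> is zero modulo \<open>J\<close>.\<close>

definition dies_in_limit ::
  "(nat \<Rightarrow> 'a::comm_ring_1) \<Rightarrow> nat \<Rightarrow> 'a set \<Rightarrow> nat \<Rightarrow> nat \<Rightarrow> (nat set \<Rightarrow> 'a) \<Rightarrow> bool" where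
  "dies_in_limit x r J p N u \<longleftrightarrow>
     (\<exists>e v. \<forall>I\<subseteq>{..<r}. card I = p \<longrightarrow>
        (\<Prod>i\<in>I. x i) ^ e * u I - koszul_diff (\<lambda>j. x j ^ (N + e)) v I \<in> J)"

definition cohomology_vanishes_below ::
  "(nat \<Rightarrow> 'a::comm_ring_1) \<Rightarrow> nat \<Rightarrow> 'a set \<Rightarrow> nat \<Rightarrow> bool" where
  "cohomology_vanishes_below x r J d \<longleftrightarrow>
     (\<forall>p<d. \<forall>N u. koszul_cocycle x r J p N u \<longrightarrow> dies_in_limit x r J p N u)"

abbreviation shift :: "(nat \<Rightarrow> 'a::comm_ring_1) \<Rightarrow> nat \<Rightarrow> (nat set \<Rightarrow> 'a) \<Rightarrow> nat set \<Rightarrow> 'a" where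
  "shift x e u \<equiv> (\<lambda>I. (\<Prod>i\<in>I. x i) ^ e * u I)"

lemma dies_in_limit_shift:
  assumes "dies_in_limit x r J p (N + e) (shift x e u)"
  shows "dies_in_limit x r J p N u"
proof -
  obtain f v where v: "\<And>I. I \<subseteq> {..<r} \<Longrightarrow> card I = p \<Longrightarrow>
      (\<Prod>i\<in>I. x i) ^ f * shift x e u I - koszul_diff (\<lambda>j. x j ^ (N + e + f)) v I \<in> J"
    using assms unfolding dies_in_limit_def by blast
  show ?thesis
    unfolding dies_in_limit_def
    by (rule exI[of _ "e + f"], rule exI[of _ v]) (use v in \<open>simp add: power_add mult_ac add_ac\<close>)
qed

text \<open>A witness persists for all later exponents, so finitely many classes can be killed at the
  same exponent.\<close>

lemma dies_in_limit_later:
  assumes "idl.subspace J" "dies_in_limit x r J p N u"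
  shows "\<exists>e0. \<forall>e\<ge>e0. \<exists>v. \<forall>I\<subseteq>{..<r}. card I = p \<longrightarrow>
        shift x e u I - koszul_diff (\<lambda>j. x j ^ (N + e)) v I \<in> J"
proof -
  obtain e0 v where v: "\<And>I. I \<subseteq> {..<r} \<Longrightarrow> card I = p \<Longrightarrow>
      shift x e0 u I - koszul_diff (\<lambda>j. x j ^ (N + e0)) v I \<in> J"
    using assms(2) unfolding dies_in_limit_def by blast
  have "shift x e u I - koszul_diff (\<lambda>j. x j ^ (N + e)) (shift x (e - e0) v) I \<in> J"
    if "e0 \<le> e" "I \<subseteq> {..<r}" "card I = p" for e I
  proof -
    have fin: "finite I" using that(2) by (meson finite_lessThan finite_subset)
    have e: "N + e = (N + e0) + (e - e0)" using that(1) by simp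
    have "shift x e u I = (\<Prod>i\<in>I. x i) ^ (e - e0) * shift x e0 u I"
      using that(1) by (metis (no_types, lifting) le_add_diff_inverse2 mult.assoc power_add)
    then have "shift x e u I - koszul_diff (\<lambda>j. x j ^ (N + e)) (shift x (e - e0) v) I
      = (\<Prod>i\<in>I. x i) ^ (e - e0) * (shift x e0 u I - koszul_diff (\<lambda>j. x j ^ (N + e0)) v I)"
      by (simp only: e koszul_diff_transition[OF fin] right_diff_distrib)
    then show ?thesis using v[OF that(2,3)] assms(1) by (simp add: idl.subspace_scale)
  qed
  then show ?thesis by blast
qed

lemma cohomology_vanishes_below_mono:
  "cohomology_vanishes_below x r J d \<Longrightarrow> d' \<le> d \<Longrightarrow> cohomology_vanishes_below x r J d'"
  unfolding cohomology_vanishes_below_def by auto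

text \<open>The step of the long exact sequence that bounds the depth of \<open>S/(I \<inter> J)\<close>. Primitives of the
  cocycle modulo \<open>I\<close> and modulo \<open>J\<close> differ by a cocycle modulo \<open>I + J\<close>, in one degree lower; once
  this difference is a coboundary, the primitives can be corrected to agree.\<close>

lemma vanishes_below_intersection:
  fixes x :: "nat \<Rightarrow> 'a::comm_ring_1"
  assumes d1: "cohomology_vanishes_below x r (idl.span A) d"
    and d2: "cohomology_vanishes_below x r (idl.span B) d"
    and d3: "cohomology_vanishes_below x r (idl.span (A \<union> B)) (d - 1)"
  shows "cohomology_vanishes_below x r (idl.span A \<inter> idl.span B) d"
  unfolding cohomology_vanishes_below_def
proof (intro allI impI)
  fix p N u assume p: "p < d" and u: "koszul_cocycle x r (idl.span A \<inter> idl.span B) p N u"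
  have uA: "koszul_cocycle x r (idl.span A) p N u" and uB: "koszul_cocycle x r (idl.span B) p N u"
    using u unfolding koszul_cocycle_def by auto
  obtain eA where eA: "\<forall>e\<ge>eA. \<exists>v. \<forall>I\<subseteq>{..<r}. card I = p \<longrightarrow>
        shift x e u I - koszul_diff (\<lambda>j. x j ^ (N + e)) v I \<in> idl.span A"
    using dies_in_limit_later[of "idl.span A"] d1 uA p unfolding cohomology_vanishes_below_def by blast
  obtain eB where eB: "\<forall>e\<ge>eB. \<exists>v. \<forall>I\<subseteq>{..<r}. card I = p \<longrightarrow>
        shift x e u I - koszul_diff (\<lambda>j. x j ^ (N + e)) v I \<in> idl.span B"
    using dies_in_limit_later[of "idl.span B"] d2 uB p unfolding cohomology_vanishes_below_def by blast
  define e where "e = max eA eB"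
  define M where "M = N + e"
  obtain vA where vA: "\<And>I. I \<subseteq> {..<r} \<Longrightarrow> card I = p \<Longrightarrow>
      shift x e u I - koszul_diff (\<lambda>j. x j ^ M) vA I \<in> idl.span A"
    using eA unfolding M_def e_def by (metis max.cobounded1)
  obtain vB where vB: "\<And>I. I \<subseteq> {..<r} \<Longrightarrow> card I = p \<Longrightarrow>
      shift x e u I - koszul_diff (\<lambda>j. x j ^ M) vB I \<in> idl.span B"
    using eB unfolding M_def e_def by (metis max.cobounded2)
  show "dies_in_limit x r (idl.span A \<inter> idl.span B) p N u"
  proof (cases p)
    case 0
    have "shift x e u {} \<in> idl.span A \<inter> idl.span B"
      using vA[of "{}"] vB[of "{}"] 0 by simp
    then show ?thesis unfolding dies_in_limit_def 0
      by (intro exI[of _ e] exI[of _ "\<lambda>_. 0"]) (auto simp: card_eq_0_iff dest: finite_subset)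
  next
    case (Suc q)
    \<comment> \<open>The primitives modulo the two ideals differ by a cocycle modulo their sum.\<close>
    have "koszul_cocycle x r (idl.span (A \<union> B)) q M (\<lambda>I. vA I - vB I)"
      unfolding koszul_cocycle_def
    proof (intro allI impI)
      fix I assume I: "I \<subseteq> {..<r}" "card I = Suc q"
      let ?d = "koszul_diff (\<lambda>j. x j ^ M)"
      have "shift x e u I - ?d vA I \<in> idl.span (A \<union> B)" "shift x e u I - ?d vB I \<in> idl.span (A \<union> B)"
        using vA[of I] vB[of I] I Suc idl.span_mono[of A "A \<union> B"] idl.span_mono[of B "A \<union> B"] by auto
      then have "(shift x e u I - ?d vB I) - (shift x e u I - ?d vA I) \<in> idl.span (A \<union> B)"
        by (rule idl.span_diff[rotated])
      then show "?d (\<lambda>I. vA I - vB I) I \<in> idl.span (A \<union> B)"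
        by (simp add: koszul_diff_diff)
    qed
    then have "dies_in_limit x r (idl.span (A \<union> B)) q M (\<lambda>I. vA I - vB I)"
      using d3 p Suc unfolding cohomology_vanishes_below_def by simp
    then obtain f w where w: "\<And>I. I \<subseteq> {..<r} \<Longrightarrow> card I = q \<Longrightarrow>
        shift x f (\<lambda>I. vA I - vB I) I - koszul_diff (\<lambda>j. x j ^ (M + f)) w I \<in> idl.span (A \<union> B)"
      unfolding dies_in_limit_def by blast
    let ?d = "koszul_diff (\<lambda>j. x j ^ (M + f))"
    have "\<forall>I. \<exists>a b. I \<subseteq> {..<r} \<longrightarrow> card I = q \<longrightarrow> a \<in> idl.span A \<and> b \<in> idl.span B \<and>
        shift x f (\<lambda>I. vA I - vB I) I - ?d w I = a + b"
      using w unfolding idl.span_Un by blast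
    then obtain a b where ab: "\<And>I. I \<subseteq> {..<r} \<Longrightarrow> card I = q \<Longrightarrow> a I \<in> idl.span A"
      "\<And>I. I \<subseteq> {..<r} \<Longrightarrow> card I = q \<Longrightarrow> b I \<in> idl.span B"
      "\<And>I. I \<subseteq> {..<r} \<Longrightarrow> card I = q \<Longrightarrow> shift x f (\<lambda>I. vA I - vB I) I - ?d w I = a I + b I"
      by metis
    \<comment> \<open>Modulo the second ideal this differs from \<open>vB\<close> by a coboundary, so it is a primitive modulo
      both ideals.\<close>
    define v where "v I = shift x f vA I - a I" for I
    have "shift x (e + f) u I - ?d v I \<in> idl.span A \<inter> idl.span B" if I: "I \<subseteq> {..<r}" "card I = p" for I
    proof -
      have fin: "finite I" using I by (meson finite_lessThan finite_subset)
      have sub: "I - {j} \<subseteq> {..<r}" "card (I - {j}) = q" if "j \<in> I" for j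
        using I Suc that fin by auto
      have shift_e: "shift x (e + f) u I = (\<Prod>i\<in>I. x i) ^ f * shift x e u I"
        by (simp add: power_add mult_ac)
      have dA: "?d (shift x f vA) I = (\<Prod>i\<in>I. x i) ^ f * koszul_diff (\<lambda>j. x j ^ M) vA I"
        and dB: "?d (shift x f vB) I = (\<Prod>i\<in>I. x i) ^ f * koszul_diff (\<lambda>j. x j ^ M) vB I"
        by (rule koszul_diff_transition[OF fin])+
      have "shift x (e + f) u I - ?d v I
          = (\<Prod>i\<in>I. x i) ^ f * (shift x e u I - koszul_diff (\<lambda>j. x j ^ M) vA I) + ?d a I"
        unfolding v_def koszul_diff_diff shift_e dA by (simp add: algebra_simps)
      moreover have "?d a I \<in> idl.span A"
        by (intro koszul_diff_in_ideal) (use ab(1) sub in auto)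
      ultimately have A: "shift x (e + f) u I - ?d v I \<in> idl.span A"
        using vA[OF I] by (simp only: idl.span_add idl.span_scale)
      have "?d v I = ?d (\<lambda>I. shift x f vB I + (?d w I + b I)) I"
        unfolding koszul_diff_def
      proof (rule sum.cong)
        fix j assume "j \<in> I"
        have "v (I - {j}) = shift x f vB (I - {j}) + (?d w (I - {j}) + b (I - {j}))"
          using ab(3)[OF sub[OF \<open>j \<in> I\<close>]] by (simp add: v_def algebra_simps)
        then show "koszul_sign I j * x j ^ (M + f) * v (I - {j}) = koszul_sign I j * x j ^ (M + f) *
          (shift x f vB (I - {j}) + ((\<Sum>k\<in>I - {j}. koszul_sign (I - {j}) k * x k ^ (M + f) * w (I - {j} - {k})) + b (I - {j})))"
          by (simp only: koszul_diff_def)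
      qed simp
      also have "\<dots> = ?d (shift x f vB) I + ?d b I"
        by (simp only: koszul_diff_add koszul_diff_square[OF fin]) simp
      finally have "shift x (e + f) u I - ?d v I
          = (\<Prod>i\<in>I. x i) ^ f * (shift x e u I - koszul_diff (\<lambda>j. x j ^ M) vB I) - ?d b I"
        unfolding shift_e dB by (simp add: algebra_simps)
      moreover have "?d b I \<in> idl.span B"
        by (intro koszul_diff_in_ideal) (use ab(2) sub in auto)
      ultimately have B: "shift x (e + f) u I - ?d v I \<in> idl.span B"
        using vB[OF I] by (simp only: idl.span_diff idl.span_scale)
      from A B show ?thesis by blast
    qed
    then show ?thesis unfolding dies_in_limit_def M_def
      by (intro exI[of _ "e + f"] exI[of _ v]) (simp add: add.assoc)
  qed
qed

text \<open>The connecting argument for \<open>0 \<rightarrow> S/I \<rightarrow> S/I \<rightarrow> S/(I, x\<^sub>a) \<rightarrow> 0\<close>: in degrees at most \<open>d\<close>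
  multiplication by \<open>x\<^sub>a\<close> is injective on the limit cohomology, while a power of \<open>x\<^sub>a\<close> kills every
  class.\<close>

lemma vanishes_below_regular:
  fixes x :: "nat \<Rightarrow> 'a::comm_ring_1"
  assumes a: "a < r"
    and regular: "\<And>f. x a * f \<in> idl.span A \<Longrightarrow> f \<in> idl.span A"
    and van: "cohomology_vanishes_below x r (idl.span (insert (x a) A)) d"
  shows "cohomology_vanishes_below x r (idl.span A) (Suc d)"
proof -
  let ?J = "idl.span A"
  have cancel: "dies_in_limit x r ?J p N u"
    if p: "p < Suc d" and dies: "dies_in_limit x r ?J p N (\<lambda>I. x a * u I)" for p N u
  proof -
    obtain e v where v: "\<And>I. I \<subseteq> {..<r} \<Longrightarrow> card I = p \<Longrightarrow>
        shift x e (\<lambda>I. x a * u I) I - koszul_diff (\<lambda>j. x j ^ (N + e)) v I \<in> ?J"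
      using dies unfolding dies_in_limit_def by blast
    define M where "M = N + e"
    show ?thesis
    proof (cases p)
      case 0
      have "u {} \<in> ?J" using v[of "{}"] 0 regular by simp
      then show ?thesis unfolding dies_in_limit_def 0
        by (intro exI[of _ 0] exI[of _ "\<lambda>_. 0"]) (auto simp: card_eq_0_iff dest: finite_subset)
    next
      case (Suc q)
      have "koszul_cocycle x r (idl.span (insert (x a) A)) q M v"
        unfolding koszul_cocycle_def
      proof (intro allI impI)
        fix I assume I: "I \<subseteq> {..<r}" "card I = Suc q"
        have "shift x e (\<lambda>I. x a * u I) I = ((\<Prod>i\<in>I. x i) ^ e * u I) * x a" by (simp add: mult_ac)
        then have "shift x e (\<lambda>I. x a * u I) I \<in> idl.span (insert (x a) A)"
          by (simp only: idl.span_scale idl.span_base insertI1)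
        moreover have "shift x e (\<lambda>I. x a * u I) I - koszul_diff (\<lambda>j. x j ^ M) v I \<in> idl.span (insert (x a) A)"
          using v[of I] I Suc idl.span_mono[of A "insert (x a) A"] by (auto simp: M_def)
        ultimately have "shift x e (\<lambda>I. x a * u I) I - (shift x e (\<lambda>I. x a * u I) I
            - koszul_diff (\<lambda>j. x j ^ M) v I) \<in> idl.span (insert (x a) A)"
          by (rule idl.span_diff)
        then show "koszul_diff (\<lambda>j. x j ^ M) v I \<in> idl.span (insert (x a) A)" by simp
      qed
      then have "dies_in_limit x r (idl.span (insert (x a) A)) q M v"
        using van p Suc unfolding cohomology_vanishes_below_def by simp
      then obtain f w where w: "\<And>I. I \<subseteq> {..<r} \<Longrightarrow> card I = q \<Longrightarrow>
          shift x f v I - koszul_diff (\<lambda>j. x j ^ (M + f)) w I \<in> idl.span (insert (x a) A)"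
        unfolding dies_in_limit_def by blast
      let ?d = "koszul_diff (\<lambda>j. x j ^ (M + f))"
      have "\<forall>I. \<exists>k. I \<subseteq> {..<r} \<longrightarrow> card I = q \<longrightarrow> shift x f v I - ?d w I - k * x a \<in> ?J"
        using w unfolding idl.span_breakdown_eq by blast
      then obtain k where k: "\<And>I. I \<subseteq> {..<r} \<Longrightarrow> card I = q \<Longrightarrow> shift x f v I - ?d w I - k I * x a \<in> ?J"
        by metis
      define b where "b I = shift x f v I - ?d w I - k I * x a" for I
      have "shift x (e + f) u I - ?d k I \<in> ?J" if I: "I \<subseteq> {..<r}" "card I = p" for I
      proof -
        have fin: "finite I" using I by (meson finite_lessThan finite_subset)
        have sub: "I - {j} \<subseteq> {..<r}" "card (I - {j}) = q" if "j \<in> I" for j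
          using I Suc that fin by auto
        have dv: "?d (shift x f v) I = (\<Prod>i\<in>I. x i) ^ f * koszul_diff (\<lambda>j. x j ^ M) v I"
          by (rule koszul_diff_transition[OF fin])
        have db: "?d b I \<in> ?J"
          by (intro koszul_diff_in_ideal) (use k sub in \<open>auto simp: b_def\<close>)
        have "?d b I = ?d (shift x f v) I - ?d (?d w) I - ?d (\<lambda>I. x a * k I) I"
          unfolding b_def koszul_diff_diff by (simp only: mult.commute)
        then have "?d b I = ?d (shift x f v) I - x a * ?d k I"
          by (simp only: koszul_diff_square[OF fin] koszul_diff_scale) simp
        then have "x a * (shift x (e + f) u I - ?d k I) = (\<Prod>i\<in>I. x i) ^ f *
            (shift x e (\<lambda>I. x a * u I) I - koszul_diff (\<lambda>j. x j ^ M) v I) + ?d b I"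
          unfolding dv by (simp add: algebra_simps power_add)
        also have "\<dots> \<in> ?J"
          using v[OF I] db by (simp only: M_def idl.span_add idl.span_scale)
        finally show ?thesis by (rule regular)
      qed
      then show ?thesis unfolding dies_in_limit_def M_def
        by (intro exI[of _ "e + f"] exI[of _ k]) (simp add: add.assoc)
    qed
  qed
  have power: "dies_in_limit x r ?J p N u"
    if "p < Suc d" "koszul_cocycle x r ?J p N u" "dies_in_limit x r ?J p N (\<lambda>I. x a ^ k * u I)" for p N u k
    using that
  proof (induction k)
    case (Suc k)
    have "koszul_cocycle x r ?J p N (\<lambda>I. x a ^ k * u I)"
      using Suc.prems(2) unfolding koszul_cocycle_def koszul_diff_scale by (auto intro: idl.span_scale)
    then have "dies_in_limit x r ?J p N (\<lambda>I. x a ^ k * u I)"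
      using Suc.prems cancel[of p N "\<lambda>I. x a ^ k * u I"] by (simp add: mult.assoc)
    then show ?case using Suc by blast
  qed simp
  show ?thesis
    unfolding cohomology_vanishes_below_def
  proof (intro allI impI)
    fix p N u assume p: "p < Suc d" and u: "koszul_cocycle x r ?J p N u"
    let ?h = "\<lambda>w I. if a \<in> I then 0 else koszul_sign (insert a I) a * w (insert a I)"
    let ?d = "koszul_diff (\<lambda>j. x j ^ N)"
    have "x a ^ N * u I - ?d (?h u) I \<in> ?J" if I: "I \<subseteq> {..<r}" "card I = p" for I
    proof -
      have fin: "finite I" using I by (meson finite_lessThan finite_subset)
      have "?h (?d u) I \<in> ?J"
      proof (cases "a \<in> I")
        case False
        then have "insert a I \<subseteq> {..<r}" "card (insert a I) = Suc p" using I a fin by auto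
        then show ?thesis using u False unfolding koszul_cocycle_def by (simp add: idl.span_scale)
      qed (simp add: idl.span_zero)
      moreover have "x a ^ N * u I = ?d (?h u) I + ?h (?d u) I"
        using koszul_diff_homotopy[OF fin, of "\<lambda>j. x j ^ N" a u] by (rule sym)
      ultimately show ?thesis by (simp only: add_diff_cancel_left')
    qed
    then have "dies_in_limit x r ?J p N (\<lambda>I. x a ^ N * u I)"
      unfolding dies_in_limit_def by (intro exI[of _ 0] exI[of _ "?h u"]) simp
    then show "dies_in_limit x r ?J p N u" using power p u by blast
  qed
qed

section \<open>The Cech complex of a quotient ring\<close>

text \<open>A ring with carrier \<open>S\<close> inside a larger ring, as the polynomials in finitely many variables
  inside those in infinitely many. The retraction turns primitives found in the larger ring into
  primitives over \<open>S\<close>, and the module considered is \<open>S/(I \<inter> S)\<close>.\<close>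

locale quotient_cech =
  fixes S I :: "'a::comm_ring_1 set" and retract :: "'a \<Rightarrow> 'a" and xs :: "'a list"
  assumes retract_closed: "retract a \<in> S"
    and retract_id: "a \<in> S \<Longrightarrow> retract a = a"
    and retract_add: "retract (a + b) = retract a + retract b"
    and retract_mult: "retract (a * b) = retract a * retract b"
    and one_closed: "1 \<in> S"
    and xs_closed: "set xs \<subseteq> S"
    and ideal: "idl.subspace I"
    and retract_ideal: "a \<in> I \<Longrightarrow> retract a \<in> I"
begin

definition R :: "'a ring" where
  "R = \<lparr>carrier = S, monoid.mult = (*), one = 1, ring.zero = 0, ring.add = (+)\<rparr>"

definition M :: "('a, 'a set) module" where
  "M = quotient_module (ring_as_module R) (I \<inter> S)"

lemma S_add: "a \<in> S \<Longrightarrow> b \<in> S \<Longrightarrow> a + b \<in> S"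
  using retract_closed[of "a + b"] by (simp add: retract_add retract_id)

lemma S_mult: "a \<in> S \<Longrightarrow> b \<in> S \<Longrightarrow> a * b \<in> S"
  using retract_closed[of "a * b"] by (simp add: retract_mult retract_id)

lemma retract_0 [simp]: "retract 0 = 0"
  using retract_add[of 0 0] by simp

lemma S_zero: "0 \<in> S" using retract_closed[of 0] by simp

lemma retract_uminus: "retract (- a) = - retract a"
  using retract_add[of "- a" a] by (simp add: eq_neg_iff_add_eq_0)

lemma retract_diff: "retract (a - b) = retract a - retract b"
  using retract_add[of a "- b"] by (simp add: retract_uminus)

lemma S_uminus: "a \<in> S \<Longrightarrow> - a \<in> S"
  using retract_closed[of "- a"] by (simp add: retract_uminus retract_id)

lemma S_diff: "a \<in> S \<Longrightarrow> b \<in> S \<Longrightarrow> a - b \<in> S"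
  using S_add[of a "- b"] S_uminus by simp

lemma S_power: "a \<in> S \<Longrightarrow> a ^ k \<in> S"
  by (induction k) (auto intro: S_mult one_closed)

lemma S_sum: "(\<And>j. j \<in> A \<Longrightarrow> f j \<in> S) \<Longrightarrow> sum f A \<in> S"
  by (induction A rule: infinite_finite_induct) (auto intro: S_add S_zero)

lemma S_prod: "(\<And>j. j \<in> A \<Longrightarrow> f j \<in> S) \<Longrightarrow> prod f A \<in> S"
  by (induction A rule: infinite_finite_induct) (auto intro: S_mult one_closed)

lemmas S_closed = S_add S_mult S_zero S_uminus S_diff S_power one_closed

lemma R_simps [simp]: "carrier R = S" "a \<otimes>\<^bsub>R\<^esub> b = a * b" "\<one>\<^bsub>R\<^esub> = 1" "\<zero>\<^bsub>R\<^esub> = 0" "a \<oplus>\<^bsub>R\<^esub> b = a + b"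
  by (simp_all add: R_def)

lemma R_power [simp]: "a [^]\<^bsub>R\<^esub> (k::nat) = a ^ k"
  by (induction k) (simp_all add: nat_pow_def mult.commute)

definition cls :: "'a \<Rightarrow> 'a set" where
  "cls s = (\<lambda>j. j + s) ` (I \<inter> S)"

lemma cls_eq_iff: "s \<in> S \<Longrightarrow> t \<in> S \<Longrightarrow> cls s = cls t \<longleftrightarrow> s - t \<in> I"
proof
  assume s: "s \<in> S" and t: "t \<in> S"
  have "0 + s \<in> cls s" unfolding cls_def by (rule imageI) (simp add: idl.subspace_0[OF ideal] S_zero)
  moreover assume "cls s = cls t"
  ultimately obtain j where "j \<in> I" "s = j + t" unfolding cls_def by auto
  then show "s - t \<in> I" by simp
next
  have sub: "cls s \<subseteq> cls t" if s: "s \<in> S" and t: "t \<in> S" and "s - t \<in> I" for s t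
  proof
    fix z assume "z \<in> cls s"
    then obtain j where j: "j \<in> I" "j \<in> S" "z = j + s" unfolding cls_def by auto
    then have "j + (s - t) \<in> I \<inter> S" using that by (auto intro: idl.subspace_add[OF ideal] S_closed)
    moreover have "z = j + (s - t) + t" using j by simp
    ultimately show "z \<in> cls t" unfolding cls_def by (rule rev_image_eqI)
  qed
  assume "s \<in> S" "t \<in> S" "s - t \<in> I"
  then show "cls s = cls t" using sub[of s t] sub[of t s] idl.subspace_neg[OF ideal, of "s - t"] by auto
qed

lemma coset_cls: "(I \<inter> S) +>\<^bsub>ring_as_module R\<^esub> s = cls s"
  by (auto simp: a_r_coset_def r_coset_def ring_as_module_def cls_def)

lemma M_carrier: "carrier M = cls ` S"
proof -
  have "cls = (\<lambda>s. \<Union>h\<in>I \<inter> S. {h + s})" by (auto simp: cls_def fun_eq_iff)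
  then show ?thesis
    by (auto simp: M_def quotient_module_def A_RCOSETS_def RCOSETS_def r_coset_def ring_as_module_def)
qed

lemma M_zero: "\<zero>\<^bsub>M\<^esub> = cls 0"
  by (simp add: M_def quotient_module_def cls_def)

lemma M_add:
  assumes "s \<in> S" "t \<in> S"
  shows "cls s \<oplus>\<^bsub>M\<^esub> cls t = cls (s + t)"
proof -
  have "cls s \<oplus>\<^bsub>M\<^esub> cls t = {a + b | a b. a \<in> cls s \<and> b \<in> cls t}"
    by (auto simp: M_def quotient_module_def set_add_def set_mult_def ring_as_module_def)
  also have "\<dots> = cls (s + t)"
  proof (intro equalityI subsetI)
    fix z assume "z \<in> {a + b | a b. a \<in> cls s \<and> b \<in> cls t}"
    then obtain i j where ij: "i \<in> I \<inter> S" "j \<in> I \<inter> S" "z = (i + s) + (j + t)"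
      unfolding cls_def by auto
    then have "i + j \<in> I \<inter> S" by (auto intro: idl.subspace_add[OF ideal] S_closed)
    moreover have "z = (i + j) + (s + t)" using ij(3) by (simp add: algebra_simps)
    ultimately show "z \<in> cls (s + t)" unfolding cls_def by (rule rev_image_eqI)
  next
    fix z assume "z \<in> cls (s + t)"
    then obtain j where j: "j \<in> I \<inter> S" "z = j + (s + t)" unfolding cls_def by auto
    have "0 \<in> I \<inter> S" by (simp add: idl.subspace_0[OF ideal] S_zero)
    then have "0 + t \<in> cls t" unfolding cls_def by (rule imageI)
    moreover have "j + s \<in> cls s" using j(1) unfolding cls_def by (rule imageI)
    moreover have "z = (j + s) + (0 + t)" using j(2) by (simp add: add.assoc)
    ultimately show "z \<in> {a + b | a b. a \<in> cls s \<and> b \<in> cls t}" by blast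
  qed
  finally show ?thesis .
qed

lemma M_smult:
  assumes "r \<in> S" "s \<in> S"
  shows "r \<odot>\<^bsub>M\<^esub> cls s = cls (r * s)"
proof -
  have "r \<odot>\<^bsub>M\<^esub> cls s = (\<Union>x\<in>cls s. cls (r * x))"
    by (simp add: M_def quotient_module_def coset_cls) (simp add: ring_as_module_def)
  also have "\<dots> = (\<Union>x\<in>cls s. cls (r * s))"
  proof (rule SUP_cong)
    fix x assume "x \<in> cls s"
    then obtain j where j: "j \<in> I" "j \<in> S" "x = j + s" unfolding cls_def by auto
    then have "r * x - r * s = r * j" by (simp add: algebra_simps)
    then have "r * x - r * s \<in> I" using idl.subspace_scale[OF ideal j(1)] by simp
    then show "cls (r * x) = cls (r * s)" using assms j by (subst cls_eq_iff) (auto intro: S_closed)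
  qed simp
  also have "\<dots> = cls (r * s)"
  proof -
    have "0 + s \<in> cls s" unfolding cls_def by (rule imageI) (simp add: idl.subspace_0[OF ideal] S_zero)
    then show ?thesis by blast
  qed
  finally show ?thesis .
qed

text \<open>Equality of the fractions \<open>s/f\<^sup>a\<close> and \<open>t/f\<^sup>b\<close> over the quotient.\<close>

definition frac_rel :: "'a \<Rightarrow> 'a \<Rightarrow> nat \<Rightarrow> 'a \<Rightarrow> nat \<Rightarrow> bool" where
  "frac_rel f s a t b \<longleftrightarrow> (\<exists>c. f ^ (c + b) * s - f ^ (c + a) * t \<in> I)"

abbreviation frac :: "'a \<Rightarrow> 'a \<Rightarrow> nat \<Rightarrow> ('a set \<times> nat) set" where
  "frac f s a \<equiv> fraction R M f (cls s) a"

lemma frac_mem_iff: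
  assumes "f \<in> S" "s \<in> S"
  shows "(V, b) \<in> frac f s a \<longleftrightarrow> (\<exists>t\<in>S. V = cls t \<and> frac_rel f s a t b)"
proof -
  have key: "f ^ k \<odot>\<^bsub>M\<^esub> cls s = f ^ l \<odot>\<^bsub>M\<^esub> cls t \<longleftrightarrow> f ^ k * s - f ^ l * t \<in> I" if "t \<in> S" for k l t
    using assms that by (simp add: M_smult cls_eq_iff S_closed)
  have "(V, b) \<in> frac f s a \<longleftrightarrow> V \<in> cls ` S \<and> (\<exists>c. f ^ (c + b) \<odot>\<^bsub>M\<^esub> cls s = f ^ (c + a) \<odot>\<^bsub>M\<^esub> V)"
    by (simp add: fraction_def M_carrier)
  also have "\<dots> \<longleftrightarrow> (\<exists>t\<in>S. V = cls t \<and> (\<exists>c. f ^ (c + b) \<odot>\<^bsub>M\<^esub> cls s = f ^ (c + a) \<odot>\<^bsub>M\<^esub> cls t))"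
    by blast
  finally show ?thesis unfolding frac_rel_def by (simp only: key cong: bex_cong)
qed

lemma frac_rel_eqI:
  assumes "f ^ b * s = f ^ a * t"
  shows "frac_rel f s a t b"
  unfolding frac_rel_def by (rule exI[of _ 0]) (simp add: assms idl.subspace_0[OF ideal])

lemma frac_rel_sym: "frac_rel f s a t b \<Longrightarrow> frac_rel f t b s a"
  unfolding frac_rel_def by (metis idl.subspace_neg[OF ideal] minus_diff_eq)

lemma frac_rel_trans:
  assumes "frac_rel f s a t b" "frac_rel f t b u c"
  shows "frac_rel f s a u c"
proof -
  obtain d e where de: "f ^ (d + b) * s - f ^ (d + a) * t \<in> I" "f ^ (e + c) * t - f ^ (e + b) * u \<in> I"
    using assms unfolding frac_rel_def by blast
  have "f ^ (e + c) * (f ^ (d + b) * s - f ^ (d + a) * t) + f ^ (d + a) * (f ^ (e + c) * t - f ^ (e + b) * u) \<in> I"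
    by (rule idl.subspace_add[OF ideal]; rule idl.subspace_scale[OF ideal]; rule de)
  also have "f ^ (e + c) * (f ^ (d + b) * s - f ^ (d + a) * t) + f ^ (d + a) * (f ^ (e + c) * t - f ^ (e + b) * u)
      = f ^ ((d + e + b) + c) * s - f ^ ((d + e + b) + a) * u"
    by (simp add: algebra_simps power_add)
  finally show ?thesis unfolding frac_rel_def by blast
qed

lemma frac_eq_iff:
  assumes "f \<in> S" "s \<in> S" "t \<in> S"
  shows "frac f s a = frac f t b \<longleftrightarrow> frac_rel f s a t b"
proof
  have "(cls t, b) \<in> frac f t b"
    using assms by (auto simp: frac_mem_iff intro!: bexI[of _ t] frac_rel_eqI)
  moreover assume "frac f s a = frac f t b"
  ultimately have "(cls t, b) \<in> frac f s a" by simp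
  then obtain t' where t': "t' \<in> S" "cls t = cls t'" "frac_rel f s a t' b"
    unfolding frac_mem_iff[OF assms(1,2)] by blast
  have "t' - t \<in> I" using t' assms by (simp add: cls_eq_iff[symmetric])
  then have "frac_rel f t' b t b"
    unfolding frac_rel_def using idl.subspace_scale[OF ideal, of "t' - t" "f ^ b"]
    by (intro exI[of _ 0]) (simp add: right_diff_distrib)
  with t'(3) show "frac_rel f s a t b" by (rule frac_rel_trans)
next
  assume rel: "frac_rel f s a t b"
  have "(V, c) \<in> frac f s a \<longleftrightarrow> (V, c) \<in> frac f t b" for V c
    unfolding frac_mem_iff[OF assms(1,2)] frac_mem_iff[OF assms(1,3)]
    using frac_rel_trans[OF rel] frac_rel_trans[OF frac_rel_sym[OF rel]] by blast 
  then show "frac f s a = frac f t b" by auto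
qed

lemma frac_eqI:
  assumes "f \<in> S" "s \<in> S" "t \<in> S" "f ^ b * s = f ^ a * t"
  shows "frac f s a = frac f t b"
  using assms by (simp add: frac_eq_iff frac_rel_eqI)

abbreviation L :: "'a \<Rightarrow> ('a, ('a set \<times> nat) set) module" where
  "L f \<equiv> localization R M f"

lemma L_carrier: "carrier (L f) = {frac f s a | s a. s \<in> S}"
  by (auto simp: localization_def M_carrier)

lemma L_zero: "\<zero>\<^bsub>L f\<^esub> = frac f 0 0"
  by (simp add: localization_def M_zero)

lemma frac_self_mem: "f \<in> S \<Longrightarrow> s \<in> S \<Longrightarrow> (cls s, a) \<in> frac f s a"
  by (auto simp: frac_mem_iff intro!: bexI[of _ s] frac_rel_eqI)

lemma L_add:
  assumes f: "f \<in> S" and s: "s \<in> S" and t: "t \<in> S"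
  shows "frac f s a \<oplus>\<^bsub>L f\<^esub> frac f t b = frac f (f ^ b * s + f ^ a * t) (a + b)"
proof -
  have "fraction R M f ((f ^ b') \<odot>\<^bsub>M\<^esub> u \<oplus>\<^bsub>M\<^esub> (f ^ a') \<odot>\<^bsub>M\<^esub> v) (a' + b')
      = frac f (f ^ b * s + f ^ a * t) (a + b)"
    if mem: "(u, a') \<in> frac f s a" "(v, b') \<in> frac f t b" for u v a' b'
  proof -
    obtain s' t' where st: "s' \<in> S" "u = cls s'" "frac_rel f s a s' a'" "t' \<in> S" "v = cls t'" "frac_rel f t b t' b'"
      using mem f s t by (auto simp: frac_mem_iff)
    obtain c d where cd: "f ^ (c + a') * s - f ^ (c + a) * s' \<in> I" "f ^ (d + b') * t - f ^ (d + b) * t' \<in> I"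
      using st unfolding frac_rel_def by blast
    have "f ^ (d + b + b') * (f ^ (c + a') * s - f ^ (c + a) * s') + f ^ (c + a + a') * (f ^ (d + b') * t - f ^ (d + b) * t') \<in> I"
      by (rule idl.subspace_add[OF ideal]; rule idl.subspace_scale[OF ideal]; rule cd)
    also have "f ^ (d + b + b') * (f ^ (c + a') * s - f ^ (c + a) * s') + f ^ (c + a + a') * (f ^ (d + b') * t - f ^ (d + b) * t')
        = f ^ ((c + d) + (a' + b')) * (f ^ b * s + f ^ a * t) - f ^ ((c + d) + (a + b)) * (f ^ b' * s' + f ^ a' * t')"
      by (simp add: algebra_simps power_add)
    finally have "frac_rel f (f ^ b * s + f ^ a * t) (a + b) (f ^ b' * s' + f ^ a' * t') (a' + b')"
      unfolding frac_rel_def by blast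
    then have "frac f (f ^ b * s + f ^ a * t) (a + b) = frac f (f ^ b' * s' + f ^ a' * t') (a' + b')"
      using st f s t by (subst frac_eq_iff) (auto intro: S_closed)
    then show ?thesis using st f by (simp add: M_smult M_add S_closed)
  qed
  then show ?thesis
    unfolding localization_def using frac_self_mem[OF f s, of a] frac_self_mem[OF f t, of b]
    by (auto simp: split_beta)
qed

text \<open>With equal denominators fractions are added numerator by numerator. All later computations
  use a common exponent for this reason.\<close>

lemma L_add_same:
  assumes "f \<in> S" "s \<in> S" "t \<in> S"
  shows "frac f s N \<oplus>\<^bsub>L f\<^esub> frac f t N = frac f (s + t) N"
  unfolding L_add[OF assms] using assms
  by (intro frac_eqI) (auto simp: algebra_simps power_add intro: S_closed)

lemma frac_zero: "f \<in> S \<Longrightarrow> frac f 0 N = frac f 0 0"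
  by (rule frac_eqI) (auto intro: S_closed)

lemma L_abelian_group:
  assumes f: "f \<in> S" shows "abelian_group (L f)"
proof (rule abelian_groupI)
  fix x y assume "x \<in> carrier (L f)" "y \<in> carrier (L f)"
  then obtain s a t b where xy: "s \<in> S" "t \<in> S" "x = frac f s a" "y = frac f t b"
    unfolding L_carrier by blast
  show "x \<oplus>\<^bsub>L f\<^esub> y \<in> carrier (L f)"
    unfolding xy L_add[OF f xy(1,2)] L_carrier using xy f by (blast intro: S_closed)
  show "x \<oplus>\<^bsub>L f\<^esub> y = y \<oplus>\<^bsub>L f\<^esub> x"
    unfolding xy L_add[OF f xy(1,2)] L_add[OF f xy(2,1)] by (simp add: add.commute)
  fix z assume "z \<in> carrier (L f)"
  then obtain u c where z: "u \<in> S" "z = frac f u c" unfolding L_carrier by blast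
  show "x \<oplus>\<^bsub>L f\<^esub> y \<oplus>\<^bsub>L f\<^esub> z = x \<oplus>\<^bsub>L f\<^esub> (y \<oplus>\<^bsub>L f\<^esub> z)"
    unfolding xy z using f xy(1,2) z(1)
    by (simp add: L_add S_closed) (simp add: algebra_simps power_add)
next
  show "\<zero>\<^bsub>L f\<^esub> \<in> carrier (L f)" unfolding L_zero L_carrier using S_zero by blast
next
  fix x assume "x \<in> carrier (L f)"
  then obtain s a where x: "s \<in> S" "x = frac f s a" unfolding L_carrier by blast
  show "\<zero>\<^bsub>L f\<^esub> \<oplus>\<^bsub>L f\<^esub> x = x"
    unfolding x L_zero using f x(1) by (simp add: L_add S_closed)
  have "frac f (- s) a \<oplus>\<^bsub>L f\<^esub> x = \<zero>\<^bsub>L f\<^esub>"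
    unfolding x L_zero using f x(1) by (simp add: L_add_same S_closed frac_zero[OF f, of a])
  moreover have "frac f (- s) a \<in> carrier (L f)" unfolding L_carrier using x(1) S_uminus by blast
  ultimately show "\<exists>y\<in>carrier (L f). y \<oplus>\<^bsub>L f\<^esub> x = \<zero>\<^bsub>L f\<^esub>" by blast
qed

lemma frac_in_L: "s \<in> S \<Longrightarrow> frac f s a \<in> carrier (L f)"
  unfolding L_carrier by blast

lemma L_uminus:
  assumes "f \<in> S" "s \<in> S"
  shows "\<ominus>\<^bsub>L f\<^esub> frac f s N = frac f (- s) N"
proof -
  interpret abelian_group "L f" by (rule L_abelian_group[OF assms(1)])
  show ?thesis
    by (rule minus_equality) (use assms in \<open>simp_all add: L_add_same S_closed frac_zero[of f N] L_zero frac_in_L\<close>)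
qed

lemma L_finsum:
  assumes "f \<in> S" "finite A" "\<And>j. j \<in> A \<Longrightarrow> s j \<in> S"
  shows "finsum (L f) (\<lambda>j. frac f (s j) N) A = frac f (\<Sum>j\<in>A. s j) N"
proof -
  interpret abelian_group "L f" by (rule L_abelian_group[OF assms(1)])
  show ?thesis using assms(2,3)
  proof (induction A rule: finite_induct)
    case empty
    then show ?case using assms(1) by (simp add: L_zero frac_zero[of f N])
  next
    case (insert i A)
    have "finsum (L f) (\<lambda>j. frac f (s j) N) (insert i A)
        = frac f (s i) N \<oplus>\<^bsub>L f\<^esub> finsum (L f) (\<lambda>j. frac f (s j) N) A"
      using insert by (intro finsum_insert) (auto intro: frac_in_L)
    also have "\<dots> = frac f (s i + (\<Sum>j\<in>A. s j)) N"
      using insert assms(1) by (simp add: L_add_same S_sum)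
    finally show ?case using insert by simp
  qed
qed

lemma loc_map_frac:
  assumes "f \<in> S" "g \<in> S" "s \<in> S"
  shows "loc_map R M f g (frac f s a) = frac (f * g) (g ^ a * s) a"
proof -
  have "fraction R M (f * g) ((g ^ a') \<odot>\<^bsub>M\<^esub> u) a' = frac (f * g) (g ^ a * s) a"
    if mem: "(u, a') \<in> frac f s a" for u a'
  proof -
    obtain s' where s': "s' \<in> S" "u = cls s'" "frac_rel f s a s' a'"
      using mem assms by (auto simp: frac_mem_iff)
    obtain c where c: "f ^ (c + a') * s - f ^ (c + a) * s' \<in> I"
      using s' unfolding frac_rel_def by blast
    have "g ^ (c + a + a') * (f ^ (c + a') * s - f ^ (c + a) * s') \<in> I"
      by (rule idl.subspace_scale[OF ideal c])
    also have "g ^ (c + a + a') * (f ^ (c + a') * s - f ^ (c + a) * s')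
        = (f * g) ^ (c + a') * (g ^ a * s) - (f * g) ^ (c + a) * (g ^ a' * s')"
      by (simp add: algebra_simps power_add power_mult_distrib)
    finally have "frac_rel (f * g) (g ^ a * s) a (g ^ a' * s') a'"
      unfolding frac_rel_def by blast
    then show ?thesis using s' assms by (simp add: M_smult S_closed frac_eq_iff frac_rel_sym)
  qed
  then show ?thesis
    unfolding loc_map_def using frac_self_mem[OF assms(1,3), of a] by (auto simp: split_beta)
qed

abbreviation x :: "nat \<Rightarrow> 'a" where "x \<equiv> \<lambda>i. xs ! i"
abbreviation r :: nat where "r \<equiv> length xs"

lemma x_closed: "i < r \<Longrightarrow> x i \<in> S"
  using xs_closed by (auto dest: nth_mem)

lemma x_prod_closed: "A \<subseteq> {..<r} \<Longrightarrow> prod x A \<in> S"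
  using x_closed by (intro S_prod) auto

lemma comm_monoid_R: "comm_monoid R"
  by (rule comm_monoidI) (auto simp: S_closed mult_ac)

lemma index_prod_eq:
  assumes "A \<subseteq> {..<r}" shows "index_prod R xs A = prod x A"
proof -
  interpret comm_monoid R by (rule comm_monoid_R)
  have "finite A" using assms finite_subset by blast
  then show ?thesis using assms
  proof (induction A rule: finite_induct)
    case (insert i A)
    then show ?case using x_closed
      by (simp add: index_prod_def finprod_insert Pi_def subset_iff)
  qed (simp add: index_prod_def)
qed

definition cochain :: "nat \<Rightarrow> nat \<Rightarrow> (nat set \<Rightarrow> 'a) \<Rightarrow> nat set \<Rightarrow> ('a set \<times> nat) set" where
  "cochain p N u = (\<lambda>A\<in>cech_index xs p. frac (prod x A) (u A) N)"

abbreviation "valued u \<equiv> \<forall>A. u A \<in> S"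

lemma index_subset: "A \<in> cech_index xs p \<Longrightarrow> A \<subseteq> {..<r}"
  by (simp add: cech_index_def)

lemma index_finite: "A \<in> cech_index xs p \<Longrightarrow> finite A"
  using index_subset finite_subset by blast

lemma finite_cech_index: "finite (cech_index xs p)"
  by (rule finite_subset[of _ "Pow {..<r}"]) (auto simp: cech_index_def)

lemma cech_term_carrier:
  "carrier (cech_term R xs M p) = (\<Pi>\<^sub>E A\<in>cech_index xs p. carrier (L (prod x A)))"
  unfolding cech_term_def by (auto simp: Let_def index_prod_eq index_subset intro!: PiE_cong)

lemma cech_term_zero: "\<zero>\<^bsub>cech_term R xs M p\<^esub> = cochain p 0 (\<lambda>_. 0)"
  unfolding cech_term_def cochain_def
  by (auto simp: Let_def index_prod_eq index_subset L_zero intro!: restrict_ext)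

lemma cochain_shift:
  assumes "valued u" shows "cochain p (N + e) (shift x e u) = cochain p N u"
  unfolding cochain_def
proof (rule restrict_ext)
  fix A assume "A \<in> cech_index xs p"
  then have "prod x A \<in> S" using x_prod_closed index_subset by blast
  then show "frac (prod x A) (shift x e u A) (N + e) = frac (prod x A) (u A) N"
    using assms by (intro frac_eqI) (auto simp: S_closed algebra_simps power_add)
qed

lemma cochain_zero: "cochain p N (\<lambda>_. 0) = \<zero>\<^bsub>cech_term R xs M p\<^esub>"
  unfolding cech_term_zero cochain_def
  by (rule restrict_ext) (use x_prod_closed index_subset frac_zero in blast)

lemma cochain_add:
  assumes "valued u" "valued v"
  shows "cochain p N u \<oplus>\<^bsub>cech_term R xs M p\<^esub> cochain p N v = cochain p N (\<lambda>A. u A + v A)"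
proof -
  have "cochain p N u \<oplus>\<^bsub>cech_term R xs M p\<^esub> cochain p N v
      = (\<lambda>A\<in>cech_index xs p. cochain p N u A \<oplus>\<^bsub>L (index_prod R xs A)\<^esub> cochain p N v A)"
    by (simp add: cech_term_def Let_def)
  also have "\<dots> = cochain p N (\<lambda>A. u A + v A)"
    unfolding cochain_def[of p N "\<lambda>A. u A + v A"]
  proof (rule restrict_ext)
    fix A assume "A \<in> cech_index xs p"
    then show "cochain p N u A \<oplus>\<^bsub>L (index_prod R xs A)\<^esub> cochain p N v A = frac (prod x A) (u A + v A) N"
      using assms x_prod_closed[OF index_subset]
      by (simp add: cochain_def index_prod_eq[OF index_subset] L_add_same)
  qed
  finally show ?thesis .
qed

lemma cochain_in_term: "valued u \<Longrightarrow> cochain p N u \<in> carrier (cech_term R xs M p)"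
  unfolding cech_term_carrier cochain_def by (auto intro: frac_in_L)

lemma cochain_exists:
  assumes "c \<in> carrier (cech_term R xs M p)"
  obtains N u where "valued u" "c = cochain p N u"
proof -
  have "\<forall>A. \<exists>s a. A \<in> cech_index xs p \<longrightarrow> s \<in> S \<and> c A = frac (prod x A) s a"
    using assms unfolding cech_term_carrier L_carrier by (fastforce dest: PiE_mem)
  then obtain s a where sa: "\<And>A. A \<in> cech_index xs p \<Longrightarrow> s A \<in> S"
    "\<And>A. A \<in> cech_index xs p \<Longrightarrow> c A = frac (prod x A) (s A) (a A)" by metis
  \<comment> \<open>The sum is a convenient common upper bound for the exponents.\<close>
  define N where "N = (\<Sum>A\<in>cech_index xs p. a A)"
  define u where "u A = (if A \<in> cech_index xs p then prod x A ^ (N - a A) * s A else 0)" for A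
  have "valued u" unfolding u_def using sa(1) x_prod_closed[OF index_subset] by (simp add: S_mult S_power S_zero)
  moreover have "c = cochain p N u"
  proof (rule extensionalityI[of _ "cech_index xs p"])
    show "c \<in> extensional (cech_index xs p)" using assms unfolding cech_term_carrier by (simp add: PiE_def)
    show "cochain p N u \<in> extensional (cech_index xs p)" by (simp add: cochain_def)
    fix A assume A: "A \<in> cech_index xs p"
    have "a A \<le> N" unfolding N_def using A finite_cech_index by (intro member_le_sum) auto
    then have "prod x A ^ N * s A = prod x A ^ a A * u A"
      using A by (simp add: u_def mult.assoc[symmetric] power_add[symmetric])
    then show "c A = cochain p N u A"
      unfolding cochain_def using A sa x_prod_closed[OF index_subset[OF A]] \<open>valued u\<close>
      by (simp add: frac_eqI)
  qed
  ultimately show thesis by (rule that)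
qed

lemma koszul_sign_closed: "koszul_sign A j \<in> S"
  by (simp add: koszul_sign_def S_closed)

text \<open>On numerators over a common exponent the Cech differential is the Koszul differential for
  the powers \<open>x\<^sup>N\<close>.\<close>

lemma cech_diff_cochain:
  assumes u: "valued u"
  shows "cech_diff R xs M p (cochain p N u) = cochain (Suc p) N (koszul_diff (\<lambda>j. x j ^ N) u)"
  unfolding cech_diff_def cochain_def[of "Suc p"]
proof (rule restrict_ext)
  fix A assume A: "A \<in> cech_index xs (Suc p)"
  have subA: "A \<subseteq> {..<r}" and finA: "finite A" using index_subset[OF A] index_finite[OF A] .
  have PA: "prod x A \<in> S" by (rule x_prod_closed[OF subA])
  have face: "A - {j} \<in> cech_index xs p" "prod x (A - {j}) * x j = prod x A"
    "prod x (A - {j}) \<in> S" "x j \<in> S" if "j \<in> A" for j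
    using A that finA x_prod_closed[of "A - {j}"] subA x_closed
    by (auto simp: cech_index_def prod.remove mult.commute)
  have summand: "(let y = loc_map R M (index_prod R xs (A - {j})) (xs ! j) (cochain p N u (A - {j}))
        in if even (card {k \<in> A. k < j}) then y else \<ominus>\<^bsub>L (index_prod R xs A)\<^esub> y)
      = frac (prod x A) (koszul_sign A j * x j ^ N * u (A - {j})) N" if j: "j \<in> A" for j
  proof -
    have "loc_map R M (index_prod R xs (A - {j})) (xs ! j) (cochain p N u (A - {j}))
        = frac (prod x A) (x j ^ N * u (A - {j})) N"
      using loc_map_frac[OF face(3,4)[OF j], of "u (A - {j})" N] face(1,2)[OF j] u
      by (simp add: cochain_def index_prod_eq index_subset)
    then show ?thesis
      using L_uminus[OF PA, of "x j ^ N * u (A - {j})" N] u face(4)[OF j]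
      by (simp add: Let_def koszul_sign_def index_prod_eq[OF subA] S_closed)
  qed
  have "finsum (L (prod x A)) (\<lambda>j. let y = loc_map R M (index_prod R xs (A - {j})) (xs ! j) (cochain p N u (A - {j}))
        in if even (card {k \<in> A. k < j}) then y else \<ominus>\<^bsub>L (index_prod R xs A)\<^esub> y) A
     = finsum (L (prod x A)) (\<lambda>j. frac (prod x A) (koszul_sign A j * x j ^ N * u (A - {j})) N) A"
  proof -
    interpret abelian_group "L (prod x A)" by (rule L_abelian_group[OF PA])
    show ?thesis
      by (rule finsum_cong') (use summand u face(4) in \<open>auto intro!: frac_in_L S_closed koszul_sign_closed\<close>)
  qed
  also have "\<dots> = frac (prod x A) (koszul_diff (\<lambda>j. x j ^ N) u A) N"
    unfolding koszul_diff_def using u face(4)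
    by (intro L_finsum PA finA) (simp add: S_mult S_power koszul_sign_closed)
  finally show "(let L = L (index_prod R xs A) in
      finsum L (\<lambda>j. let y = loc_map R M (index_prod R xs (A - {j})) (xs ! j) (cochain p N u (A - {j}))
        in if even (card {k \<in> A. k < j}) then y else \<ominus>\<^bsub>L\<^esub> y) A)
    = frac (prod x A) (koszul_diff (\<lambda>j. x j ^ N) u A) N"
    unfolding Let_def index_prod_eq[OF subA] .
qed

lemma koszul_diff_closed:
  assumes "valued u" "A \<subseteq> {..<r}" shows "koszul_diff (\<lambda>j. x j ^ N) u A \<in> S"
  unfolding koszul_diff_def using assms x_closed
  by (intro S_sum) (auto intro!: S_closed koszul_sign_closed)

text \<open>A fraction vanishes if a power of its denominator kills the numerator; as there are finitely
  many entries, one power serves for all.\<close>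

lemma cochain_eq_zeroD:
  assumes "\<And>A. A \<subseteq> {..<r} \<Longrightarrow> u A \<in> S" "cochain p N u = \<zero>\<^bsub>cech_term R xs M p\<^esub>"
  obtains e where "\<And>A. A \<in> cech_index xs p \<Longrightarrow> shift x e u A \<in> I"
proof -
  have "\<exists>c. prod x A ^ c * u A \<in> I" if A: "A \<in> cech_index xs p" for A
  proof -
    have "cochain p N u A = cochain p 0 (\<lambda>_. 0) A" using assms(2) by (simp add: cech_term_zero)
    then have "frac_rel (prod x A) (u A) N 0 0"
      using A assms(1) x_prod_closed[OF index_subset[OF A]] index_subset[OF A]
      by (simp add: cochain_def frac_eq_iff S_zero)
    then show ?thesis unfolding frac_rel_def by auto
  qed
  then obtain c where c: "\<And>A. A \<in> cech_index xs p \<Longrightarrow> prod x A ^ c A * u A \<in> I" by metis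
  define e where "e = (\<Sum>A\<in>cech_index xs p. c A)"
  have "shift x e u A \<in> I" if A: "A \<in> cech_index xs p" for A
  proof -
    have "c A \<le> e" unfolding e_def using A finite_cech_index by (intro member_le_sum) auto
    then have "shift x e u A = prod x A ^ (e - c A) * (prod x A ^ c A * u A)"
      by (simp add: mult.assoc[symmetric] power_add[symmetric])
    then show ?thesis using idl.subspace_scale[OF ideal c[OF A]] by simp
  qed
  then show thesis by (rule that)
qed

lemma cochain_cong:
  assumes "\<And>A. A \<subseteq> {..<r} \<Longrightarrow> u A \<in> S" "\<And>A. A \<subseteq> {..<r} \<Longrightarrow> v A \<in> S"
    "\<And>A. A \<in> cech_index xs p \<Longrightarrow> u A - v A \<in> I"
  shows "cochain p N u = cochain p N v"
  unfolding cochain_def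
proof (rule restrict_ext)
  fix A assume A: "A \<in> cech_index xs p"
  have "prod x A ^ N * (u A - v A) \<in> I" by (rule idl.subspace_scale[OF ideal assms(3)[OF A]])
  then have "frac_rel (prod x A) (u A) N (v A) N"
    unfolding frac_rel_def by (intro exI[of _ 0]) (simp add: right_diff_distrib)
  then show "frac (prod x A) (u A) N = frac (prod x A) (v A) N"
    using assms(1,2)[OF index_subset[OF A]] x_prod_closed[OF index_subset[OF A]] by (simp add: frac_eq_iff)
qed

lemma retract_power: "retract (a ^ k) = retract a ^ k"
  by (induction k) (simp_all add: retract_mult retract_id[OF one_closed])

lemma retract_koszul_diff:
  assumes "A \<subseteq> {..<r}"
  shows "retract (koszul_diff (\<lambda>j. x j ^ N) v A) = koszul_diff (\<lambda>j. x j ^ N) (\<lambda>B. retract (v B)) A"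
proof -
  have "retract (sum g B) = (\<Sum>j\<in>B. retract (g j))" for g and B :: "nat set"
    by (induction B rule: infinite_finite_induct) (simp_all add: retract_add)
  moreover have "retract (koszul_sign A j * x j ^ N * v (A - {j})) = koszul_sign A j * x j ^ N * retract (v (A - {j}))"
    if "j \<in> A" for j
    using that assms x_closed by (simp add: retract_mult retract_power retract_id koszul_sign_closed subset_iff)
  ultimately show ?thesis unfolding koszul_diff_def by simp
qed

text \<open>A primitive of the numerators modulo \<open>I\<close> exists in the larger ring only; its retraction is a
  primitive with values in \<open>S\<close>, because the elements of the sequence and the signs are fixed by
  the retraction.\<close>

lemma cocycle_is_coboundary:
  assumes van: "cohomology_vanishes_below x r I d" and p: "p < d"
    and c: "c \<in> cech_cocycles R xs M p"
  shows "c \<in> cech_coboundaries R xs M p"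
proof -
  have "c \<in> carrier (cech_term R xs M p)" using c by (simp add: cech_cocycles_def)
  then obtain N u where u: "valued u" "c = cochain p N u" by (rule cochain_exists)
  have "cochain (Suc p) N (koszul_diff (\<lambda>j. x j ^ N) u) = \<zero>\<^bsub>cech_term R xs M (Suc p)\<^esub>"
    using c u by (simp add: cech_cocycles_def cech_diff_cochain)
  then obtain e where e: "\<And>A. A \<in> cech_index xs (Suc p) \<Longrightarrow> shift x e (koszul_diff (\<lambda>j. x j ^ N) u) A \<in> I"
    using cochain_eq_zeroD koszul_diff_closed[OF u(1)] by metis
  have "koszul_cocycle x r I p (N + e) (shift x e u)"
    unfolding koszul_cocycle_def
  proof (intro allI impI)
    fix A assume A: "A \<subseteq> {..<r}" "card A = Suc p"
    then have "finite A" using finite_subset by blast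
    then show "koszul_diff (\<lambda>j. x j ^ (N + e)) (shift x e u) A \<in> I"
      using e[of A] A by (simp only: koszul_diff_transition cech_index_def mem_Collect_eq simp_thms)
  qed
  then have "dies_in_limit x r I p (N + e) (shift x e u)"
    using van p unfolding cohomology_vanishes_below_def by blast
  then have "dies_in_limit x r I p N u" by (rule dies_in_limit_shift)
  then obtain f v where v: "\<And>A. A \<subseteq> {..<r} \<Longrightarrow> card A = p \<Longrightarrow>
      shift x f u A - koszul_diff (\<lambda>j. x j ^ (N + f)) v A \<in> I"
    unfolding dies_in_limit_def by blast
  define w where "w = (\<lambda>A. retract (v A))"
  have w: "valued w" by (simp add: w_def retract_closed)
  have shifted: "shift x f u A \<in> S" if "A \<subseteq> {..<r}" for A
    using u(1) x_prod_closed[OF that] by (simp add: S_closed)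
  have diff: "shift x f u A - koszul_diff (\<lambda>j. x j ^ (N + f)) w A \<in> I" if A: "A \<in> cech_index xs p" for A
  proof -
    have "retract (shift x f u A - koszul_diff (\<lambda>j. x j ^ (N + f)) v A) \<in> I"
      using A by (intro retract_ideal v) (auto simp: cech_index_def)
    then show ?thesis
      using shifted[OF index_subset[OF A]] retract_koszul_diff[OF index_subset[OF A], of "N + f" v]
      by (simp only: retract_diff retract_id w_def)
  qed
  have cN: "c = cochain p (N + f) (koszul_diff (\<lambda>j. x j ^ (N + f)) w)"
    unfolding u(2) cochain_shift[OF u(1), of p N f, symmetric]
    using shifted koszul_diff_closed[OF w] diff by (rule cochain_cong)
  show ?thesis
  proof (cases p)
    case 0
    have "c = cochain 0 (N + f) (\<lambda>_. 0)"
      unfolding cN 0 cochain_def by (rule restrict_ext) (auto simp: cech_index_def dest: finite_subset)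
    then show ?thesis by (simp add: 0 cech_coboundaries_def cochain_zero)
  next
    case (Suc q)
    then show ?thesis
      unfolding cN cech_coboundaries_def
      by (simp add: cech_diff_cochain[OF w, symmetric] cochain_in_term[OF w])
  qed
qed

text \<open>The coboundaries form a group. This is needed because the cohomology module is a set of
  cosets: it is trivial only if every coset of a cocycle is the set of coboundaries itself.\<close>

lemma coboundaries_coset:
  assumes b: "b \<in> cech_coboundaries R xs M p" and c: "c \<in> cech_coboundaries R xs M p"
  shows "b \<oplus>\<^bsub>cech_term R xs M p\<^esub> c \<in> cech_coboundaries R xs M p"
    and "\<exists>h\<in>cech_coboundaries R xs M p. b = h \<oplus>\<^bsub>cech_term R xs M p\<^esub> c"
proof -
  have "b \<oplus>\<^bsub>cech_term R xs M p\<^esub> c \<in> cech_coboundaries R xs M p \<and>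
      (\<exists>h\<in>cech_coboundaries R xs M p. b = h \<oplus>\<^bsub>cech_term R xs M p\<^esub> c)"
  proof (cases p)
    case 0
    have "\<zero>\<^bsub>cech_term R xs M 0\<^esub> \<oplus>\<^bsub>cech_term R xs M 0\<^esub> \<zero>\<^bsub>cech_term R xs M 0\<^esub> = \<zero>\<^bsub>cech_term R xs M 0\<^esub>"
      using cochain_add[of "\<lambda>_. 0" "\<lambda>_. 0" 0 0] by (simp add: S_zero cochain_zero)
    then show ?thesis using b c by (simp add: 0 cech_coboundaries_def)
  next
    case (Suc q)
    let ?B = "cech_coboundaries R xs M p"
    have inB: "cech_diff R xs M q (cochain q N v) \<in> ?B" if "valued v" for N v
      by (simp add: Suc cech_coboundaries_def cochain_in_term that)
    have "\<exists>N v. valued v \<and> b = cech_diff R xs M q (cochain q N v)" if "b \<in> ?B" for b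
      using that cochain_exists unfolding cech_coboundaries_def Suc by (simp add: image_iff) metis
    then obtain N v N' v' where vb: "valued v" "b = cech_diff R xs M q (cochain q N v)"
      and vc: "valued v'" "c = cech_diff R xs M q (cochain q N' v')"
      using b c by meson
    define w where "w = (\<lambda>A. if A \<subseteq> {..<r} then shift x N' v A else 0)"
    define w' where "w' = (\<lambda>A. if A \<subseteq> {..<r} then shift x N v' A else 0)"
    have w: "valued w" "valued w'" unfolding w_def w'_def
      using vb(1) vc(1) x_prod_closed by (auto intro!: S_closed)
    define K where "K = N + N'"
    let ?d = "koszul_diff (\<lambda>j. x j ^ K)"
    have restr: "cochain q K (\<lambda>A. if A \<subseteq> {..<r} then g A else 0) = cochain q K g" for g
      unfolding cochain_def by (rule restrict_ext) (simp add: index_subset)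
    have bK: "cochain q N v = cochain q K w" "cochain q N' v' = cochain q K w'"
      unfolding w_def w'_def restr
      using cochain_shift[OF vb(1), of q N N'] cochain_shift[OF vc(1), of q N' N]
      by (simp_all add: K_def add.commute)
    have bd: "b = cochain p K (?d w)" "c = cochain p K (?d w')"
      unfolding vb(2) vc(2) bK Suc by (rule cech_diff_cochain[OF w(1)], rule cech_diff_cochain[OF w(2)])
    have add: "cech_diff R xs M q (cochain q K g) \<oplus>\<^bsub>cech_term R xs M p\<^esub> c
        = cech_diff R xs M q (cochain q K (\<lambda>A. g A + w' A))" if g: "valued g" for g
    proof -
      have gw: "valued (\<lambda>A. g A + w' A)" using g w by (simp add: S_add)
      let ?g = "\<lambda>A. if A \<subseteq> {..<r} then ?d g A else 0" and ?w' = "\<lambda>A. if A \<subseteq> {..<r} then ?d w' A else 0"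
      have restr': "cochain p K (\<lambda>A. if A \<subseteq> {..<r} then h A else 0) = cochain p K h" for h
        unfolding cochain_def by (rule restrict_ext) (simp add: index_subset)
      have "cochain p K ?g \<oplus>\<^bsub>cech_term R xs M p\<^esub> cochain p K ?w' = cochain p K (\<lambda>A. ?g A + ?w' A)"
        by (rule cochain_add) (use koszul_diff_closed[OF g] koszul_diff_closed[OF w(2)] S_zero in auto)
      also have "\<dots> = cochain p K (?d (\<lambda>A. g A + w' A))"
        unfolding cochain_def by (rule restrict_ext) (simp add: index_subset koszul_diff_add)
      finally show ?thesis
        unfolding restr'[of "?d g"] restr'[of "?d w'"] unfolding bd(2) Suc cech_diff_cochain[OF g] cech_diff_cochain[OF gw] .
    qed
    have "b \<oplus>\<^bsub>cech_term R xs M p\<^esub> c \<in> ?B"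
      unfolding vb(2) bK add[OF w(1)] using w by (intro inB) (simp add: S_add)
    moreover have diffw: "valued (\<lambda>A. w A - w' A)" using w by (simp add: S_diff)
    have "b = cech_diff R xs M q (cochain q K (\<lambda>A. w A - w' A)) \<oplus>\<^bsub>cech_term R xs M p\<^esub> c"
      unfolding add[OF diffw] by (simp add: vb(2) bK)
    ultimately show ?thesis using inB[OF diffw] by blast
  qed
  then show "b \<oplus>\<^bsub>cech_term R xs M p\<^esub> c \<in> cech_coboundaries R xs M p"
    "\<exists>h\<in>cech_coboundaries R xs M p. b = h \<oplus>\<^bsub>cech_term R xs M p\<^esub> c" by blast+
qed

theorem depth_lower_bound:
  assumes van: "cohomology_vanishes_below x r I d"
  shows "enat d \<le> depth R xs M"
proof -
  have "carrier (local_cohomology R xs M p) = {\<zero>\<^bsub>local_cohomology R xs M p\<^esub>}" if p: "p < d" for p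
  proof -
    let ?B = "cech_coboundaries R xs M p" and ?Z = "cech_cocycles R xs M p" and ?C = "cech_term R xs M p"
    have coset: "(\<Union>h\<in>?B. {h \<oplus>\<^bsub>?C\<^esub> c}) = ?B" if "c \<in> ?Z" for c
      using coboundaries_coset[OF _ cocycle_is_coboundary[OF van p that]] by blast
    have "\<zero>\<^bsub>?C\<^esub> \<in> ?Z"
    proof -
      have val: "valued (\<lambda>_. 0)" by (simp add: S_zero)
      have zero: "koszul_diff (\<lambda>j. x j ^ 0) (\<lambda>_. 0) = (\<lambda>_. 0)" by (simp add: koszul_diff_def fun_eq_iff)
      have "cech_diff R xs M p (cochain p 0 (\<lambda>_. 0)) = \<zero>\<^bsub>cech_term R xs M (Suc p)\<^esub>"
        unfolding cech_diff_cochain[OF val] zero by (rule cochain_zero)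
      then show ?thesis
        using cochain_in_term[OF val, of p 0] by (simp add: cech_cocycles_def cochain_zero)
    qed
    then have "(\<lambda>c. \<Union>h\<in>?B. {h \<oplus>\<^bsub>?C\<^esub> c}) ` ?Z = {?B}" using coset by auto
    moreover have "carrier (local_cohomology R xs M p) = (\<lambda>c. \<Union>h\<in>?B. {h \<oplus>\<^bsub>?C\<^esub> c}) ` ?Z"
      by (auto simp: local_cohomology_def quotient_module_def A_RCOSETS_def RCOSETS_def r_coset_def)
    ultimately show ?thesis by (simp add: local_cohomology_def quotient_module_def)
  qed
  then show ?thesis
    unfolding depth_def by (intro Inf_greatest) (auto simp: not_less[symmetric])
qed

end

section \<open>Ideals of 2-minors and of variables\<close>

lemma poly_mapping_single_induct [case_names zero single_add]:
  fixes f :: "'a \<Rightarrow>\<^sub>0 'b::comm_monoid_add"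
  assumes "P 0" "\<And>t c g. P g \<Longrightarrow> P (single t c + g)"
  shows "P f"
proof -
  have "P (\<Sum>t\<in>A. single t (lookup f t))" if "finite A" for A
    using that by (induction A rule: finite_induct) (simp_all add: assms)
  moreover have "f = (\<Sum>t\<in>keys f. single t (lookup f t))"
    by (rule poly_mapping_eqI) (simp add: lookup_sum lookup_single when_def in_keys_iff)
  ultimately show ?thesis by (metis finite_keys)
qed

lemma keys_plus_nat:
  fixes s t :: "'a \<Rightarrow>\<^sub>0 nat"
  shows "keys (s + t) = keys s \<union> keys t"
  by (auto simp: in_keys_iff lookup_add)

lemma decompose_monomial:
  fixes t :: "'a \<Rightarrow>\<^sub>0 nat"
  assumes "p \<in> keys t"
  obtains t' where "t = single p 1 + t'"
proof
  show "t = single p 1 + (t - single p 1)"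
    using assms by (intro poly_mapping_eqI) (auto simp: lookup_add lookup_minus lookup_single when_def in_keys_iff)
qed

abbreviation "pvar p \<equiv> xvar (fst p) (snd p)"

lemma pvar_mult_single:
  "pvar p * single t c = (single (single p 1 + t) c :: 'k::field mpoly)"
  by (simp add: xvar_def mult_single)

text \<open>The ring homomorphism that sets the variables in \<open>Z\<close> to zero.\<close>

definition kill :: "(nat \<times> nat) set \<Rightarrow> 'k::field mpoly \<Rightarrow> 'k mpoly" where
  "kill Z f = Abs_poly_mapping (\<lambda>t. lookup f t when keys t \<inter> Z = {})"

lemma lookup_kill:
  "lookup (kill Z f) t = (lookup f t when keys t \<inter> Z = {})"
proof -
  have "finite {t. (lookup f t when keys t \<inter> Z = {}) \<noteq> 0}"
    by (rule finite_subset[of _ "keys f"]) (auto simp: in_keys_iff when_def)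
  then show ?thesis unfolding kill_def by simp
qed

lemma kill_zero [simp]: "kill Z 0 = 0"
  by (rule poly_mapping_eqI) (simp add: lookup_kill)

lemma kill_add: "kill Z (f + g) = kill Z f + kill Z g"
  by (rule poly_mapping_eqI) (simp add: lookup_kill lookup_add when_def)

lemma kill_diff: "kill Z (f - g) = kill Z f - kill Z g"
  by (rule poly_mapping_eqI) (simp add: lookup_kill lookup_minus when_def)

lemma kill_single:
  "kill Z (single t c) = (if keys t \<inter> Z = {} then single t c else 0)"
  by (rule poly_mapping_eqI) (auto simp: lookup_kill lookup_single when_def)

lemma kill_mult: "kill Z (f * g) = kill Z f * kill Z g"
proof (induction f rule: poly_mapping_single_induct)
  case (single_add s c f)
  have "kill Z (single s c * g) = kill Z (single s c) * kill Z g"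
  proof (induction g rule: poly_mapping_single_induct)
    case (single_add t d g)
    have "kill Z (single s c * single t d)
      = kill Z (single s c) * kill Z (single t d)"
      by (auto simp: mult_single kill_single keys_plus_nat Int_Un_distrib2)
    then show ?case using single_add by (simp add: distrib_left kill_add)
  qed simp
  then show ?case using single_add by (simp add: distrib_right kill_add)
qed simp

lemma kill_pvar [simp]: "kill Z (xvar a b) = (if (a, b) \<in> Z then 0 else xvar a b)"
  by (simp add: xvar_def kill_single)

lemma diff_kill_in_span: "f - kill Z f \<in> idl.span (pvar ` Z)"
proof (induction f rule: poly_mapping_single_induct)
  case (single_add t c f)
  have "single t c - kill Z (single t c) \<in> idl.span (pvar ` Z)"
  proof (cases "keys t \<inter> Z = {}")
    case False
    then obtain p where p: "p \<in> keys t" "p \<in> Z" by blast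
    obtain t' where t': "t = single p 1 + t'" using decompose_monomial[OF p(1)] .
    have "single t c = single t' c * pvar p"
      unfolding t' pvar_mult_single[symmetric] by (rule mult.commute)
    then have "single t c \<in> idl.span (pvar ` Z)"
      using p(2) by (simp add: idl.span_scale idl.span_base)
    then show ?thesis using False by (simp add: kill_single)
  qed (simp add: kill_single idl.span_zero)
  from idl.span_add[OF this single_add] show ?case
    by (simp add: kill_add algebra_simps)
qed (simp add: idl.span_zero)

lemma kill_span_pvar:
  assumes "f \<in> idl.span (pvar ` Z)" shows "kill Z f = 0"
  using assms by (induction f rule: idl.span_induct_alt) (auto simp: kill_add kill_mult)

text \<open>An element of the left-hand side is \<open>f = g + c\<close> with \<open>c\<close> in the ideal of \<open>C\<close>. Its image
  under \<open>kill Z\<close> lies in the ideal of \<open>G\<close>, because \<open>f\<close> also has a representation in which the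
  generators beyond \<open>G\<close> are killed. The difference \<open>f - kill Z f\<close> lies there too: a multiple \<open>h c\<close>
  of a generator contributes \<open>(h - kill Z h) c + kill Z h (c - kill Z c)\<close>, and \<open>h - kill Z h\<close> is a
  combination of variables in \<open>Z\<close>.\<close>

lemma span_intersection_by_kill:
  fixes G C :: "'k::field mpoly set"
  assumes G: "\<And>g. g \<in> G \<Longrightarrow> kill Z g \<in> idl.span G"
    and C: "\<And>c. c \<in> C \<Longrightarrow> c - kill Z c \<in> idl.span G"
    and ZC: "\<And>z c. z \<in> Z \<Longrightarrow> c \<in> C \<Longrightarrow> pvar z * c \<in> idl.span G"
  shows "idl.span (G \<union> C) \<inter> idl.span (G \<union> pvar ` Z) = idl.span G"
proof (intro equalityI subsetI)
  have killG: "kill Z g \<in> idl.span G" if "g \<in> idl.span G" for g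
    using that
    by (induction g rule: idl.span_induct_alt)
      (auto simp: kill_add kill_mult intro!: idl.span_add idl.span_scale G idl.span_zero)
  have killC: "c - kill Z c \<in> idl.span G" if "c \<in> idl.span C" for c
    using that
  proof (induction c rule: idl.span_induct_alt)
    case (step h c d)
    have "q * c \<in> idl.span G" if "q \<in> idl.span (pvar ` Z)" for q
      using that
    proof (induction q rule: idl.span_induct_alt)
      case (step k z q)
      have "z * c \<in> idl.span G" using step(1) ZC \<open>c \<in> C\<close> by blast
      then have "k * (z * c) + q * c \<in> idl.span G"
        using step(2) by (simp only: idl.span_add idl.span_scale)
      then show ?case by (simp add: distrib_right mult.assoc)
    qed (simp add: idl.span_zero)
    then have "(h - kill Z h) * c \<in> idl.span G"
      using diff_kill_in_span by blast
    moreover have "kill Z h * (c - kill Z c) \<in> idl.span G"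
      by (intro idl.span_scale C step)
    ultimately have "(h - kill Z h) * c + kill Z h * (c - kill Z c) + (d - kill Z d) \<in> idl.span G"
      using step by (intro idl.span_add)
    then show ?case by (simp add: kill_add kill_mult algebra_simps)
  qed (simp add: idl.span_zero)
  fix f assume f: "f \<in> idl.span (G \<union> C) \<inter> idl.span (G \<union> pvar ` Z)"
  obtain g c where gc: "f = g + c" "g \<in> idl.span G" "c \<in> idl.span C"
    using f unfolding idl.span_Un by blast
  obtain g' z where gz: "f = g' + z" "g' \<in> idl.span G" "z \<in> idl.span (pvar ` Z)"
    using f unfolding idl.span_Un by blast
  have "kill Z f \<in> idl.span G"
    using gz killG by (simp add: kill_add kill_span_pvar)
  moreover have "(g - kill Z g) + (c - kill Z c) \<in> idl.span G"
    by (intro idl.span_add[OF idl.span_diff[OF gc(2) killG[OF gc(2)]]] killC gc(3))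
  ultimately have "kill Z f + ((g - kill Z g) + (c - kill Z c)) \<in> idl.span G"
    by (rule idl.span_add)
  then show "f \<in> idl.span G" by (simp add: gc(1) kill_add)
qed (use idl.span_mono[of G "G \<union> C"] idl.span_mono[of G "G \<union> pvar ` Z"] in auto)

definition minor2 :: "nat \<Rightarrow> nat \<Rightarrow> nat \<Rightarrow> nat \<Rightarrow> 'k::field mpoly" where
  "minor2 a c b d = xvar a b * xvar c d - xvar a d * xvar c b"

text \<open>Generators for both kinds of ideals below. The relation \<open>E\<close> on columns is adjacency for
  graphs, and the relation of lying in one block for blocks. Variables at positions outside \<open>Q\<close>
  are generators, so that deleting vertices and having finitely many variables both amount to
  making \<open>Q\<close> smaller. In the ideals that matter, minors that meet positions outside \<open>Q\<close> are
  combinations of these variables.\<close>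

definition minor_gens :: "(nat \<times> nat) set \<Rightarrow> (nat \<Rightarrow> nat \<Rightarrow> bool) \<Rightarrow> 'k::field mpoly set" where
  "minor_gens Q E = {minor2 a c b d | a c b d. E b d} \<union> pvar ` (- Q)"

lemma minor_in_gens: "E b d \<Longrightarrow> minor2 a c b d \<in> minor_gens Q E"
  unfolding minor_gens_def by blast

lemma pvar_in_gens: "(a, b) \<notin> Q \<Longrightarrow> xvar a b \<in> minor_gens Q E"
  unfolding minor_gens_def by (rule UnI2) (rule image_eqI[of _ _ "(a, b)"], auto)

lemma minor_gens_Un:
  "minor_gens Q E \<union> minor_gens Q' E' = minor_gens (Q \<inter> Q') (\<lambda>b d. E b d \<or> E' b d)"
  unfolding minor_gens_def by blast

lemma minor_gens_Un_vars: "minor_gens Q E \<union> pvar ` Z = minor_gens (Q - Z) E"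
  unfolding minor_gens_def by blast

lemma minor_gens_cases:
  assumes "g \<in> minor_gens Q E"
  obtains a c b d where "g = minor2 a c b d" "E b d" | a b where "g = xvar a b" "(a, b) \<notin> Q"
  using assms unfolding minor_gens_def by auto

text \<open>The splitting \<open>J(G) = J(G\<^sub>v) \<inter> ((X\<^sub>v) + J(G - v))\<close>.\<close>

lemma span_minor_gens_delete_vertex:
  assumes irrefl: "\<not> E v v"
  defines "E' \<equiv> \<lambda>b d. E b d \<or> (E v b \<and> E v d \<and> b \<noteq> d)"
  shows "idl.span (minor_gens Q E') \<inter> idl.span (minor_gens (Q - UNIV \<times> {v}) E)
    = (idl.span (minor_gens Q E) :: 'k::field mpoly set)"
proof -
  define C where "C = {minor2 a c k l :: 'k mpoly | a c k l. E v k \<and> E v l \<and> k \<noteq> l}"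
  have "minor_gens Q E \<union> C = minor_gens Q E'"
    unfolding minor_gens_def C_def E'_def by blast
  moreover have "idl.span (minor_gens Q E \<union> C) \<inter> idl.span (minor_gens Q E \<union> pvar ` (UNIV \<times> {v}))
    = idl.span (minor_gens Q E)"
  proof (rule span_intersection_by_kill)
    fix g :: "'k mpoly" assume "g \<in> minor_gens Q E"
    then show "kill (UNIV \<times> {v}) g \<in> idl.span (minor_gens Q E)"
    proof (cases rule: minor_gens_cases)
      case (1 a c b d)
      have "kill (UNIV \<times> {v}) g = (if b = v \<or> d = v then 0 else g)"
        unfolding 1 by (simp add: minor2_def kill_diff kill_mult)
      then show ?thesis using 1 by (auto intro: idl.span_zero idl.span_base minor_in_gens)
    next
      case (2 a b)
      then show ?thesis by (auto intro: idl.span_zero idl.span_base pvar_in_gens)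
    qed
  next
    fix c assume "c \<in> C"
    then obtain a e k l where c: "c = minor2 a e k l" "E v k" "E v l" "k \<noteq> l"
      unfolding C_def by blast
    then have "k \<noteq> v" "l \<noteq> v" using irrefl by auto
    then show "c - kill (UNIV \<times> {v}) c \<in> idl.span (minor_gens Q E)"
      unfolding c by (simp add: minor2_def kill_diff kill_mult idl.span_zero)
    fix z assume "z \<in> (UNIV :: nat set) \<times> {v}"
    then obtain r where r: "z = (r, v)" by auto
    have "pvar z * c = xvar e l * minor2 r a v k - xvar a l * minor2 r e v k + xvar r k * minor2 a e v l"
      unfolding r c minor2_def by (simp add: algebra_simps)
    then show "pvar z * c \<in> idl.span (minor_gens Q E)"
      using c by (simp only: idl.span_add idl.span_diff idl.span_scale idl.span_base minor_in_gens)
  qed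
  ultimately show ?thesis by (simp add: minor_gens_Un_vars)
qed

text \<open>With \<open>E\<close> an equivalence relation, \<open>x\<^sub>r\<^sub>d x\<^sub>e\<^sub>v\<close> is congruent to \<open>x\<^sub>r\<^sub>v x\<^sub>e\<^sub>d\<close>, so products
  of the variables in row \<open>r\<close> and in column \<open>v\<close> of one block vanish modulo the ideal and \<open>x\<^sub>r\<^sub>v\<close>.\<close>

lemma span_minor_gens_delete_position:
  assumes sym: "\<And>b d. E b d \<Longrightarrow> E d b" and trans: "\<And>b c d. E b c \<Longrightarrow> E c d \<Longrightarrow> E b d" and refl: "E v v"
  shows "idl.span (minor_gens (Q - UNIV \<times> {v}) E) \<inter> idl.span (minor_gens (Q - {r} \<times> {d. E v d}) E)
    = (idl.span (minor_gens (Q - {(r, v)}) E) :: 'k::field mpoly set)"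
proof -
  let ?G = "minor_gens (Q - {(r, v)}) E" and ?Z = "{r} \<times> {d. E v d}"
  have "idl.span (?G \<union> pvar ` (UNIV \<times> {v})) \<inter> idl.span (?G \<union> pvar ` ?Z) = (idl.span ?G :: 'k mpoly set)"
  proof (rule span_intersection_by_kill)
    fix g :: "'k mpoly" assume "g \<in> ?G"
    then show "kill ?Z g \<in> idl.span ?G"
    proof (cases rule: minor_gens_cases)
      case (1 a c b d)
      have "E v b \<longleftrightarrow> E v d" using 1(2) sym trans by blast
      then have "kill ?Z g = (if E v b \<and> (a = r \<or> c = r) then 0 else g)"
        unfolding 1 by (auto simp: minor2_def kill_diff kill_mult)
      then show ?thesis using 1 by (auto intro: idl.span_zero idl.span_base minor_in_gens)
    next
      case (2 a b)
      then show ?thesis by (auto intro: idl.span_zero idl.span_base pvar_in_gens)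
    qed
  next
    fix c :: "'k mpoly" assume "c \<in> pvar ` (UNIV \<times> {v})"
    then obtain e where c: "c = xvar e v" by auto
    show "c - kill ?Z c \<in> idl.span ?G"
      unfolding c using refl by (auto intro!: idl.span_zero idl.span_base pvar_in_gens)
    fix z assume "z \<in> ?Z"
    then obtain d where d: "z = (r, d)" "E v d" by auto
    have "pvar z * c = xvar e d * xvar r v - minor2 r e v d"
      unfolding d(1) c minor2_def by (simp add: algebra_simps)
    moreover have "xvar r v \<in> (?G :: 'k mpoly set)" "minor2 r e v d \<in> (?G :: 'k mpoly set)"
      using d by (auto intro: pvar_in_gens minor_in_gens)
    ultimately show "pvar z * c \<in> idl.span ?G"
      by (simp only: idl.span_diff idl.span_scale idl.span_base)
  qed
  moreover have "Q - {(r, v)} - UNIV \<times> {v} = Q - UNIV \<times> {v}" "Q - {(r, v)} - ?Z = Q - ?Z"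
    using refl by auto
  ultimately show ?thesis by (simp only: minor_gens_Un_vars)
qed

text \<open>Used twice: for a monomial it yields the degree in a set of variables, for a polynomial the
  sum of the coefficients of a set of monomials.\<close>

definition weight_sum :: "('a \<Rightarrow> bool) \<Rightarrow> ('a \<Rightarrow>\<^sub>0 'b::comm_monoid_add) \<Rightarrow> 'b" where
  "weight_sum W f = (\<Sum>t\<in>keys f. lookup f t when W t)"

lemma weight_sum_superset:
  assumes "finite A" "keys f \<subseteq> A"
  shows "weight_sum W f = (\<Sum>t\<in>A. lookup f t when W t)"
  unfolding weight_sum_def using assms
  by (intro sum.mono_neutral_left) (auto simp: in_keys_iff)

lemma weight_sum_zero [simp]: "weight_sum W 0 = 0"
  by (simp add: weight_sum_def)

lemma weight_sum_add: "weight_sum W (f + g) = weight_sum W f + weight_sum W g"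
proof -
  let ?A = "keys f \<union> keys g"
  have "keys (f + g) \<subseteq> ?A" by (rule keys_add)
  then show ?thesis
    by (simp add: weight_sum_superset[of ?A] lookup_add when_add_distrib sum.distrib)
qed

lemma weight_sum_single [simp]: "weight_sum W (single t c) = (c when W t)"
  by (cases "c = 0") (simp_all add: weight_sum_def)

lemma weight_sum_uminus: "weight_sum W (- f) = - weight_sum W (f :: 'a \<Rightarrow>\<^sub>0 'b::ab_group_add)"
  using weight_sum_add[of W f "- f"] by (simp add: eq_neg_iff_add_eq_0 add.commute)

lemma weight_sum_diff: "weight_sum W (f - g) = weight_sum W f - weight_sum W (g :: 'a \<Rightarrow>\<^sub>0 'b::ab_group_add)"
  using weight_sum_add[of W f "- g"] by (simp add: weight_sum_uminus)

lemma weight_sum_nat_eq_0_iff: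
  "weight_sum W (t :: 'a \<Rightarrow>\<^sub>0 nat) = 0 \<longleftrightarrow> (\<forall>p\<in>keys t. \<not> W p)"
  by (auto simp: weight_sum_def when_def in_keys_iff)

lemma weight_sum_nat_neq_0:
  "p \<in> keys t \<Longrightarrow> W p \<Longrightarrow> weight_sum W (t :: 'a \<Rightarrow>\<^sub>0 nat) \<noteq> 0"
  by (auto simp: weight_sum_nat_eq_0_iff)

text \<open>The row degrees and the column degrees of a monomial. A row is counted separately in each
  block of columns.\<close>

definition multidegree ::
  "(nat \<Rightarrow> nat \<Rightarrow> bool) \<Rightarrow> (nat \<times> nat \<Rightarrow>\<^sub>0 nat) \<Rightarrow> (nat \<Rightarrow> nat \<Rightarrow> nat) \<times> (nat \<Rightarrow> nat)" where
  "multidegree E t = (\<lambda>a b. weight_sum (\<lambda>p. fst p = a \<and> E b (snd p)) t, \<lambda>b. weight_sum (\<lambda>p. snd p = b) t)"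

lemma multidegree_eq_iff:
  "multidegree E s = multidegree E t \<longleftrightarrow>
    (\<forall>a b. weight_sum (\<lambda>p. fst p = a \<and> E b (snd p)) s = weight_sum (\<lambda>p. fst p = a \<and> E b (snd p)) t) \<and>
    (\<forall>b. weight_sum (\<lambda>p. snd p = b) s = weight_sum (\<lambda>p. snd p = b) t)"
  by (auto simp: multidegree_def fun_eq_iff)

lemma multidegree_add_cancel:
  "multidegree E (u + s) = multidegree E (u + t) \<longleftrightarrow> multidegree E s = multidegree E t"
  by (simp add: multidegree_eq_iff weight_sum_add)

lemma multidegree_add_cong:
  "multidegree E u = multidegree E v \<Longrightarrow> multidegree E (u + s) = multidegree E (v + s)"
  by (simp add: multidegree_eq_iff weight_sum_add)

text \<open>Positions that form one rectangle in each class of columns, as those of disjoint blocks do.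
  This is the condition under which two variables in columns of one class can exchange their
  columns.\<close>

locale block_shape =
  fixes Q :: "(nat \<times> nat) set" and E :: "nat \<Rightarrow> nat \<Rightarrow> bool"
  assumes sym: "\<And>b d. E b d \<Longrightarrow> E d b"
    and trans: "\<And>b c d. E b c \<Longrightarrow> E c d \<Longrightarrow> E b d"
    and refl: "\<And>a b. (a, b) \<in> Q \<Longrightarrow> E b b"
    and rectangle: "\<And>a b c d. (a, b) \<in> Q \<Longrightarrow> (c, d) \<in> Q \<Longrightarrow> E b d \<Longrightarrow> (a, d) \<in> Q"
begin

lemma multidegree_exchange:
  assumes "E b d"
  shows "multidegree E (single (a, b) 1 + single (c, d) 1)
    = multidegree E (single (c, b) 1 + single (a, d) 1)"
proof -
  have "E e b \<longleftrightarrow> E e d" for e using assms sym trans by blast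
  then show ?thesis by (auto simp: multidegree_eq_iff weight_sum_add when_def)
qed

text \<open>Both monomials are given a common variable by exchanging the columns of two variables of
  \<open>t\<close>, which does not change the class of \<open>t\<close>; then this variable is cancelled.\<close>

lemma monomials_congruent:
  fixes k :: "'k::field"
  assumes "keys s \<subseteq> Q" "keys t \<subseteq> Q" "multidegree E s = multidegree E t"
  shows "single s k - single t k \<in> idl.span (minor_gens Q E)"
  using assms
proof (induction "weight_sum (\<lambda>_. True) s" arbitrary: s t)
  case 0
  then have "weight_sum (\<lambda>_. True) s = 0" by simp
  then have "keys s = {}" unfolding weight_sum_nat_eq_0_iff by blast
  then have s: "s = 0" by simp
  have "keys t = {}"
  proof (rule ccontr)
    assume "keys t \<noteq> {}"
    then obtain p where "p \<in> keys t" by blast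
    moreover have "weight_sum (\<lambda>q. snd q = snd p) t = 0"
      using 0(4) unfolding s multidegree_eq_iff by simp
    ultimately show False by (auto simp: weight_sum_nat_eq_0_iff)
  qed
  then have "t = 0" by simp
  then show ?case by (simp add: s idl.span_zero)
next
  case (Suc n)
  then have "weight_sum (\<lambda>_. True) s \<noteq> 0" by simp
  then obtain p where "p \<in> keys s"
    unfolding weight_sum_nat_eq_0_iff by blast
  then obtain a b where ab: "(a, b) \<in> keys s" by (cases p) auto
  then have abQ: "(a, b) \<in> Q" using Suc.prems by blast
  obtain s' where s': "s = single (a, b) 1 + s'" using decompose_monomial[OF ab] .
  have conclude: "single s k - single t k \<in> idl.span (minor_gens Q E)"
    if t2: "single (single (a, b) 1 + t') k - single t k \<in> idl.span (minor_gens Q E)"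
      "keys t' \<subseteq> Q" "multidegree E (single (a, b) 1 + t') = multidegree E t" for t'
  proof -
    have "single s' k - single t' k \<in> idl.span (minor_gens Q E)"
    proof (rule Suc.hyps(1))
      show "n = weight_sum (\<lambda>_. True) s'" using Suc.hyps(2) by (simp add: s' weight_sum_add)
      show "keys s' \<subseteq> Q" using Suc.prems(1) by (simp add: s' keys_plus_nat)
      show "multidegree E s' = multidegree E t'"
        using Suc.prems(3) t2(3) unfolding s' by (metis multidegree_add_cancel)
    qed (rule t2(2))
    then have "pvar (a, b) * (single s' k - single t' k) \<in> idl.span (minor_gens Q E)"
      by (rule idl.span_scale)
    then have "single s k - single (single (a, b) 1 + t') k \<in> idl.span (minor_gens Q E)"
      unfolding right_diff_distrib pvar_mult_single s' .
    from idl.span_add[OF this t2(1)] show ?thesis by simp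
  qed
  show ?case
  proof (cases "(a, b) \<in> keys t")
    case True
    obtain t' where t': "t = single (a, b) 1 + t'" using decompose_monomial[OF True] .
    show ?thesis
      by (rule conclude[of t']) (use Suc.prems(2) in \<open>simp_all add: t' keys_plus_nat idl.span_zero\<close>)
  next
    case False
    have "weight_sum (\<lambda>p. fst p = a \<and> E b (snd p)) s \<noteq> 0"
      by (rule weight_sum_nat_neq_0[OF ab]) (simp add: refl[OF abQ])
    then have "weight_sum (\<lambda>p. fst p = a \<and> E b (snd p)) t \<noteq> 0"
      using Suc.prems(3) by (simp add: multidegree_eq_iff)
    then obtain d where d: "(a, d) \<in> keys t" "E b d"
      by (auto simp: weight_sum_nat_eq_0_iff)
    have "weight_sum (\<lambda>p. snd p = b) s \<noteq> 0"
      by (rule weight_sum_nat_neq_0[OF ab]) simp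
    then have "weight_sum (\<lambda>p. snd p = b) t \<noteq> 0"
      using Suc.prems(3) by (simp add: multidegree_eq_iff)
    then obtain c where c: "(c, b) \<in> keys t"
      by (auto simp: weight_sum_nat_eq_0_iff)
    obtain t1 where t1: "t = single (c, b) 1 + t1" using decompose_monomial[OF c] .
    have "(a, d) \<noteq> (c, b)" using c False by auto
    then have "(a, d) \<in> keys t1" using d by (auto simp: t1 keys_plus_nat)
    then obtain t2 where t2: "t1 = single (a, d) 1 + t2" by (rule decompose_monomial)
    \<comment> \<open>Exchange the columns: \<open>x\<^sub>c\<^sub>b x\<^sub>a\<^sub>d\<close> becomes \<open>x\<^sub>a\<^sub>b x\<^sub>c\<^sub>d\<close>.\<close>
    let ?t' = "single (c, d) 1 + t2"
    have "(c, d) \<in> Q" using rectangle[of c b a d] c d Suc.prems(2) by blast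
    then have keys: "keys ?t' \<subseteq> Q"
      using Suc.prems(2) by (simp add: t1 t2 keys_plus_nat)
    have "single (single (a, b) 1 + ?t') k - single t k
        = single t2 k * minor2 a c b d"
      unfolding t1 t2 minor2_def xvar_def by (simp add: algebra_simps mult_single)
    then have diff: "single (single (a, b) 1 + ?t') k - single t k
        \<in> idl.span (minor_gens Q E)"
      using d(2) by (simp only: idl.span_scale idl.span_base minor_in_gens)
    have "multidegree E (single (a, b) 1 + ?t') = multidegree E t"
      using multidegree_add_cong[OF multidegree_exchange[OF d(2), of a c], of t2]
      by (simp add: t1 t2 add.assoc)
    with diff keys show ?thesis by (rule conclude)
  qed
qed

text \<open>The coefficients of the monomials of one multidegree, summed. The ideal is the common kernel
  of these functionals, because it identifies exactly the monomials of equal multidegree.\<close>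

definition class_sum :: "(nat \<times> nat \<Rightarrow>\<^sub>0 nat) \<Rightarrow> 'k::field mpoly \<Rightarrow> 'k" where
  "class_sum t = weight_sum (\<lambda>s. keys s \<subseteq> Q \<and> multidegree E s = multidegree E t)"

lemma class_sum_span:
  assumes "f \<in> idl.span (minor_gens Q E)"
  shows "class_sum t f = 0"
  using assms
proof (induction f rule: idl.span_induct_alt)
  case (step h g f)
  have "class_sum t (h * g) = 0"
  proof (induction h rule: poly_mapping_single_induct)
    case (single_add s k h)
    have "class_sum t (single s k * g) = 0"
      using step(1)
    proof (cases rule: minor_gens_cases)
      case (1 a c b d)
      let ?u = "single (a, b) 1 + single (c, d) 1 + s"
      let ?v = "single (a, d) 1 + single (c, b) 1 + s"
      have "single s k * g = single ?u k - single ?v k"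
        unfolding 1 minor2_def xvar_def by (simp add: algebra_simps mult_single)
      moreover have "multidegree E ?u = multidegree E ?v"
        using multidegree_add_cong[OF multidegree_exchange[OF 1(2), of a c], of s]
        by (simp add: add.commute add.left_commute)
      moreover have "keys ?u \<subseteq> Q \<longleftrightarrow> keys ?v \<subseteq> Q"
        using rectangle[of a b c d] rectangle[of a d c b] rectangle[of c d a b] rectangle[of c b a d] 1(2) sym
        by (auto simp: keys_plus_nat)
      ultimately show ?thesis by (simp add: class_sum_def weight_sum_diff)
    next
      case (2 a b)
      then show ?thesis
        by (simp add: class_sum_def xvar_def mult_single keys_plus_nat)
    qed
    then show ?case using single_add by (simp add: distrib_right class_sum_def weight_sum_add)
  qed (simp add: class_sum_def)
  then show ?case using step by (simp add: class_sum_def weight_sum_add)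
qed (simp add: class_sum_def)

lemma span_if_class_sums_vanish:
  fixes f :: "'k::field mpoly"
  assumes "\<And>t. class_sum t f = 0"
  shows "f \<in> idl.span (minor_gens Q E)"
  using assms
proof (induction "card (keys f)" arbitrary: f rule: less_induct)
  case less
  show ?case
  proof (cases "f = 0")
    case False
    then obtain t where t: "t \<in> keys f" by (metis keys_eq_empty ex_in_conv)
    let ?c = "lookup f t"
    have reduce: "f \<in> idl.span (minor_gens Q E)"
      if g: "g \<in> idl.span (minor_gens Q E)" "keys (f - g) \<subseteq> keys f - {t}" for g
    proof -
      have "keys (f - g) \<subset> keys f" using g(2) t by blast
      then have "card (keys (f - g)) < card (keys f)"
        by (intro psubset_card_mono) simp_all
      moreover have "class_sum s (f - g) = 0" for s
        using class_sum_span[OF g(1)] less.prems by (simp add: class_sum_def weight_sum_diff)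
      ultimately have "f - g \<in> idl.span (minor_gens Q E)" by (rule less.hyps)
      from idl.span_add[OF this g(1)] show ?thesis by simp
    qed
    show ?thesis
    proof (cases "keys t \<subseteq> Q")
      case False
      then obtain p where p: "p \<in> keys t" "p \<notin> Q" by blast
      obtain t' where t': "t = single p 1 + t'" using decompose_monomial[OF p(1)] .
      show ?thesis
      proof (rule reduce)
        have "pvar p \<in> (minor_gens Q E :: 'k mpoly set)" using p(2) by (cases p) (simp add: pvar_in_gens)
        moreover have "single t ?c = single t' ?c * pvar p"
          by (subst mult.commute) (simp add: pvar_mult_single t')
        ultimately show "single t ?c \<in> idl.span (minor_gens Q E)"
          by (simp only: idl.span_scale idl.span_base)
        show "keys (f - single t ?c) \<subseteq> keys f - {t}"
          by (auto simp: in_keys_iff lookup_minus lookup_single when_def split: if_splits)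
      qed
    next
      case True
      have "\<exists>s\<in>keys f - {t}. keys s \<subseteq> Q \<and> multidegree E s = multidegree E t"
      proof (rule ccontr)
        assume "\<not> ?thesis"
        then have "class_sum t f = (\<Sum>s\<in>{t}. lookup f s)"
          unfolding class_sum_def weight_sum_def using t True
          by (intro sum.mono_neutral_cong_right) (auto simp: when_def)
        then show False using less.prems[of t] t by (simp add: in_keys_iff)
      qed
      then obtain s where s: "s \<in> keys f" "s \<noteq> t" "keys s \<subseteq> Q"
        "multidegree E s = multidegree E t" by blast
      show ?thesis
      proof (rule reduce)
        show "single t ?c - single s ?c \<in> idl.span (minor_gens Q E)"
          by (rule monomials_congruent[OF True s(3) s(4)[symmetric]])
        show "keys (f - (single t ?c - single s ?c)) \<subseteq> keys f - {t}"
          using s(1,2) by (auto simp: in_keys_iff lookup_minus lookup_single when_def split: if_splits)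
      qed
    qed
  qed (simp add: idl.span_zero)
qed

text \<open>Multiplication by a variable in \<open>Q\<close> is a bijection between the monomials of one multidegree
  and those divisible by this variable of another, so it preserves class sums.\<close>

theorem pvar_regular:
  assumes "(a, b) \<in> Q" "xvar a b * f \<in> idl.span (minor_gens Q E)"
  shows "f \<in> idl.span (minor_gens Q E)"
proof (rule span_if_class_sums_vanish)
  fix t
  have "class_sum (single (a, b) 1 + t) (xvar a b * f) = class_sum t f"
  proof (induction f rule: poly_mapping_single_induct)
    case (single_add s k f)
    have "xvar a b * single s k = single (single (a, b) 1 + s) k"
      using pvar_mult_single[of "(a, b)" s k] by simp
    then show ?case
      using single_add assms(1)
      by (simp add: class_sum_def distrib_left weight_sum_add multidegree_add_cancel keys_plus_nat)
  qed (simp add: class_sum_def)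
  then show "class_sum t f = 0" using class_sum_span[OF assms(2)] by metis
qed

end

text \<open>The relation only matters between distinct columns that meet \<open>Q\<close>: a minor with a repeated
  column is zero, and one with a dead column is a combination of variables outside \<open>Q\<close>.\<close>

lemma span_minor_gens_subset:
  assumes "\<And>a c b d. b \<noteq> d \<Longrightarrow> (a, b) \<in> Q \<Longrightarrow> (c, d) \<in> Q \<Longrightarrow> E b d \<Longrightarrow> E' b d"
  shows "idl.span (minor_gens Q E) \<subseteq> idl.span (minor_gens Q E' :: 'k::field mpoly set)"
proof (rule idl.span_minimal[OF subsetI idl.subspace_span])
  fix g :: "'k mpoly" assume "g \<in> minor_gens Q E"
  then show "g \<in> idl.span (minor_gens Q E')"
  proof (cases rule: minor_gens_cases)
    case (1 a c b d)
    let ?dead = "\<lambda>b. \<forall>a. (a, b) \<notin> Q"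
    consider "E' b d" | "b = d" | "?dead b" | "?dead d"
      using assms[of b d] 1(2) by blast
    then show ?thesis
    proof cases
      case 1
      then show ?thesis unfolding \<open>g = minor2 a c b d\<close> by (intro idl.span_base minor_in_gens)
    next
      case 2
      then show ?thesis unfolding \<open>g = minor2 a c b d\<close> by (simp add: minor2_def mult.commute idl.span_zero)
    next
      case 3
      have "g = xvar c d * xvar a b - xvar a d * xvar c b"
        unfolding \<open>g = minor2 a c b d\<close> minor2_def by (simp add: mult.commute)
      moreover have "xvar a b \<in> idl.span (minor_gens Q E' :: 'k mpoly set)" "xvar c b \<in> idl.span (minor_gens Q E' :: 'k mpoly set)"
        using 3 by (auto intro!: idl.span_base pvar_in_gens)
      ultimately show ?thesis by (simp only: idl.span_diff idl.span_scale)
    next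
      case 4
      have "g = xvar a b * xvar c d - xvar c b * xvar a d"
        unfolding \<open>g = minor2 a c b d\<close> minor2_def by (simp add: mult.commute)
      moreover have "xvar c d \<in> idl.span (minor_gens Q E' :: 'k mpoly set)" "xvar a d \<in> idl.span (minor_gens Q E' :: 'k mpoly set)"
        using 4 by (auto intro!: idl.span_base pvar_in_gens)
      ultimately show ?thesis by (simp only: idl.span_diff idl.span_scale)
    qed
  qed (simp add: idl.span_base pvar_in_gens)
qed

lemma span_minor_gens_cong:
  assumes "Q = Q'" "\<And>a c b d. b \<noteq> d \<Longrightarrow> (a, b) \<in> Q' \<Longrightarrow> (c, d) \<in> Q' \<Longrightarrow> E b d \<longleftrightarrow> E' b d"
  shows "idl.span (minor_gens Q E) = idl.span (minor_gens Q' E')"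
  unfolding assms(1) using assms(2) by (intro equalityI span_minor_gens_subset) blast+

section \<open>Disjoint blocks of 2-minors\<close>

abbreviation vanishes :: "nat \<Rightarrow> nat \<Rightarrow> 'k::field mpoly set \<Rightarrow> nat \<Rightarrow> bool" where
  "vanishes m n J d \<equiv> cohomology_vanishes_below (\<lambda>i. xvars m n ! i) (length (xvars m n :: 'k mpoly list)) (J :: 'k mpoly set) d"

text \<open>The dimension of the ring of a generic matrix modulo its 2-minors. An empty block
  contributes the base field.\<close>

definition block_depth :: "nat set \<Rightarrow> nat set \<Rightarrow> nat" where
  "block_depth A B = (if A = {} \<or> B = {} then 0 else card A + card B - 1)"

lemma block_depth_singleton [simp]:
  "finite A \<Longrightarrow> block_depth A {b} = card A" "finite A \<Longrightarrow> block_depth {b} A = card A"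
  by (cases "A = {}"; simp add: block_depth_def)+

lemma set_xvars: "set (xvars m n) = {xvar a b | a b. a \<in> {1..m} \<and> b \<in> {1..n}}"
  unfolding xvars_def by (auto simp: atLeastLessThanSuc_atLeastAtMost simp del: upt_Suc) blast

lemma xvars_index:
  assumes "a \<in> {1..m}" "b \<in> {1..n}"
  obtains j where "j < length (xvars m n :: 'k::field mpoly list)" "xvars m n ! j = (xvar a b :: 'k mpoly)"
proof -
  have "(xvar a b :: 'k mpoly) \<in> set (xvars m n)" unfolding set_xvars using assms by blast
  then show ?thesis using that by (auto simp: in_set_conv_nth)
qed

text \<open>Induction on the size of the blocks. The classes \<open>B0 i\<close> are fixed, while the blocks
  \<open>A i \<times> B i\<close> shrink inside them. Dividing by the regular variable \<open>x\<^sub>a\<^sub>b\<close> removes one position,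
  and the ideal then splits into the ones without row \<open>a\<close> and without column \<open>b\<close>. In a block with
  a single row or column this splitting is trivial: removing the position is then the same as
  removing its column or row.\<close>

theorem vanishes_blocks:
  fixes A B B0 :: "'i \<Rightarrow> nat set"
  assumes T: "finite T"
    and disjoint: "\<And>i j. i \<in> T \<Longrightarrow> j \<in> T \<Longrightarrow> i \<noteq> j \<Longrightarrow> B0 i \<inter> B0 j = {}"
    and B0: "\<And>i. i \<in> T \<Longrightarrow> B0 i \<subseteq> {1..n}"
  defines "E \<equiv> \<lambda>b d. \<exists>i\<in>T. b \<in> B0 i \<and> d \<in> B0 i"
  assumes A: "\<And>i. i \<in> T \<Longrightarrow> A i \<subseteq> {1..m}"
    and B: "\<And>i. i \<in> T \<Longrightarrow> B i \<subseteq> B0 i"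
  shows "vanishes m n (idl.span (minor_gens (\<Union>i\<in>T. A i \<times> B i) E) :: 'k::field mpoly set)
    (\<Sum>i\<in>T. block_depth (A i) (B i))"
  using A B
proof (induction "\<Sum>i\<in>T. card (A i) + card (B i)" arbitrary: A B rule: less_induct)
  case (less A B)
  let ?Q = "\<lambda>A B. \<Union>i\<in>T. A i \<times> B i"
  let ?N = "\<lambda>A B. \<Sum>i\<in>T. block_depth (A i) (B i)"
  let ?J = "\<lambda>Q. idl.span (minor_gens Q E) :: 'k mpoly set"
  have same: "i = j" if "i \<in> T" "j \<in> T" "b \<in> B0 i" "b \<in> B0 j" for i j b
    using disjoint[of i j] that by blast
  show ?case
  proof (cases "\<exists>i\<in>T. A i \<noteq> {} \<and> B i \<noteq> {}")
    case False
    then have "?N A B = 0" by (simp add: block_depth_def)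
    then show ?thesis by (simp add: cohomology_vanishes_below_def)
  next
    case True
    then obtain i a b where i: "i \<in> T" and a: "a \<in> A i" and b: "b \<in> B i" by blast
    have finA: "finite (A i)" and finB: "finite (B i)" and b0: "b \<in> B0 i"
      using less.prems[OF i] B0[OF i] b finite_subset[of _ "{1..m}"] finite_subset[of _ "{1..n}"] by auto
    have ab: "(a, b) \<in> ?Q A B" using i a b by blast
    interpret block_shape "?Q A B" E
    proof
      show "E b c \<Longrightarrow> E c d \<Longrightarrow> E b d" for b c d unfolding E_def using same by blast
      show "E b b" if "(a, b) \<in> ?Q A B" for a b unfolding E_def using that less.prems(2) by blast
      show "(a, d) \<in> ?Q A B" if Q: "(a, b) \<in> ?Q A B" "(c, d) \<in> ?Q A B" and "E b d" for a b c d
      proof -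
        obtain i j where "i \<in> T" "j \<in> T" "a \<in> A i" "b \<in> B i" "c \<in> A j" "d \<in> B j" using Q by blast
        moreover from this \<open>E b d\<close> have "i = j" unfolding E_def using same less.prems(2) by blast
        ultimately show ?thesis by blast
      qed
    qed (auto simp: E_def)
    define A' where "A' = A(i := A i - {a})"
    define B' where "B' = B(i := B i - {b})"
    define s where "s = (\<Sum>j\<in>T - {i}. block_depth (A j) (B j))"
    have NAB: "?N A B = block_depth (A i) (B i) + s" "?N A' B = block_depth (A i - {a}) (B i) + s"
      "?N A B' = block_depth (A i) (B i - {b}) + s" "?N A' B' = block_depth (A i - {a}) (B i - {b}) + s"
      unfolding s_def A'_def B'_def by (simp_all add: sum.remove[OF T i])
    have card_less: "card (A i - {a}) < card (A i)" "card (B i - {b}) < card (B i)"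
      by (rule card_Diff1_less[OF finA a], rule card_Diff1_less[OF finB b])
    let ?size = "\<lambda>A B. \<Sum>i\<in>T. card (A i) + card (B i)"
    have smaller: "?size A' B < ?size A B" "?size A B' < ?size A B" "?size A' B' < ?size A B"
      unfolding A'_def B'_def using card_less by (simp_all add: sum.remove[OF T i])
    have sub: "j \<in> T \<Longrightarrow> A' j \<subseteq> {1..m}" "j \<in> T \<Longrightarrow> B' j \<subseteq> B0 j" for j
      using less.prems[of j] by (auto simp: A'_def B'_def)
    have IH: "vanishes m n (?J (?Q A' B)) (?N A' B)" "vanishes m n (?J (?Q A B')) (?N A B')"
      "vanishes m n (?J (?Q A' B')) (?N A' B')"
      by (rule less.hyps; use smaller less.prems sub in simp)+
    have class_b: "{d. E b d} = B0 i" unfolding E_def using i b0 same by blast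
    have Qrow: "?Q A B - {a} \<times> {d. E b d} = ?Q A' B"
      unfolding class_b A'_def using i less.prems(2) same
      by (auto split: if_splits) (metis less.prems(2) subsetD)+
    have Qcol: "?Q A B - UNIV \<times> {b} = ?Q A B'"
      unfolding B'_def using i less.prems(2) same b0
      by (auto split: if_splits) (metis less.prems(2) subsetD)+
    have "vanishes m n (?J (?Q A B - {(a, b)})) (?N A B - 1)"
    proof -
      consider "B i = {b}" | "A i = {a}" | "card (A i) \<ge> 2" "card (B i) \<ge> 2"
      proof -
        have "card (A i) \<noteq> 0" "card (B i) \<noteq> 0" using a b finA finB by auto
        moreover have "A i = {a}" if "card (A i) = 1" using that a by (auto simp: card_1_singleton_iff)
        moreover have "B i = {b}" if "card (B i) = 1" using that b by (auto simp: card_1_singleton_iff)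
        ultimately show ?thesis using that by linarith
      qed
      then show ?thesis
      proof cases
        case 1
        have "?Q A B - {(a, b)} = ?Q A' B"
          unfolding Qrow[symmetric] class_b using same i b0 less.prems(2) 1 by (auto; metis less.prems(2) subsetD singletonD)
        moreover have "?N A B - 1 \<le> ?N A' B"
          unfolding NAB 1 using a finA by simp
        ultimately show ?thesis by (simp only: cohomology_vanishes_below_mono[OF IH(1)])
      next
        case 2
        have "?Q A B - {(a, b)} = ?Q A B'"
          unfolding Qcol[symmetric] using same i b0 less.prems(2) 2 by (auto; metis less.prems(2) subsetD singletonD)
        moreover have "?N A B - 1 \<le> ?N A B'"
          unfolding NAB 2 using b finB by simp
        ultimately show ?thesis by (simp only: cohomology_vanishes_below_mono[OF IH(2)])
      next
        case 3
        have depths: "block_depth (A i) (B i) = card (A i) + card (B i) - 1"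
          "block_depth (A i - {a}) (B i) = card (A i) + card (B i) - 2"
          "block_depth (A i) (B i - {b}) = card (A i) + card (B i) - 2"
          "block_depth (A i - {a}) (B i - {b}) = card (A i) + card (B i) - 3"
        proof -
          have cards: "card (A i - {a}) = card (A i) - 1" "card (B i - {b}) = card (B i) - 1"
            using a b finA finB by simp_all
          have "card (A i - {a}) \<noteq> 0" "card (B i - {b}) \<noteq> 0" using 3 cards by linarith+
          then have "A i - {a} \<noteq> {}" "B i - {b} \<noteq> {}" "A i \<noteq> {}" "B i \<noteq> {}"
            using a b by (metis card.empty, metis card.empty, blast+)
          note ne = this[THEN eq_False[THEN iffD2]]
          show "block_depth (A i) (B i) = card (A i) + card (B i) - 1"
            "block_depth (A i - {a}) (B i) = card (A i) + card (B i) - 2"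
            "block_depth (A i) (B i - {b}) = card (A i) + card (B i) - 2"
            "block_depth (A i - {a}) (B i - {b}) = card (A i) + card (B i) - 3"
            using 3 unfolding block_depth_def cards by (simp_all only: ne simp_thms if_False)
        qed
        have "?Q A B' \<inter> ?Q A' B = ?Q A' B'"
          unfolding A'_def B'_def using same less.prems(2) i b0
          by (auto split: if_splits)
        then have union: "minor_gens (?Q A B') E \<union> minor_gens (?Q A' B) E = (minor_gens (?Q A' B') E :: 'k mpoly set)"
          unfolding minor_gens_Un by simp
        have "vanishes m n (?J (?Q A B') \<inter> ?J (?Q A' B)) (?N A B - 1)"
        proof (rule vanishes_below_intersection)
          have N: "?N A B - 1 \<le> ?N A B'" "?N A B - 1 \<le> ?N A' B" "?N A B - 1 - 1 \<le> ?N A' B'"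
            unfolding NAB depths using 3 by linarith+
          show "vanishes m n (?J (?Q A B')) (?N A B - 1)" "vanishes m n (?J (?Q A' B)) (?N A B - 1)"
            by (rule cohomology_vanishes_below_mono[OF IH(2) N(1)], rule cohomology_vanishes_below_mono[OF IH(1) N(2)])
          show "vanishes m n (idl.span (minor_gens (?Q A B') E \<union> minor_gens (?Q A' B) E) :: 'k mpoly set) (?N A B - 1 - 1)"
            unfolding union by (rule cohomology_vanishes_below_mono[OF IH(3) N(3)])
        qed
        moreover have "?J (?Q A B') \<inter> ?J (?Q A' B) = ?J (?Q A B - {(a, b)})"
          unfolding Qcol[symmetric] Qrow[symmetric]
          by (rule span_minor_gens_delete_position) (rule sym trans refl[OF ab]; assumption)+
        ultimately show ?thesis by simp
      qed
    qed
    moreover have "minor_gens (?Q A B - {(a, b)}) E = (insert (xvar a b) (minor_gens (?Q A B) E) :: 'k mpoly set)"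
      using minor_gens_Un_vars[of "?Q A B" E "{(a, b)}", symmetric] by simp
    ultimately have van: "vanishes m n (idl.span (insert (xvar a b) (minor_gens (?Q A B) E)) :: 'k mpoly set) (?N A B - 1)"
      by (simp only:)
    have "a \<in> {1..m}" "b \<in> {1..n}" using less.prems(1)[OF i] B0[OF i] a b0 by blast+
    then obtain j where j: "j < length (xvars m n :: 'k mpoly list)" "xvars m n ! j = (xvar a b :: 'k mpoly)"
      by (rule xvars_index)
    have "vanishes m n (?J (?Q A B)) (Suc (?N A B - 1))"
    proof (rule vanishes_below_regular)
      show "j < length (xvars m n :: 'k mpoly list)" by (rule j(1))
      show "f \<in> ?J (?Q A B)" if "xvars m n ! j * f \<in> ?J (?Q A B)" for f
        using that pvar_regular[OF ab] unfolding j(2) by blast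
      show "vanishes m n (idl.span (insert (xvars m n ! j) (minor_gens (?Q A B) E)) :: 'k mpoly set) (?N A B - 1)"
        unfolding j(2) by (rule van)
    qed
    then show ?thesis by (rule cohomology_vanishes_below_mono) simp
  qed
qed

section \<open>Induction along a d-compatible map\<close>

text \<open>The edge ideal in the ring with infinitely many variables; the variables in rows outside
  \<open>{1..m}\<close> or in columns that are not vertices are set to zero.\<close>

definition edge_span :: "nat \<Rightarrow> ugraph \<Rightarrow> 'k::field mpoly set" where
  "edge_span m G = idl.span (minor_gens ({1..m} \<times> verts G) (\<lambda>b d. {b, d} \<in> edges G))"

lemma verts_del_vertex [simp]: "verts (del_vertex G v) = verts G - {v}"
  by (auto simp: del_vertex_def induced_graph_def)

lemma edges_del_vertex: "simple_graph G \<Longrightarrow> edges (del_vertex G v) = {e \<in> edges G. v \<notin> e}"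
  by (auto simp: del_vertex_def induced_graph_def simple_graph_def)

lemma verts_complete_at [simp]: "verts (complete_at G v) = verts G"
  by (simp add: complete_at_def)

lemma simple_graph_edgeD:
  assumes "simple_graph G" "{u, w} \<in> edges G"
  shows "u \<in> verts G" "w \<in> verts G" "u \<noteq> w"
  using assms unfolding simple_graph_def by fastforce+

lemma edge_complete_at_iff:
  "{u, w} \<in> edges (complete_at G v) \<longleftrightarrow>
    {u, w} \<in> edges G \<or> ({v, u} \<in> edges G \<and> {v, w} \<in> edges G \<and> u \<noteq> w)"
proof -
  have "(\<exists>a b. {u, w} = {a, b} \<and> {a, v} \<in> edges G \<and> {b, v} \<in> edges G \<and> a \<noteq> b) \<longleftrightarrow>
      {u, v} \<in> edges G \<and> {w, v} \<in> edges G \<and> u \<noteq> w"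
    by (metis doubleton_eq_iff)
  then show ?thesis unfolding complete_at_def nbhd_def by (simp add: insert_commute)
qed

lemma simple_del_vertex: "simple_graph G \<Longrightarrow> simple_graph (del_vertex G v)"
  by (auto simp: simple_graph_def del_vertex_def induced_graph_def)

lemma simple_complete_at:
  assumes "simple_graph G" shows "simple_graph (complete_at G v)"
proof -
  have "e \<subseteq> verts G \<and> card e = 2" if "e \<in> edges (complete_at G v)" for e
    using that assms simple_graph_edgeD[OF assms]
    unfolding complete_at_def nbhd_def by (auto simp: simple_graph_def)
  then show ?thesis using assms by (simp add: simple_graph_def)
qed

lemma nonfree_witness:
  assumes "\<not> free_vertex G v"
  obtains u w where "{u, v} \<in> edges G" "{w, v} \<in> edges G" "u \<noteq> w" "{u, w} \<notin> edges G" 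
proof -
  obtain u w where "u \<in> verts (induced_graph G (nbhd G v))" "w \<in> verts (induced_graph G (nbhd G v))"
     "u \<noteq> w" "{u, w} \<notin> edges (induced_graph G (nbhd G v))"
    using assms unfolding free_vertex_def is_complete_def by blast
  then show ?thesis by (intro that[of u w]) (auto simp: induced_graph_def nbhd_def)
qed

text \<open>Decreases under all three operations at a vertex that is not free: deletion removes a vertex
  and adds no missing edge, and completion adds a missing edge.\<close>

definition graph_size :: "ugraph \<Rightarrow> nat" where
  "graph_size G = card (verts G) + card {e. e \<subseteq> verts G \<and> card e = 2 \<and> e \<notin> edges G}"

lemma finite_non_edges: "simple_graph G \<Longrightarrow> finite {e. e \<subseteq> verts G \<and> card e = 2 \<and> e \<notin> edges G}"
  by (rule finite_subset[of _ "Pow (verts G)"]) (auto simp: simple_graph_def)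

lemma graph_size_del_vertex:
  assumes "simple_graph G" "v \<in> verts G"
  shows "graph_size (del_vertex G v) < graph_size G"
proof -
  have "card {e. e \<subseteq> verts (del_vertex G v) \<and> card e = 2 \<and> e \<notin> edges (del_vertex G v)}
      \<le> card {e. e \<subseteq> verts G \<and> card e = 2 \<and> e \<notin> edges G}"
    using assms(1) by (intro card_mono finite_non_edges) (auto simp: edges_del_vertex)
  moreover have "card (verts (del_vertex G v)) < card (verts G)"
    unfolding verts_del_vertex using assms by (intro card_Diff1_less) (auto simp: simple_graph_def)
  ultimately show ?thesis unfolding graph_size_def by linarith
qed

lemma graph_size_complete_at:
  assumes "simple_graph G" "\<not> free_vertex G v"
  shows "graph_size (complete_at G v) < graph_size G"
proof -
  obtain u w where uw: "{u, v} \<in> edges G" "{w, v} \<in> edges G" "u \<noteq> w" "{u, w} \<notin> edges G"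
    using nonfree_witness[OF assms(2)] by metis
  have "{e. e \<subseteq> verts (complete_at G v) \<and> card e = 2 \<and> e \<notin> edges (complete_at G v)}
      \<subset> {e. e \<subseteq> verts G \<and> card e = 2 \<and> e \<notin> edges G}"
  proof (rule psubsetI)
    show "{e. e \<subseteq> verts (complete_at G v) \<and> card e = 2 \<and> e \<notin> edges (complete_at G v)}
      \<subseteq> {e. e \<subseteq> verts G \<and> card e = 2 \<and> e \<notin> edges G}"
      by (auto simp: complete_at_def)
    have "{u, w} \<in> edges (complete_at G v)" using uw by (simp add: edge_complete_at_iff insert_commute)
    moreover have "{u, w} \<subseteq> verts G" "card {u, w} = 2"
      using uw simple_graph_edgeD[OF assms(1)] by auto
    ultimately show "{e. e \<subseteq> verts (complete_at G v) \<and> card e = 2 \<and> e \<notin> edges (complete_at G v)}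
      \<noteq> {e. e \<subseteq> verts G \<and> card e = 2 \<and> e \<notin> edges G}" using uw(4) by blast
  qed
  then show ?thesis unfolding graph_size_def
    by (simp add: psubset_card_mono finite_non_edges assms(1))
qed

lemma vanishes_complete_union:
  assumes "complete_union G P" "simple_graph G" "verts G \<subseteq> {1..n}" and m: "1 \<le> m"
  shows "vanishes m n (edge_span m G :: 'k::field mpoly set) (card P * (m - 1) + (\<Sum>A\<in>P. card A))"
proof -
  have P: "\<Union>P = verts G" "disjoint P" "{} \<notin> P" and
    edges: "edges G = {{u, v} | u v A. A \<in> P \<and> u \<in> A \<and> v \<in> A \<and> u \<noteq> v}"
    using assms(1) unfolding complete_union_def partition_on_def by auto
  have fin: "finite (verts G)" using assms(2) by (simp add: simple_graph_def)
  have finP: "finite P" using P(1) fin by (metis finite_UnionD)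
  have "(\<Sum>A\<in>P. block_depth {1..m} A) = (\<Sum>A\<in>P. (m - 1) + card A)"
    using P(3) m by (intro sum.cong) (auto simp: block_depth_def)
  also have "\<dots> = card P * (m - 1) + (\<Sum>A\<in>P. card A)" by (simp add: sum.distrib)
  finally have depth: "(\<Sum>A\<in>P. block_depth {1..m} A) = card P * (m - 1) + (\<Sum>A\<in>P. card A)" .
  have "vanishes m n (idl.span (minor_gens (\<Union>A\<in>P. {1..m} \<times> A) (\<lambda>b d. \<exists>A\<in>P. b \<in> A \<and> d \<in> A)) :: 'k mpoly set)
      (\<Sum>A\<in>P. block_depth {1..m} A)"
  proof (rule vanishes_blocks[where B0 = "\<lambda>A. A"])
    show "A \<inter> B = {}" if "A \<in> P" "B \<in> P" "A \<noteq> B" for A B using P(2) that by (auto simp: disjoint_def)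
    show "A \<subseteq> {1..n}" if "A \<in> P" for A using that P(1) assms(3) by blast
  qed (use finP in auto)
  moreover have "idl.span (minor_gens (\<Union>A\<in>P. {1..m} \<times> A) (\<lambda>b d. \<exists>A\<in>P. b \<in> A \<and> d \<in> A)) = (edge_span m G :: 'k mpoly set)"
    unfolding edge_span_def
  proof (rule span_minor_gens_cong)
    show "(\<Union>A\<in>P. {1..m} \<times> A) = {1..m} \<times> verts G" using P(1) by blast
    show "(\<exists>A\<in>P. b \<in> A \<and> d \<in> A) \<longleftrightarrow> {b, d} \<in> edges G" if "b \<noteq> d" for b d
      using that unfolding edges by (auto simp: doubleton_eq_iff)
  qed
  ultimately show ?thesis by (simp only: depth)
qed

text \<open>The two ideals of the exact sequence for \<open>v\<close>. The second part holds because the edges of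
  \<open>G - v\<close> are edges of \<open>G\<^sub>v\<close>, and the minors of \<open>G\<^sub>v\<close> at column \<open>v\<close> become redundant with the
  variables of this column.\<close>

lemma edge_span_intersection:
  assumes "simple_graph G"
  shows "edge_span m (complete_at G v) \<inter> edge_span m (del_vertex G v) = (edge_span m G :: 'k::field mpoly set)"
    and "edge_span m (del_vertex (complete_at G v) v) =
      (idl.span (minor_gens ({1..m} \<times> verts (complete_at G v)) (\<lambda>b d. {b, d} \<in> edges (complete_at G v)) \<union>
        minor_gens ({1..m} \<times> verts (del_vertex G v)) (\<lambda>b d. {b, d} \<in> edges (del_vertex G v))) :: 'k mpoly set)"
proof -
  let ?E = "\<lambda>b d. {b, d} \<in> edges G"
  have "edge_span m (complete_at G v) = (idl.span (minor_gens ({1..m} \<times> verts G)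
      (\<lambda>b d. ?E b d \<or> (?E v b \<and> ?E v d \<and> b \<noteq> d))) :: 'k mpoly set)"
    unfolding edge_span_def edge_complete_at_iff by simp
  moreover have "edge_span m (del_vertex G v) = (idl.span (minor_gens ({1..m} \<times> verts G - UNIV \<times> {v}) ?E) :: 'k mpoly set)"
    unfolding edge_span_def by (rule span_minor_gens_cong) (auto simp: edges_del_vertex assms)
  ultimately show "edge_span m (complete_at G v) \<inter> edge_span m (del_vertex G v) = (edge_span m G :: 'k mpoly set)"
    unfolding edge_span_def[of m G]
    using simple_graph_edgeD(3)[OF assms, of v v]
    by (simp only:) (rule span_minor_gens_delete_vertex, auto simp: insert_commute)
  show "edge_span m (del_vertex (complete_at G v) v) =
      (idl.span (minor_gens ({1..m} \<times> verts (complete_at G v)) (\<lambda>b d. {b, d} \<in> edges (complete_at G v)) \<union>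
        minor_gens ({1..m} \<times> verts (del_vertex G v)) (\<lambda>b d. {b, d} \<in> edges (del_vertex G v))) :: 'k mpoly set)"
    unfolding edge_span_def minor_gens_Un
    by (rule span_minor_gens_cong)
      (auto simp: edges_del_vertex assms simple_complete_at edge_complete_at_iff)
qed

text \<open>Each of the three graphs obtained from a vertex \<open>v\<close> is smaller. For \<open>G\<^sub>v - v\<close> a bound that
  is smaller by one suffices, because the sum of the ideals enters the exact sequence in one
  degree lower.\<close>

theorem vanishes_d_compatible:
  fixes G :: ugraph
  assumes \<Psi>: "d_compatible \<Psi>" and m: "2 \<le> m"
    and G: "G \<in> graph_class" "verts G \<subseteq> {1..n}"
  shows "vanishes m n (edge_span m G :: 'k::field mpoly set) (\<Psi> (complete_graph m) G)"
  using G
proof (induction "graph_size G" arbitrary: G rule: less_induct)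
  case (less G)
  have simple: "simple_graph G" using less.prems(1) by (simp add: graph_class_def)
  show ?case
  proof (cases "\<exists>P. complete_union G P")
    case True
    then obtain P where P: "complete_union G P" by blast
    then have "\<Psi> (complete_graph m) G \<le> card P * (m - 1) + (\<Sum>A\<in>P. card A)"
      using \<Psi> m less.prems(1) unfolding d_compatible_def by blast
    then show ?thesis
      using vanishes_complete_union[OF P simple less.prems(2)] m cohomology_vanishes_below_mono
      by (metis one_le_numeral order_trans)
  next
    case False
    let ?d = "\<Psi> (complete_graph m) G"
    obtain v where v: "v \<in> verts G" "\<not> free_vertex G v"
      "?d \<le> \<Psi> (complete_graph m) (del_vertex G v)"
      "?d \<le> \<Psi> (complete_graph m) (complete_at G v)"
      "?d \<le> \<Psi> (complete_graph m) (del_vertex (complete_at G v) v) + 1"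
      using \<Psi> m less.prems(1) False unfolding d_compatible_def by meson
    obtain u where "{u, v} \<in> edges G" using nonfree_witness[OF v(2)] by metis
    then have "u \<in> verts G - {v}" using simple_graph_edgeD[OF simple] by blast
    then have classes: "del_vertex G v \<in> graph_class" "complete_at G v \<in> graph_class"
      "del_vertex (complete_at G v) v \<in> graph_class"
      using less.prems(1) simple_del_vertex simple_complete_at unfolding graph_class_def by auto
    have sizes: "graph_size (del_vertex G v) < graph_size G" "graph_size (complete_at G v) < graph_size G"
      "graph_size (del_vertex (complete_at G v) v) < graph_size G"
      using graph_size_del_vertex[OF simple v(1)] graph_size_complete_at[OF simple v(2)]
        graph_size_del_vertex[OF simple_complete_at[OF simple], of v v] v(1) by auto
    have subs: "verts (del_vertex G v) \<subseteq> {1..n}" "verts (complete_at G v) \<subseteq> {1..n}"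
      "verts (del_vertex (complete_at G v) v) \<subseteq> {1..n}" using less.prems(2) by auto
    note IH = less.hyps[OF sizes(1) classes(1) subs(1)] less.hyps[OF sizes(2) classes(2) subs(2)]
      less.hyps[OF sizes(3) classes(3) subs(3)]
    have "vanishes m n (edge_span m (complete_at G v) \<inter> edge_span m (del_vertex G v) :: 'k mpoly set) ?d"
      unfolding edge_span_def
    proof (rule vanishes_below_intersection, unfold edge_span_def[symmetric] edge_span_intersection(2)[OF simple, symmetric])
      show "vanishes m n (edge_span m (complete_at G v) :: 'k mpoly set) ?d"
        by (rule cohomology_vanishes_below_mono[OF IH(2) v(4)])
      show "vanishes m n (edge_span m (del_vertex G v) :: 'k mpoly set) ?d"
        by (rule cohomology_vanishes_below_mono[OF IH(1) v(3)])
      show "vanishes m n (edge_span m (del_vertex (complete_at G v) v) :: 'k mpoly set) (?d - 1)"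
        by (rule cohomology_vanishes_below_mono[OF IH(3)]) (use v(5) in linarith)
    qed
    then show ?thesis by (simp only: edge_span_intersection(1)[OF simple])
  qed
qed

section \<open>Depth of the quotient by a generalized binomial edge ideal\<close>

lemma kill_id:
  assumes "\<And>t. t \<in> keys f \<Longrightarrow> keys t \<inter> Z = {}"
  shows "kill Z f = f"
proof (rule poly_mapping_eqI)
  fix t
  show "lookup (kill Z f) t = lookup f t"
    using assms[of t] by (cases "t \<in> keys f") (simp_all add: lookup_kill in_keys_iff)
qed

lemma keys_kill: "t \<in> keys (kill Z f) \<Longrightarrow> keys t \<inter> Z = {}"
  unfolding in_keys_iff[of t] lookup_kill by simp

text \<open>Killing the variables outside \<open>{1..m} \<times> {1..n}\<close> retracts onto the ring with finitely many
  variables, and it preserves the edge ideal since those variables belong to it.\<close>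

lemma quotient_cech_mpoly:
  "quotient_cech (carrier (mpoly_ring m n)) (edge_span m G :: 'k::field mpoly set)
    (kill (- ({1..m} \<times> {1..n}))) (xvars m n)"
  if "verts G \<subseteq> {1..n}"
proof
  let ?Z = "- ({1..m} \<times> {1..n} :: (nat \<times> nat) set)"
  fix f g :: "'k mpoly"
  show "kill ?Z f \<in> carrier (mpoly_ring m n)"
    using keys_kill[of _ ?Z f] by (auto simp: mpoly_ring_def disjoint_eq_subset_Compl)
  show "kill ?Z f = f" if "f \<in> carrier (mpoly_ring m n)"
    using that by (intro kill_id) (auto simp: mpoly_ring_def)
  show "kill ?Z f \<in> edge_span m G" if "f \<in> edge_span m G"
  proof -
    have "f - kill ?Z f \<in> idl.span (pvar ` ?Z)" by (rule diff_kill_in_span)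
    also have "idl.span (pvar ` ?Z) \<subseteq> (edge_span m G :: 'k mpoly set)"
      unfolding edge_span_def minor_gens_def using \<open>verts G \<subseteq> {1..n}\<close> by (intro idl.span_mono) auto
    finally show ?thesis using that idl.span_diff unfolding edge_span_def by fastforce
  qed
  show "set (xvars m n) \<subseteq> carrier (mpoly_ring m n :: 'k mpoly ring)"
    by (auto simp: set_xvars mpoly_ring_def xvar_def)
  show "idl.subspace (edge_span m G :: 'k mpoly set)" by (simp add: edge_span_def)
qed (simp_all add: kill_add kill_mult mpoly_ring_def)

lemma cring_mpoly: "cring (mpoly_ring m n :: 'k::field mpoly ring)"
proof -
  interpret quotient_cech "carrier (mpoly_ring m n)" "edge_span m \<lparr>verts = {}, edges = {}\<rparr> :: 'k mpoly set"
    "kill (- ({1..m} \<times> {1..n}))" "xvars m n"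
    by (rule quotient_cech_mpoly) simp
  have ops: "monoid.mult (mpoly_ring m n :: 'k mpoly ring) = (*)" "ring.add (mpoly_ring m n :: 'k mpoly ring) = (+)"
    "ring.zero (mpoly_ring m n :: 'k mpoly ring) = 0" "one (mpoly_ring m n :: 'k mpoly ring) = 1"
    by (simp_all add: mpoly_ring_def)
  show ?thesis
  proof (rule cringI)
    show "abelian_group (mpoly_ring m n :: 'k mpoly ring)"
    proof (rule abelian_groupI)
      fix f assume "f \<in> carrier (mpoly_ring m n :: 'k mpoly ring)"
      then show "\<exists>g\<in>carrier (mpoly_ring m n). g \<oplus>\<^bsub>mpoly_ring m n\<^esub> f = \<zero>\<^bsub>mpoly_ring m n\<^esub>"
        by (intro bexI[of _ "- f"] S_uminus) (simp_all add: ops)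
    qed (simp_all add: ops S_add S_zero add_ac)
    show "comm_monoid (mpoly_ring m n :: 'k mpoly ring)"
      by (rule comm_monoidI) (simp_all add: ops S_mult one_closed mult_ac)
  qed (simp add: ops distrib_right)
qed

text \<open>Killing the variables outside \<open>{1..m} \<times> {1..n}\<close> sends every generator of the large ideal to
  zero or, up to sign, to a generator of the binomial edge ideal.\<close>

lemma binomial_edge_ideal_eq:
  assumes "simple_graph G" "verts G = {1..n}"
  shows "binomial_edge_ideal m n G = (edge_span m G \<inter> carrier (mpoly_ring m n) :: 'k::field mpoly set)"
proof -
  let ?R = "mpoly_ring m n :: 'k mpoly ring"
  let ?Z = "- ({1..m} \<times> {1..n} :: (nat \<times> nat) set)"
  let ?gens = "{xvar i k * xvar j l - xvar i l * xvar j k | i j k l.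
          1 \<le> i \<and> i < j \<and> j \<le> m \<and> {k, l} \<in> edges G \<and> k < l} :: 'k mpoly set"
  interpret quotient_cech "carrier ?R" "edge_span m G" "kill ?Z" "xvars m n"
    by (rule quotient_cech_mpoly) (simp add: assms)
  interpret cring ?R by (rule cring_mpoly)
  have Rsimps: "monoid.mult ?R = (*)" "ring.add ?R = (+)" "ring.zero ?R = 0"
    by (simp_all add: mpoly_ring_def)
  have var: "xvar a b \<in> carrier ?R" if "a \<in> {1..m}" "b \<in> {1..n}" for a b
    using that by (auto simp: mpoly_ring_def xvar_def)
  have vertex: "b \<in> {1..n}" "d \<in> {1..n}" if "{b, d} \<in> edges G" for b d
    using simple_graph_edgeD[OF assms(1) that] assms(2) by auto
  have gens: "?gens \<subseteq> edge_span m G \<inter> carrier ?R"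
  proof
    fix g assume "g \<in> ?gens"
    then obtain i j k l where g: "g = minor2 i j k l" "1 \<le> i" "i < j" "j \<le> m" "{k, l} \<in> edges G" "k < l"
      unfolding minor2_def by blast
    have "g \<in> edge_span m G"
      unfolding edge_span_def g(1) by (rule idl.span_base, rule minor_in_gens, rule g(5))
    moreover have "g \<in> carrier ?R"
      unfolding g(1) minor2_def using g vertex[OF g(5)] by (intro S_diff S_mult var) auto
    ultimately show "g \<in> edge_span m G \<inter> carrier ?R" by blast
  qed
  show ?thesis
  proof
    have "ideal (edge_span m G \<inter> carrier ?R) ?R"
    proof (rule idealI)
      show "ring ?R" by (rule ring_axioms)
      show "subgroup (edge_span m G \<inter> carrier ?R) (add_monoid ?R)"
      proof (rule add.subgroupI)
        show "edge_span m G \<inter> carrier ?R \<noteq> {}"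
          using idl.subspace_0[OF ideal] S_zero by blast
        fix a assume a: "a \<in> edge_span m G \<inter> carrier ?R"
        then have "\<ominus>\<^bsub>?R\<^esub> a = - a"
          by (intro minus_equality) (auto simp: Rsimps S_uminus)
        then show "\<ominus>\<^bsub>?R\<^esub> a \<in> edge_span m G \<inter> carrier ?R"
          using a by (auto simp: S_uminus idl.subspace_neg[OF ideal])
        fix b assume "b \<in> edge_span m G \<inter> carrier ?R"
        then show "a \<oplus>\<^bsub>?R\<^esub> b \<in> edge_span m G \<inter> carrier ?R"
          using a by (auto simp: Rsimps S_add idl.subspace_add[OF ideal])
      qed simp
    next
      fix a b assume "a \<in> edge_span m G \<inter> carrier ?R" "b \<in> carrier ?R"
      then show "b \<otimes>\<^bsub>?R\<^esub> a \<in> edge_span m G \<inter> carrier ?R" "a \<otimes>\<^bsub>?R\<^esub> b \<in> edge_span m G \<inter> carrier ?R"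
        using idl.subspace_scale[OF ideal, of a b] by (auto simp: Rsimps S_mult mult.commute)
    qed
    then show "binomial_edge_ideal m n G \<subseteq> edge_span m G \<inter> carrier ?R"
      unfolding binomial_edge_ideal_def using gens by (rule genideal_minimal)
  next
    have "ideal (Idl\<^bsub>?R\<^esub> ?gens) ?R"
      using gens by (intro genideal_ideal) auto
    then interpret J: ideal "Idl\<^bsub>?R\<^esub> ?gens" ?R .
    define K where "K = Idl\<^bsub>?R\<^esub> ?gens"
    have K_gens: "?gens \<subseteq> K" unfolding K_def using gens by (intro genideal_self) blast
    have K_zero: "0 \<in> K" using J.zero_closed by (simp add: K_def Rsimps)
    have K_add: "f + g \<in> K" if "f \<in> K" "g \<in> K" for f g
      using J.a_closed that by (simp add: K_def Rsimps)
    have K_mult: "h * f \<in> K" if "f \<in> K" "h \<in> carrier ?R" for f h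
      using J.I_l_closed that by (simp add: K_def Rsimps)
    have K_neg: "- f \<in> K" if "f \<in> K" for f
      using K_mult[OF that, of "- 1"] by (simp add: mpoly_ring_def)
    have base: "minor2 a c b d \<in> K"
      if "a \<in> {1..m}" "c \<in> {1..m}" "{b, d} \<in> edges G" "a < c" "b < d" for a c b d
    proof -
      have "minor2 a c b d \<in> ?gens"
        unfolding minor2_def
        using that by (intro CollectI exI[of _ a] exI[of _ c] exI[of _ b] exI[of _ d]) simp
      then show ?thesis using K_gens by blast
    qed
    have minor: "minor2 a c b d \<in> K"
      if ac: "a \<in> {1..m}" "c \<in> {1..m}" and bd: "{b, d} \<in> edges G" for a c b d
    proof -
      have db: "{d, b} \<in> edges G" using bd by (simp add: insert_commute)
      have "b \<noteq> d" using simple_graph_edgeD(3)[OF assms(1) bd] .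
      then consider "a = c" | "a < c" "b < d" | "a < c" "d < b" | "c < a" "b < d" | "c < a" "d < b"
        by linarith
      then show ?thesis
      proof cases
        case 1
        then have "minor2 a c b d = (0 :: 'k mpoly)" by (simp add: minor2_def mult.commute)
        then show ?thesis using K_zero by simp
      next
        case 2
        then show ?thesis by (rule base[OF ac bd])
      next
        case 3
        from K_neg[OF base[OF ac db this]] show ?thesis unfolding minor2_def by (simp add: algebra_simps)
      next
        case 4
        from K_neg[OF base[OF ac(2,1) bd this]] show ?thesis unfolding minor2_def by (simp add: algebra_simps)
      next
        case 5
        from base[OF ac(2,1) db this] show ?thesis unfolding minor2_def by (simp add: algebra_simps)
      qed
    qed
    have "kill ?Z f \<in> K" if "f \<in> edge_span m G" for f
      using that unfolding edge_span_def
    proof (induction f rule: idl.span_induct_alt)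
      case base
      then show ?case using K_zero by simp
    next
      case (step h g f)
      have "kill ?Z g \<in> K"
        using step(1)
      proof (cases rule: minor_gens_cases)
        case (1 a c b d)
        show ?thesis
        proof (cases "a \<in> {1..m} \<and> c \<in> {1..m}")
          case True
          then have "kill ?Z g = g"
            unfolding 1(1) using vertex[OF 1(2)] by (simp add: minor2_def kill_diff kill_mult)
          then show ?thesis using minor True 1 by simp
        next
          case False
          then have "kill ?Z g = 0" unfolding 1(1) by (auto simp: minor2_def kill_diff kill_mult)
          then show ?thesis using K_zero by simp
        qed
      next
        case (2 a b)
        then have "kill ?Z g = 0" using assms(2) by auto
        then show ?thesis using K_zero by simp
      qed
      then have "kill ?Z h * kill ?Z g \<in> K"
        by (rule K_mult) (rule retract_closed)
      then show ?case
        using K_add[OF _ step(2)] by (simp only: kill_add kill_mult)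
    qed
    then show "edge_span m G \<inter> carrier ?R \<subseteq> binomial_edge_ideal m n G"
      unfolding binomial_edge_ideal_def K_def[symmetric] using retract_id by fastforce
  qed
qed

theorem depth_edge_quotient_ge:
  assumes "d_compatible \<Psi>" "2 \<le> m" "1 \<le> n" "simple_graph G" "verts G = {1..n}"
  shows "enat (\<Psi> (complete_graph m) G)
    \<le> depth (mpoly_ring m n :: 'k::field mpoly ring) (xvars m n) (edge_quotient m n G)"
proof -
  let ?R = "mpoly_ring m n :: 'k mpoly ring"
  interpret quotient_cech "carrier ?R" "edge_span m G" "kill (- ({1..m} \<times> {1..n}))" "xvars m n"
    by (rule quotient_cech_mpoly) (simp add: assms(5))
  have R: "R = ?R" unfolding R_def by (simp add: mpoly_ring_def)
  have M: "M = edge_quotient m n G"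
    unfolding M_def R edge_quotient_def binomial_edge_ideal_eq[OF assms(4,5)] ..
  have "G \<in> graph_class" using assms by (auto simp: graph_class_def)
  then have "vanishes m n (edge_span m G :: 'k mpoly set) (\<Psi> (complete_graph m) G)"
    using assms by (intro vanishes_d_compatible) auto
  from depth_lower_bound[OF this] show ?thesis unfolding R M .
qed

section \<open>Distances in graphs\<close>

abbreviation adj :: "ugraph \<Rightarrow> (nat \<times> nat) set" where
  "adj G \<equiv> {(a, b). {a, b} \<in> edges G}"

abbreviation linked :: "ugraph \<Rightarrow> nat \<Rightarrow> nat \<Rightarrow> bool" where
  "linked G u v \<equiv> (u, v) \<in> (adj G)\<^sup>*"

text \<open>The distance through powers of the adjacency relation instead of simple paths, so that walks
  can be joined freely.\<close>

definition gdist :: "ugraph \<Rightarrow> nat \<Rightarrow> nat \<Rightarrow> nat" where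
  "gdist G u v = (LEAST k. (u, v) \<in> adj G ^^ k)"

lemma relpow_adj_sym: "(u, v) \<in> adj G ^^ k \<Longrightarrow> (v, u) \<in> adj G ^^ k"
proof (induction k arbitrary: v)
  case (Suc k)
  then obtain w where "(u, w) \<in> adj G ^^ k" "(w, v) \<in> adj G" by auto
  then have "(v, w) \<in> adj G" "(w, u) \<in> adj G ^^ k" using Suc by (auto simp: insert_commute)
  then show ?case by (rule relpow_Suc_I2)
qed simp

lemma linked_sym: "linked G u v \<Longrightarrow> linked G v u"
  unfolding rtrancl_power using relpow_adj_sym by blast

lemma relpow_subset: "R \<subseteq> S \<Longrightarrow> R ^^ k \<subseteq> S ^^ k" for R S :: "('a \<times> 'a) set"
  by (induction k) (simp_all add: relcomp_mono)

lemma linked_in_verts: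
  assumes "simple_graph G" "linked G u v" "u \<in> verts G" shows "v \<in> verts G"
  using assms(2) by (induction rule: rtrancl_induct) (use assms simple_graph_edgeD in auto)

lemma gdist_le: "(u, v) \<in> adj G ^^ k \<Longrightarrow> gdist G u v \<le> k"
  unfolding gdist_def by (rule Least_le)

lemma gdist_relpow: "linked G u v \<Longrightarrow> (u, v) \<in> adj G ^^ gdist G u v"
  unfolding gdist_def rtrancl_power by (erule exE) (rule LeastI)

lemma gdist_self [simp]: "gdist G u u = 0"
  using gdist_le[where u = u and v = u and k = 0] by simp

lemma gdist_sym: "gdist G u v = gdist G v u"
proof -
  have "(u, v) \<in> adj G ^^ k \<longleftrightarrow> (v, u) \<in> adj G ^^ k" for k
    by (rule iffI; rule relpow_adj_sym)
  then show ?thesis unfolding gdist_def by (simp only:)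
qed

lemma gdist_eq_0: "linked G u v \<Longrightarrow> gdist G u v = 0 \<Longrightarrow> u = v"
  using gdist_relpow[of u v G] by simp

lemma gdist_eq_1: "linked G u v \<Longrightarrow> gdist G u v = 1 \<Longrightarrow> {u, v} \<in> edges G"
  using gdist_relpow[of u v G] by simp

lemma gdist_triangle: "linked G u v \<Longrightarrow> linked G v w \<Longrightarrow> gdist G u w \<le> gdist G u v + gdist G v w"
  by (rule gdist_le, unfold relpow_add, rule relcompI; rule gdist_relpow)

lemma gdist_adj_le: "linked G u v \<Longrightarrow> {v, w} \<in> edges G \<Longrightarrow> gdist G u w \<le> Suc (gdist G u v)"
  by (rule gdist_le, rule relpow_Suc_I, erule gdist_relpow) simp

lemma gdist_mono:
  assumes "adj H \<subseteq> adj G" "linked H u v" shows "gdist G u v \<le> gdist H u v"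
  using gdist_relpow[OF assms(2)] relpow_subset[OF assms(1)] by (intro gdist_le) blast

text \<open>A function that grows by at most one along edges bounds distances from below. This is how
  distances in a graph with added edges are controlled.\<close>

lemma gdist_potential:
  assumes "linked G u v" "\<And>a b. {a, b} \<in> edges G \<Longrightarrow> g b \<le> Suc (g a)"
  shows "g v \<le> g u + gdist G u v"
proof -
  have "g w \<le> g u + k" if "(u, w) \<in> adj G ^^ k" for w k
    using that
  proof (induction k arbitrary: w)
    case (Suc k)
    then obtain z where "(u, z) \<in> adj G ^^ k" "{z, w} \<in> edges G" by auto
    then show ?case using Suc.IH[of z] assms(2)[of z w] by simp
  qed simp
  then show ?thesis using gdist_relpow[OF assms(1)] by blast
qed

lemma relpow_segment:
  assumes "\<And>i. i < k \<Longrightarrow> (f i, f (Suc i)) \<in> R" "i \<le> j" "j \<le> k"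
  shows "(f i, f j) \<in> R ^^ (j - i)"
  using assms(2,3)
proof (induction j)
  case (Suc j)
  show ?case
  proof (cases "i = Suc j")
    case False
    then have "(f i, f j) \<in> R ^^ (j - i)" "(f j, f (Suc j)) \<in> R" using Suc assms(1) by auto
    moreover have "Suc j - i = Suc (j - i)" using False Suc by simp
    ultimately show ?thesis by auto
  qed simp
qed simp

lemma path_relpow: "is_path G p u v \<Longrightarrow> (u, v) \<in> adj G ^^ (length p - 1)"
proof (induction p arbitrary: u)
  case (Cons a p)
  show ?case
  proof (cases p)
    case Nil
    then show ?thesis using Cons.prems by (simp add: is_path_def)
  next
    case (Cons b q)
    then have "is_path G p b v" "a = u" "{a, b} \<in> edges G"
      using Cons.prems by (auto simp: is_path_def)
    then have "(u, b) \<in> adj G" "(b, v) \<in> adj G ^^ (length p - 1)" using Cons.IH by auto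
    then have "(u, v) \<in> adj G ^^ Suc (length p - 1)" by (rule relpow_Suc_I2)
    then show ?thesis using Cons by simp
  qed
qed (simp add: is_path_def)

lemma shortest_path_exists:
  assumes G: "simple_graph G" and u: "u \<in> verts G" and uv: "linked G u v"
  shows "\<exists>p. is_path G p u v \<and> length p = Suc (gdist G u v)"
proof -
  let ?k = "gdist G u v"
  obtain f where f: "f 0 = u" "f ?k = v" "\<And>i. i < ?k \<Longrightarrow> (f i, f (Suc i)) \<in> adj G"
    using gdist_relpow[OF uv] unfolding relpow_fun_conv by blast
  note seg = relpow_segment[of ?k f "adj G", OF f(3)]
  have "f i \<noteq> f j" if "i < j" "j \<le> ?k" for i j
  proof
    assume eq: "f i = f j"
    have "(u, f i) \<in> adj G ^^ i" "(f j, v) \<in> adj G ^^ (?k - j)"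
      using seg[of 0 i] seg[of j ?k] that f(1,2) by auto
    then have "(u, v) \<in> adj G ^^ (i + (?k - j))" unfolding relpow_add using eq by auto
    from gdist_le[OF this] show False using that by linarith
  qed
  then have inj: "inj_on f {0..<Suc ?k}"
    by (intro linorder_inj_onI) auto
  have "linked G u (f i)" if "i \<le> ?k" for i
    using seg[of 0 i] that f(1) relpow_imp_rtrancl by fastforce
  then have "f i \<in> verts G" if "i \<le> ?k" for i using linked_in_verts[OF G _ u] that by blast
  then have "is_path G (map f [0..<Suc ?k]) u v"
    using f inj unfolding is_path_def
    by (auto simp: distinct_map successively_conv_nth hd_map last_map less_Suc_eq_le simp del: upt_Suc)
  then show ?thesis by (intro exI[of _ "map f [0..<Suc ?k]"]) simp
qed

lemma distance_eq_gdist: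
  assumes "simple_graph G" "u \<in> verts G" "linked G u v"
  shows "distance G u v = gdist G u v"
  unfolding distance_def
proof (rule Least_equality)
  show "\<exists>p. is_path G p u v \<and> length p = Suc (gdist G u v)" by (rule shortest_path_exists[OF assms])
  show "gdist G u v \<le> k" if "\<exists>p. is_path G p u v \<and> length p = Suc k" for k
    using that path_relpow gdist_le by fastforce
qed

lemma reachable_iff_linked:
  assumes "simple_graph G" "u \<in> verts G"
  shows "(\<exists>p. is_path G p u v) \<longleftrightarrow> linked G u v"
proof
  assume "\<exists>p. is_path G p u v"
  then obtain p where "is_path G p u v" ..
  from path_relpow[OF this] show "linked G u v" by (rule relpow_imp_rtrancl)
next
  assume "linked G u v"
  from shortest_path_exists[OF assms this] show "\<exists>p. is_path G p u v" by blast
qed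

abbreviation comp_set :: "ugraph \<Rightarrow> nat \<Rightarrow> nat set" where
  "comp_set G u \<equiv> {w. linked G u w}"

lemma components_eq:
  assumes "simple_graph G"
  shows "components G = (\<lambda>u. induced_graph G (comp_set G u)) ` verts G"
proof -
  have "components G = (\<lambda>u. induced_graph G {w. \<exists>p. is_path G p u w}) ` verts G"
    by (auto simp: components_def)
  also have "\<dots> = (\<lambda>u. induced_graph G (comp_set G u)) ` verts G"
    by (rule image_cong) (simp_all add: reachable_iff_linked[OF assms])
  finally show ?thesis .
qed

lemma verts_induced [simp]: "verts (induced_graph G A) = verts G \<inter> A"
  by (simp add: induced_graph_def)

lemma edges_induced [simp]: "edges (induced_graph G A) = {e \<in> edges G. e \<subseteq> A}"
  by (simp add: induced_graph_def)

lemma simple_induced: "simple_graph G \<Longrightarrow> simple_graph (induced_graph G A)"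
  by (auto simp: simple_graph_def)

lemma free_vertex_iff:
  assumes "simple_graph G"
  shows "free_vertex G v \<longleftrightarrow>
    (\<forall>u w. {u, v} \<in> edges G \<longrightarrow> {w, v} \<in> edges G \<longrightarrow> u \<noteq> w \<longrightarrow> {u, w} \<in> edges G)"
  using simple_graph_edgeD(1)[OF assms]
  unfolding free_vertex_def is_complete_def verts_induced edges_induced nbhd_def by blast

section \<open>Disjoint unions of graphs\<close>

text \<open>\<open>G\<close> is the disjoint union of its induced subgraphs on \<open>A\<close> and \<open>B\<close>.\<close>

definition splits :: "ugraph \<Rightarrow> nat set \<Rightarrow> nat set \<Rightarrow> bool" where
  "splits G A B \<longleftrightarrow> simple_graph G \<and> verts G = A \<union> B \<and> A \<inter> B = {} \<and> (\<forall>e\<in>edges G. e \<subseteq> A \<or> e \<subseteq> B)"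

lemma splits_sym: "splits G A B \<Longrightarrow> splits G B A"
  by (auto simp: splits_def)

lemma splits_edge_in:
  assumes "splits G A B" "a \<in> A" "{a, b} \<in> edges G" shows "b \<in> A"
proof -
  have all: "\<forall>e\<in>edges G. e \<subseteq> A \<or> e \<subseteq> B" "A \<inter> B = {}"
    using assms(1) by (simp_all add: splits_def)
  show ?thesis using bspec[OF all(1) assms(3)] all(2) assms(2) by auto
qed

lemma splits_edge_iff:
  assumes "splits G A B" "a \<in> A"
  shows "{a, b} \<in> edges (induced_graph G A) \<longleftrightarrow> {a, b} \<in> edges G"
    "{b, a} \<in> edges (induced_graph G A) \<longleftrightarrow> {b, a} \<in> edges G"
  using assms(2) splits_edge_in[OF assms, of b] by (auto simp: insert_commute)

lemma splits_relpow:
  assumes "splits G A B" "u \<in> A"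
  shows "(u, v) \<in> adj (induced_graph G A) ^^ k \<longleftrightarrow> (u, v) \<in> adj G ^^ k"
    and "(u, v) \<in> adj G ^^ k \<Longrightarrow> v \<in> A"
proof -
  have "((u, v) \<in> adj (induced_graph G A) ^^ k \<longleftrightarrow> (u, v) \<in> adj G ^^ k) \<and> ((u, v) \<in> adj G ^^ k \<longrightarrow> v \<in> A)"
  proof (induction k arbitrary: v)
    case (Suc k)
    have iff: "(u, z) \<in> adj (induced_graph G A) ^^ k \<and> (z, v) \<in> adj (induced_graph G A) \<longleftrightarrow>
        (u, z) \<in> adj G ^^ k \<and> (z, v) \<in> adj G" for z
      using Suc[of z] splits_edge_iff(1)[OF assms(1), of z v] by auto
    have "(u, z) \<in> adj G ^^ k \<and> (z, v) \<in> adj G \<Longrightarrow> v \<in> A" for z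
      using Suc[of z] splits_edge_in[OF assms(1), of z v] by auto
    then show ?case using iff by (auto simp: relcomp_unfold)
  qed (use assms in auto)
  then show "(u, v) \<in> adj (induced_graph G A) ^^ k \<longleftrightarrow> (u, v) \<in> adj G ^^ k"
    "(u, v) \<in> adj G ^^ k \<Longrightarrow> v \<in> A" by auto
qed

lemma splits_linked:
  assumes "splits G A B" "u \<in> A"
  shows "linked (induced_graph G A) u v \<longleftrightarrow> linked G u v" "linked G u v \<Longrightarrow> v \<in> A"
    "gdist (induced_graph G A) u v = gdist G u v"
  using splits_relpow[OF assms] unfolding rtrancl_power gdist_def by auto

lemma splits_components:
  assumes "splits G A B"
  shows "components G = components (induced_graph G A) \<union> components (induced_graph G B)"
    and "components (induced_graph G A) \<inter> components (induced_graph G B) = {}"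
proof -
  have G: "simple_graph G" and V: "verts G = A \<union> B" using assms by (auto simp: splits_def)
  have part: "components (induced_graph G A) = (\<lambda>u. induced_graph G (comp_set G u)) ` A"
    if "splits G A B" for A B
  proof -
    have "induced_graph (induced_graph G A) (comp_set (induced_graph G A) u) = induced_graph G (comp_set G u)"
      if "u \<in> A" for u
    proof -
      have "comp_set (induced_graph G A) u = comp_set G u" "comp_set G u \<subseteq> A"
        using splits_linked[OF \<open>splits G A B\<close> that] by auto
      then show ?thesis by (auto simp: induced_graph_def)
    qed
    moreover have "verts (induced_graph G A) = A" using that by (auto simp: splits_def)
    ultimately show ?thesis using components_eq[OF simple_induced[OF G]] by (auto intro!: image_cong)
  qed
  show "components G = components (induced_graph G A) \<union> components (induced_graph G B)"
    unfolding part[OF assms] part[OF splits_sym[OF assms]] components_eq[OF G] V by blast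
  have "verts H \<noteq> {} \<and> verts H \<subseteq> A"
    if split: "splits G A B" and H: "H \<in> components (induced_graph G A)" for A B H
  proof -
    obtain u where u: "u \<in> A" "H = induced_graph G (comp_set G u)"
      using H unfolding part[OF split] by blast
    then have "u \<in> verts H" using split by (auto simp: splits_def)
    moreover have "verts H \<subseteq> A" using u splits_linked(2)[OF split] by auto
    ultimately show ?thesis by blast
  qed
  note this[OF assms] this[OF splits_sym[OF assms]]
  moreover have "A \<inter> B = {}" using assms by (simp add: splits_def)
  ultimately show "components (induced_graph G A) \<inter> components (induced_graph G B) = {}" by blast
qed

lemma finite_components: "simple_graph G \<Longrightarrow> finite (components G)"
  by (simp add: components_eq simple_graph_def)

lemma splits_additive:
  assumes "splits G A B"
  shows "num_components G = num_components (induced_graph G A) + num_components (induced_graph G B)"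
    and "num_free G = num_free (induced_graph G A) + num_free (induced_graph G B)"
    and "diam_sum G = diam_sum (induced_graph G A) + diam_sum (induced_graph G B)"
proof -
  have G: "simple_graph G" and V: "verts G = A \<union> B" "A \<inter> B = {}" using assms by (auto simp: splits_def)
  have fin: "finite A" "finite B" using G V(1) by (auto simp: simple_graph_def)
  have finc: "finite (components (induced_graph G A))" "finite (components (induced_graph G B))"
    using finite_components[OF simple_induced[OF G]] by auto
  note comps = splits_components[OF assms]
  show "num_components G = num_components (induced_graph G A) + num_components (induced_graph G B)"
    unfolding num_components_def comps(1) by (rule card_Un_disjoint[OF finc comps(2)])
  have count: "card {v \<in> verts G. P G v} = card {v \<in> verts (induced_graph G A). P (induced_graph G A) v}
      + card {v \<in> verts (induced_graph G B). P (induced_graph G B) v}"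
    if "\<And>A B v. splits G A B \<Longrightarrow> v \<in> A \<Longrightarrow> P (induced_graph G A) v \<longleftrightarrow> P G v" for P
  proof -
    have "{v \<in> verts G. P G v} = {v \<in> verts (induced_graph G A). P (induced_graph G A) v}
      \<union> {v \<in> verts (induced_graph G B). P (induced_graph G B) v}"
      using that[OF assms] that[OF splits_sym[OF assms]] V by auto
    then show ?thesis using fin V by (simp add: card_Un_disjoint disjoint_iff)
  qed
  have free: "free_vertex (induced_graph G A) v \<longleftrightarrow> free_vertex G v" if "splits G A B" "v \<in> A" for A B v
  proof -
    have e1: "{u, v} \<in> edges (induced_graph G A) \<longleftrightarrow> {u, v} \<in> edges G" for u
      by (rule splits_edge_iff(2)[OF that])
    have e2: "{u, w} \<in> edges (induced_graph G A) \<longleftrightarrow> {u, w} \<in> edges G" if "{u, v} \<in> edges G" for u w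
      by (rule splits_edge_iff(1)[OF \<open>splits G A B\<close> splits_edge_in[OF \<open>splits G A B\<close> \<open>v \<in> A\<close>]])
        (use that in \<open>simp add: insert_commute\<close>)
    show ?thesis
      unfolding free_vertex_iff[OF G] free_vertex_iff[OF simple_induced[OF G]] e1 using e2 by blast
  qed
  show "num_free G = num_free (induced_graph G A) + num_free (induced_graph G B)"
    unfolding num_free_def by (rule count) (rule free)
  have "nbhd (induced_graph G A) v = {} \<longleftrightarrow> nbhd G v = {}" if "splits G A B" "v \<in> A" for A B v
    unfolding nbhd_def using splits_edge_iff[OF that] by simp
  then have iso: "num_isolated G = num_isolated (induced_graph G A) + num_isolated (induced_graph G B)"
    unfolding num_isolated_def by (rule count)
  show "diam_sum G = diam_sum (induced_graph G A) + diam_sum (induced_graph G B)"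
    unfolding diam_sum_def comps(1) iso by (simp add: sum.union_disjoint[OF finc comps(2)])
qed

lemma splits_component:
  assumes "simple_graph G" "u \<in> verts G"
  shows "splits G (comp_set G u) (verts G - comp_set G u)"
proof -
  have "e \<subseteq> comp_set G u \<or> e \<subseteq> verts G - comp_set G u" if e: "e \<in> edges G" for e
  proof -
    obtain a b where ab: "e = {a, b}" using e assms(1) by (auto simp: simple_graph_def card_2_iff)
    have "linked G u a \<longleftrightarrow> linked G u b"
      using e ab by (auto intro: rtrancl_into_rtrancl simp: insert_commute)
    then show ?thesis using e ab simple_graph_edgeD[OF assms(1)] by auto
  qed
  then show ?thesis using assms linked_in_verts[OF assms(1) _ assms(2)] by (auto simp: splits_def)
qed

section \<open>Lower bounds for the sum of the diameters\<close>

lemma finite_distances: "simple_graph G \<Longrightarrow> finite {distance G u v | u v. u \<in> verts G \<and> v \<in> verts G}"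
  using finite_imageI[of "verts G \<times> verts G" "\<lambda>(u, v). distance G u v"]
  by (rule rev_finite_subset) (auto simp: simple_graph_def)

lemma gdist_le_diam_sum:
  assumes G: "simple_graph G" and x: "x \<in> verts G" and xy: "linked G x y"
  shows "gdist G x y \<le> (\<Sum>H\<in>components G. diam H)"
proof -
  let ?H = "induced_graph G (comp_set G x)"
  have split: "splits G (comp_set G x) (verts G - comp_set G x)" by (rule splits_component[OF G x])
  have H: "simple_graph ?H" by (rule simple_induced[OF G])
  have mem: "x \<in> verts ?H" "y \<in> verts ?H" using x xy linked_in_verts[OF G xy x] by auto
  have "gdist G x y = distance ?H x y"
    using distance_eq_gdist[OF H mem(1), of y] splits_linked[OF split, of x y] xy by simp
  also have "\<dots> \<le> diam ?H"
    unfolding diam_def by (rule Max_ge[OF finite_distances[OF H]]) (use mem in blast)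
  also have "\<dots> \<le> (\<Sum>H\<in>components G. diam H)"
    using finite_components[OF G] x by (intro member_le_sum) (auto simp: components_eq[OF G])
  finally show ?thesis .
qed

text \<open>The maximum with 1 accounts for isolated vertices: these have diameter 0 but are counted
  once more.\<close>

lemma diam_sum_ge:
  assumes G: "simple_graph G" and x: "x \<in> verts G" and xy: "linked G x y"
  shows "max 1 (gdist G x y) \<le> diam_sum G"
proof -
  have "1 \<le> diam_sum G"
  proof (cases "nbhd G x = {}")
    case True
    then have "x \<in> {v \<in> verts G. nbhd G v = {}}" using x by simp
    moreover have "finite {v \<in> verts G. nbhd G v = {}}" using G by (simp add: simple_graph_def)
    ultimately have "1 \<le> num_isolated G" unfolding num_isolated_def by (metis One_nat_def Suc_leI card_gt_0_iff empty_iff)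
    then show ?thesis by (simp add: diam_sum_def)
  next
    case False
    then obtain w where w: "{x, w} \<in> edges G" by (auto simp: nbhd_def insert_commute)
    then have "linked G x w" "x \<noteq> w" using simple_graph_edgeD[OF G w] by auto
    then have "1 \<le> gdist G x w" using gdist_eq_0[of x w G] by (cases "gdist G x w") auto
    then show ?thesis using gdist_le_diam_sum[OF G x \<open>linked G x w\<close>] by (simp add: diam_sum_def)
  qed
  then show ?thesis using gdist_le_diam_sum[OF assms] by (simp add: diam_sum_def)
qed

lemma diam_sum_ge_two:
  assumes G: "simple_graph G" and x: "x \<in> verts G" "linked G x a" and y: "y \<in> verts G" "linked G y b"
    and sep: "\<not> linked G x y"
  shows "max 1 (gdist G x a) + max 1 (gdist G y b) \<le> diam_sum G"
proof -
  let ?C = "comp_set G x" and ?D = "verts G - comp_set G x"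
  have split: "splits G ?C ?D" by (rule splits_component[OF G x(1)])
  have xC: "x \<in> ?C" and yD: "y \<in> ?D" using y sep by auto
  note L = splits_linked[OF split xC, of a] and R = splits_linked[OF splits_sym[OF split] yD, of b]
  have "max 1 (gdist (induced_graph G ?C) x a) \<le> diam_sum (induced_graph G ?C)"
    by (rule diam_sum_ge[OF simple_induced[OF G]]) (use x L in auto)
  moreover have "max 1 (gdist (induced_graph G ?D) y b) \<le> diam_sum (induced_graph G ?D)"
    by (rule diam_sum_ge[OF simple_induced[OF G]]) (use y yD R in auto)
  ultimately show ?thesis unfolding splits_additive(3)[OF split] L(3) R(3) by linarith
qed

lemma num_components_pos: "simple_graph G \<Longrightarrow> verts G \<noteq> {} \<Longrightarrow> 1 \<le> num_components G"
  unfolding num_components_def using finite_components[of G] components_eq[of G]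
  by (simp add: Suc_le_eq card_gt_0_iff)

definition connected_graph :: "ugraph \<Rightarrow> bool" where
  "connected_graph G \<longleftrightarrow> simple_graph G \<and> verts G \<noteq> {} \<and> (\<forall>u\<in>verts G. \<forall>v\<in>verts G. linked G u v)"

lemma connected_components:
  assumes "connected_graph G" shows "components G = {G}"
proof -
  have G: "simple_graph G" using assms by (simp add: connected_graph_def)
  have "induced_graph G (comp_set G u) = G" if u: "u \<in> verts G" for u
  proof -
    have "linked G u w \<longleftrightarrow> w \<in> verts G" for w
      using linked_in_verts[OF G _ u] assms u unfolding connected_graph_def by blast
    then have comp: "comp_set G u = verts G" by blast
    have "{e \<in> edges G. e \<subseteq> verts G} = edges G" using G unfolding simple_graph_def by blast
    then show ?thesis unfolding comp by (simp add: induced_graph_def)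
  qed
  moreover have "verts G \<noteq> {}" using assms by (simp add: connected_graph_def)
  ultimately show ?thesis unfolding components_eq[OF G] by auto
qed

lemma diam_attained:
  assumes "connected_graph G"
  obtains x y where "x \<in> verts G" "y \<in> verts G" "gdist G x y = diam G"
    and "\<And>u v. u \<in> verts G \<Longrightarrow> v \<in> verts G \<Longrightarrow> gdist G u v \<le> diam G"
proof -
  have G: "simple_graph G" and ne: "verts G \<noteq> {}" and link: "\<And>u v. u \<in> verts G \<Longrightarrow> v \<in> verts G \<Longrightarrow> linked G u v"
    using assms by (auto simp: connected_graph_def)
  let ?S = "{distance G u v | u v. u \<in> verts G \<and> v \<in> verts G}"
  have "?S \<noteq> {}" using ne by blast
  then have "diam G \<in> ?S" unfolding diam_def by (rule Max_in[OF finite_distances[OF G]])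
  then obtain x y where xy: "x \<in> verts G" "y \<in> verts G" "distance G x y = diam G" by auto
  have "gdist G x y = diam G" using distance_eq_gdist[OF G xy(1) link[OF xy(1,2)]] xy(3) by simp
  moreover have "gdist G u v \<le> diam G" if "u \<in> verts G" "v \<in> verts G" for u v
    unfolding diam_def distance_eq_gdist[OF G that(1) link[OF that], symmetric]
    by (rule Max_ge[OF finite_distances[OF G]]) (use that in blast)
  ultimately show ?thesis by (rule that[OF xy(1,2)])
qed

section \<open>Deleting and completing at a vertex\<close>

definition graph_bound :: "nat \<Rightarrow> ugraph \<Rightarrow> nat" where
  "graph_bound c G = c * num_components G + num_free G + diam_sum G"

lemma graph_bound_splits:
  assumes "splits G A B"
  shows "graph_bound c G = graph_bound c (induced_graph G A) + graph_bound c (induced_graph G B)"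
  unfolding graph_bound_def splits_additive[OF assms] by (simp add: algebra_simps)

lemma graph_bound_ge:
  assumes "simple_graph G" "verts G \<noteq> {}"
  shows "c + num_free G + diam_sum G \<le> graph_bound c G"
  using num_components_pos[OF assms] by (simp add: graph_bound_def Suc_le_eq)

lemma linked_trans: "linked G u v \<Longrightarrow> linked G v w \<Longrightarrow> linked G u w"
  by (rule rtrancl_trans)

lemma adj_del_vertex: "adj (del_vertex G v) \<subseteq> adj G"
  by (auto simp: del_vertex_def)

lemma free_vertex_del:
  assumes "simple_graph G" "free_vertex G u"
  shows "free_vertex (del_vertex G v) u"
  using assms(2) unfolding free_vertex_iff[OF assms(1)] free_vertex_iff[OF simple_del_vertex[OF assms(1)]]
    edges_del_vertex[OF assms(1)] by blast

lemma free_vertex_complete_at_self: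
  assumes "simple_graph G" shows "free_vertex (complete_at G v) v"
  unfolding free_vertex_iff[OF simple_complete_at[OF assms]] edge_complete_at_iff
  using simple_graph_edgeD(3)[OF assms, of v v] by (auto simp: insert_commute)

lemma free_vertex_complete_at:
  assumes G: "simple_graph G" and free: "free_vertex G u"
  shows "free_vertex (complete_at G v) u"
  unfolding free_vertex_iff[OF simple_complete_at[OF G]]
proof (intro allI impI)
  have F: "{a, b} \<in> edges G" if "{u, a} \<in> edges G" "{u, b} \<in> edges G" "a \<noteq> b" for a b
    using free that unfolding free_vertex_iff[OF G] by (simp add: insert_commute)
  fix a b assume a: "{a, u} \<in> edges (complete_at G v)" and b: "{b, u} \<in> edges (complete_at G v)" and "a \<noteq> b"
  have old: "{v, a} \<in> edges G \<or> a = v" if "{v, u} \<in> edges G" "{a, u} \<in> edges G" for a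
    using F[of v a] that by (auto simp: insert_commute)
  show "{a, b} \<in> edges (complete_at G v)"
  proof (cases "{v, u} \<in> edges G")
    case True
    have "{v, a} \<in> edges G \<or> a = v" "{v, b} \<in> edges G \<or> b = v"
      using a b old[OF True] unfolding edge_complete_at_iff by blast+
    then show ?thesis using \<open>a \<noteq> b\<close> unfolding edge_complete_at_iff by (auto simp: insert_commute)
  next
    case False
    then have "{u, a} \<in> edges G" "{u, b} \<in> edges G"
      using a b unfolding edge_complete_at_iff by (auto simp: insert_commute)
    then show ?thesis using F \<open>a \<noteq> b\<close> unfolding edge_complete_at_iff by blast
  qed
qed

lemma num_free_mono:
  assumes "simple_graph H" "\<And>u. u \<in> verts G \<Longrightarrow> free_vertex G u \<Longrightarrow> u \<in> verts H \<and> free_vertex H u"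
  shows "num_free G \<le> num_free H"
  unfolding num_free_def using assms by (intro card_mono) (auto simp: simple_graph_def)

lemma num_free_less:
  assumes "simple_graph H" "\<And>u. u \<in> verts G \<Longrightarrow> free_vertex G u \<Longrightarrow> u \<in> verts H \<and> free_vertex H u"
    and "p \<in> verts H" "free_vertex H p" "\<not> free_vertex G p"
  shows "num_free G < num_free H"
  unfolding num_free_def using assms by (intro psubset_card_mono) (auto simp: simple_graph_def)

text \<open>A shortest walk between vertices that \<open>v\<close> separates passes through \<open>v\<close>.\<close>

lemma gdist_separator:
  assumes G: "simple_graph G" and ab: "linked G a b" and sep: "\<not> linked (del_vertex G v) a b"
  shows "gdist G a v + gdist G v b \<le> gdist G a b"
proof -
  let ?k = "gdist G a b"
  obtain f where f: "f 0 = a" "f ?k = b" "\<And>i. i < ?k \<Longrightarrow> (f i, f (Suc i)) \<in> adj G"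
    using gdist_relpow[OF ab] unfolding relpow_fun_conv by blast
  have "\<exists>i\<le>?k. f i = v"
  proof (rule ccontr)
    assume none: "\<not> ?thesis"
    have "(f i, f (Suc i)) \<in> adj (del_vertex G v)" if i: "i < ?k" for i
    proof -
      have "f i \<noteq> v" "f (Suc i) \<noteq> v" using none i by auto
      then show ?thesis using f(3)[OF i] by (simp add: edges_del_vertex[OF G])
    qed
    then have "(f 0, f ?k) \<in> adj (del_vertex G v) ^^ ?k"
      unfolding relpow_fun_conv by blast
    then show False using sep f(1,2) relpow_imp_rtrancl by metis
  qed
  then obtain i where i: "i \<le> ?k" "f i = v" by blast
  have "(a, v) \<in> adj G ^^ i" "(v, b) \<in> adj G ^^ (?k - i)"
    using relpow_segment[of ?k f "adj G" 0 i, OF f(3)] relpow_segment[of ?k f "adj G" i ?k, OF f(3)] f(1,2) i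
    by auto
  then have "gdist G a v \<le> i" "gdist G v b \<le> ?k - i" by (auto intro: gdist_le)
  then show ?thesis using i by linarith
qed

text \<open>The potential is the distance from \<open>x\<close>, lowered by one where it exceeds the distance of \<open>v\<close>.
  It grows by at most one along the edges of \<open>G\<close> and along the new edges, which join neighbours of
  \<open>v\<close>.\<close>

lemma gdist_complete_at:
  assumes conn: "connected_graph G" and x: "x \<in> verts G" and v: "v \<in> verts G" and y: "y \<in> verts G"
    and H: "\<And>a b. {a, b} \<in> edges H \<Longrightarrow> {a, b} \<in> edges (complete_at G v)" and xy: "linked H x y"
  shows "gdist G x y \<le> Suc (gdist H x y)"
proof -
  have G: "simple_graph G" using conn by (simp add: connected_graph_def)
  have link: "linked G x u" if "u \<in> verts G" for u using conn x that by (simp add: connected_graph_def)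
  define d where "d = gdist G x"
  \<comment> \<open>The neighbours of \<open>v\<close> have distances \<open>d v - 1\<close>, \<open>d v\<close> or \<open>d v + 1\<close>; the last two now have the
    same value.\<close>
  define g where "g w = (if d w \<le> d v then d w else d w - 1)" for w
  have lip: "d b \<le> Suc (d a)" if "{a, b} \<in> edges G" for a b
    unfolding d_def by (rule gdist_adj_le[OF link that]) (rule simple_graph_edgeD(1)[OF G that])
  have "g b \<le> Suc (g a)" if ab: "{a, b} \<in> edges H" for a b
  proof -
    consider "{a, b} \<in> edges G" | "{v, a} \<in> edges G" "{v, b} \<in> edges G"
      using H[OF ab] unfolding edge_complete_at_iff by blast
    then show ?thesis
    proof cases
      case 1
      then show ?thesis using lip[of a b] by (auto simp: g_def)
    next
      case 2
      then show ?thesis using lip[of v b] lip[of a v] by (auto simp: g_def insert_commute)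
    qed
  qed
  then have "g y \<le> g x + gdist H x y" by (rule gdist_potential[OF xy])
  moreover have "g x = 0" by (simp add: g_def d_def)
  ultimately show ?thesis by (auto simp: g_def d_def split: if_splits)
qed

section \<open>Interior vertices of a longest geodesic\<close>

text \<open>The geodesic is long enough to have interior vertices; these are the candidates for
  deletion.\<close>

locale geodesic =
  fixes G :: ugraph and f :: "nat \<Rightarrow> nat" and D :: nat
  assumes connected: "connected_graph G"
    and step: "i < D \<Longrightarrow> {f i, f (Suc i)} \<in> edges G"
    and length: "gdist G (f 0) (f D) = D"
    and D: "2 \<le> D"
begin

lemma simple: "simple_graph G"
  using connected by (simp add: connected_graph_def)

lemma linkedI: "u \<in> verts G \<Longrightarrow> v \<in> verts G \<Longrightarrow> linked G u v"
  using connected by (simp add: connected_graph_def)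

lemma f_verts:
  assumes "i \<le> D" shows "f i \<in> verts G"
proof (cases "i < D")
  case True
  show ?thesis by (rule simple_graph_edgeD(1)[OF simple step[OF True]])
next
  case False
  then have "D - 1 < D" "Suc (D - 1) = i" using assms D by linarith+
  then show ?thesis using simple_graph_edgeD(2)[OF simple step[of "D - 1"]] by simp
qed

lemma f_dist:
  assumes "i \<le> j" "j \<le> D"
  shows "gdist G (f i) (f j) = j - i"
proof -
  have seg: "gdist G (f i) (f j) \<le> j - i" if "i \<le> j" "j \<le> D" for i j
    using relpow_segment[of D f "adj G" i j] step that by (intro gdist_le) simp
  have "D \<le> gdist G (f 0) (f i) + gdist G (f i) (f D)"
    using gdist_triangle[of "f 0" "f i" G "f D"] linkedI f_verts assms length by simp
  moreover have "gdist G (f i) (f D) \<le> gdist G (f i) (f j) + gdist G (f j) (f D)"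
    using gdist_triangle[of "f i" "f j" G "f D"] linkedI f_verts assms by simp
  ultimately show ?thesis using seg[of 0 i] seg[of j D] seg[of i j] assms by simp
qed

lemma f_neq: "i \<le> D \<Longrightarrow> j \<le> D \<Longrightarrow> i \<noteq> j \<Longrightarrow> f i \<noteq> f j"
proof (induction i j rule: linorder_wlog)
  case (le i j)
  then have "gdist G (f i) (f j) = j - i" "j - i \<noteq> 0" using f_dist by auto
  then show ?case by (metis gdist_self)
qed metis

lemma segment_avoids:
  assumes "i \<le> j" "j \<le> D" "l < i \<or> j < l" "l \<le> D"
  shows "linked (del_vertex G (f l)) (f i) (f j)"
  using assms(1-3)
proof (induction j)
  case (Suc j)
  show ?case
  proof (cases "i = Suc j")
    case False
    then have "linked (del_vertex G (f l)) (f i) (f j)" using Suc by auto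
    moreover have "(f j, f (Suc j)) \<in> adj (del_vertex G (f l))"
      using step[of j] f_neq[of l j] f_neq[of l "Suc j"] Suc.prems False assms(4)
      by (auto simp: edges_del_vertex[OF simple])
    ultimately show ?thesis by (rule rtrancl_into_rtrancl)
  qed simp
qed simp

lemma interior_not_free:
  assumes "0 < i" "i < D" shows "\<not> free_vertex G (f i)"
proof
  assume free: "free_vertex G (f i)"
  have "{f (i - 1), f i} \<in> edges G" "{f (Suc i), f i} \<in> edges G"
    using step[of "i - 1"] step[of i] assms by (auto simp: insert_commute)
  moreover have "f (i - 1) \<noteq> f (Suc i)" using f_neq[of "i - 1" "Suc i"] assms by simp
  ultimately have "{f (i - 1), f (Suc i)} \<in> edges G"
    using free unfolding free_vertex_iff[OF simple] by blast
  then have "gdist G (f (i - 1)) (f (Suc i)) \<le> 1" by (intro gdist_le) auto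
  moreover have "i - 1 \<le> Suc i" "Suc i \<le> D" using assms by linarith+
  ultimately show False using f_dist[of "i - 1" "Suc i"] assms by linarith
qed

lemma num_free_del:
  assumes "0 < i" "i < D"
  shows "num_free G \<le> num_free (del_vertex G (f i))"
    and "p \<in> verts G \<Longrightarrow> p \<noteq> f i \<Longrightarrow> free_vertex (del_vertex G (f i)) p \<Longrightarrow> \<not> free_vertex G p \<Longrightarrow>
      num_free G < num_free (del_vertex G (f i))"
proof -
  have pres: "u \<in> verts (del_vertex G (f i)) \<and> free_vertex (del_vertex G (f i)) u"
    if "u \<in> verts G" "free_vertex G u" for u
    using that interior_not_free[OF assms] free_vertex_del[OF simple] by auto
  show "num_free G \<le> num_free (del_vertex G (f i))"
    by (rule num_free_mono[OF simple_del_vertex[OF simple] pres])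
  show "p \<in> verts G \<Longrightarrow> p \<noteq> f i \<Longrightarrow> free_vertex (del_vertex G (f i)) p \<Longrightarrow> \<not> free_vertex G p \<Longrightarrow>
      num_free G < num_free (del_vertex G (f i))"
    by (rule num_free_less[OF simple_del_vertex[OF simple] pres]) auto
qed

text \<open>The bounds for \<open>G\<^sub>v\<close> and \<open>G\<^sub>v - v\<close>. The ends of the geodesic stay connected without \<open>v\<close>,
  since its two neighbours on the geodesic become adjacent. The loss of one in the distance is
  compensated in \<open>G\<^sub>v\<close> by the new free vertex \<open>v\<close>.\<close>

lemma bound_complete_at:
  assumes i: "0 < i" "i < D"
  shows "num_free G + D \<le> num_free (complete_at G (f i)) + diam_sum (complete_at G (f i))"
    and "num_free G + D \<le> num_free (del_vertex (complete_at G (f i)) (f i))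
      + diam_sum (del_vertex (complete_at G (f i)) (f i)) + 1"
proof -
  let ?v = "f i"
  let ?K = "complete_at G ?v"
  let ?H = "del_vertex ?K ?v"
  have K: "simple_graph ?K" by (rule simple_complete_at[OF simple])
  have H: "simple_graph ?H" by (rule simple_del_vertex[OF K])
  have v: "?v \<in> verts G" using f_verts i by simp
  have ends: "f 0 \<in> verts G" "f D \<in> verts G" using f_verts by simp_all
  have "adj (del_vertex G ?v) \<subseteq> adj ?H"
    by (auto simp: edges_del_vertex[OF simple] edges_del_vertex[OF K] edge_complete_at_iff)
  note mono = subsetD[OF rtrancl_mono[OF this]]
  have halves: "linked ?H (f 0) (f (i - 1))" "linked ?H (f (Suc i)) (f D)"
    using segment_avoids[of 0 "i - 1" i] segment_avoids[of "Suc i" D i] i by (auto intro!: mono)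
  have bridge: "(f (i - 1), f (Suc i)) \<in> adj ?H"
  proof -
    have "{?v, f (i - 1)} \<in> edges G" "{?v, f (Suc i)} \<in> edges G"
      using step[of "i - 1"] step[of i] i by (auto simp: insert_commute)
    moreover have "f (i - 1) \<noteq> f (Suc i)" "f (i - 1) \<noteq> ?v" "f (Suc i) \<noteq> ?v"
      by (rule f_neq; use i in linarith)+
    ultimately show ?thesis
      by (simp add: edges_del_vertex[OF K] edge_complete_at_iff)
  qed
  have linkH: "linked ?H (f 0) (f D)"
    by (rule rtrancl_trans[OF rtrancl_into_rtrancl[OF halves(1) bridge] halves(2)])
  have subH: "{a, b} \<in> edges ?K" if "{a, b} \<in> edges ?H" for a b
    using that by (simp add: edges_del_vertex[OF K])
  have linkK: "linked ?K (f 0) (f D)"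
    by (rule subsetD[OF rtrancl_mono[OF adj_del_vertex] linkH])
  have "D \<le> Suc (gdist ?H (f 0) (f D))"
    using gdist_complete_at[OF connected ends(1) v ends(2) subH linkH] length by simp
  moreover have "f 0 \<in> verts ?H" using ends f_neq[of 0 i] i by simp
  ultimately have DH: "D \<le> Suc (diam_sum ?H)"
    using diam_sum_ge[OF H _ linkH] by simp
  have "D \<le> Suc (gdist ?K (f 0) (f D))"
    using gdist_complete_at[OF connected ends(1) v ends(2) _ linkK] length by simp
  then have DK: "D \<le> Suc (diam_sum ?K)"
    using diam_sum_ge[OF K _ linkK] ends by simp
  have "num_free G < num_free ?K"
    by (rule num_free_less[OF K, of G ?v])
      (use v interior_not_free[OF i] free_vertex_complete_at[OF simple] free_vertex_complete_at_self[OF simple] in auto)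
  then show "num_free G + D \<le> num_free ?K + diam_sum ?K" using DK by linarith
  have "num_free G \<le> num_free ?H"
    by (rule num_free_mono[OF H])
      (use interior_not_free[OF i] free_vertex_complete_at[OF simple] free_vertex_del[OF K] in auto)
  then show "num_free G + D \<le> num_free ?H + diam_sum ?H + 1" using DH by linarith
qed

text \<open>When an interior vertex separates \<open>a\<close> from \<open>b\<close>, their components contribute independently,
  and distances within them are at least those in \<open>G\<close>.\<close>

lemma diam_sum_del_ge:
  assumes i: "0 < i" "i < D" and sep: "\<not> linked (del_vertex G (f i)) a b"
    and a: "a \<in> verts G" "a \<noteq> f i" "linked (del_vertex G (f i)) a a'"
    and b: "b \<in> verts G" "b \<noteq> f i" "linked (del_vertex G (f i)) b b'"
  shows "max 1 (gdist G a a') + max 1 (gdist G b b') \<le> diam_sum (del_vertex G (f i))"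
proof -
  have "gdist G a a' \<le> gdist (del_vertex G (f i)) a a'" "gdist G b b' \<le> gdist (del_vertex G (f i)) b b'"
    using gdist_mono[OF adj_del_vertex a(3)] gdist_mono[OF adj_del_vertex b(3)] .
  moreover have "max 1 (gdist (del_vertex G (f i)) a a') + max 1 (gdist (del_vertex G (f i)) b b')
      \<le> diam_sum (del_vertex G (f i))"
    by (rule diam_sum_ge_two[OF simple_del_vertex[OF simple] _ a(3) _ b(3) sep]) (use a b in auto)
  ultimately show ?thesis by linarith
qed

text \<open>If every interior vertex separates the ends, the right choice is the first one behind which
  no distance from \<open>f D\<close> is lost. If a distance is lost before it, the preceding vertex of the
  geodesic becomes free; the exception is the second interior vertex, which the first one can
  replace.\<close>

lemma exists_deletable:
  "\<exists>i. 0 < i \<and> i < D \<and> num_free G + D \<le> num_free (del_vertex G (f i)) + diam_sum (del_vertex G (f i))"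
proof -
  let ?G = "\<lambda>i. del_vertex G (f i)"
  let ?x = "f 0" and ?y = "f D"
  have ends: "?x \<in> verts G" "?y \<in> verts G" using f_verts by simp_all
  have ends_neq: "?x \<noteq> f i" "?y \<noteq> f i" if "0 < i" "i < D" for i
    using f_neq[of 0 i] f_neq[of D i] that by auto
  show ?thesis
  proof (cases "\<exists>i. 0 < i \<and> i < D \<and> linked (?G i) ?x ?y")
    case True
    then obtain i where i: "0 < i" "i < D" "linked (?G i) ?x ?y" by blast
    have "D \<le> gdist (?G i) ?x ?y" using gdist_mono[OF adj_del_vertex i(3)] length by simp
    also have "\<dots> \<le> diam_sum (?G i)"
      using diam_sum_ge[OF simple_del_vertex[OF simple] _ i(3)] ends ends_neq[OF i(1,2)] by simp
    finally show ?thesis using i num_free_del(1)[OF i(1,2)] by (intro exI[of _ i]) simp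
  next
    case False
    then have sep: "\<not> linked (?G i) ?x ?y" if "0 < i" "i < D" for i using that by blast
    \<comment> \<open>Nothing is lost on the side of \<open>f D\<close>; for \<open>i = D - 1\<close> take \<open>z = f D\<close>, whose component
      contributes at least 1.\<close>
    define far where "far i \<longleftrightarrow> (\<exists>z. linked (?G i) ?y z \<and> D - i \<le> max 1 (gdist G ?y z))" for i
    have "far (D - 1)" unfolding far_def by (rule exI[of _ ?y]) (use D in auto)
    then have ex: "0 < D - 1 \<and> far (D - 1)" using D by simp
    define j where "j = (LEAST i. 0 < i \<and> far i)"
    have j: "0 < j" "far j" "j \<le> D - 1"
      using LeastI[of "\<lambda>i. 0 < i \<and> far i", OF ex] Least_le[of "\<lambda>i. 0 < i \<and> far i", OF ex]
      by (auto simp: j_def)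
    have least: "\<not> far i" if "0 < i" "i < j" for i
      using that not_less_Least[of i "\<lambda>i. 0 < i \<and> far i"] by (auto simp: j_def)
    have jD: "j < D" using j D by linarith
    obtain z where z: "linked (?G j) ?y z" "D - j \<le> max 1 (gdist G ?y z)" using j(2) by (auto simp: far_def)
    have total: "max 1 (gdist G ?x a) + (D - j) \<le> diam_sum (?G j)" if "linked (?G j) ?x a" for a
      using diam_sum_del_ge[OF j(1) jD sep[OF j(1) jD] ends(1) ends_neq(1)[OF j(1) jD] that
          ends(2) ends_neq(2)[OF j(1) jD] z(1)] z(2) by linarith
    show ?thesis
    proof (cases "j = 1")
      case True
      have "1 + (D - j) \<le> diam_sum (?G j)" using total[of ?x] by simp
      then show ?thesis using num_free_del(1)[OF j(1) jD] j(1) jD True by (intro exI[of _ j]) linarith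
    next
      case False
      define q where "q = j - 1"
      have q: "0 < q" "q < D" "j = Suc q" using False j jD by (auto simp: q_def)
      let ?p = "f q"
      have p: "?p \<in> verts G" "?p \<noteq> f j" "\<not> free_vertex G ?p"
        using f_verts[of q] q f_neq[of q j] jD interior_not_free[OF q(1,2)] by auto
      have xp: "linked (?G j) ?x ?p" using segment_avoids[of 0 q j] q jD by simp
      \<comment> \<open>A neighbour of \<open>f (j - 1)\<close> beyond that vertex would have distance \<open>j\<close> from \<open>f 0\<close>, and
        nothing would be lost on the side of \<open>f 0\<close> either.\<close>
      have near: "linked (?G q) ?x w"
        if short: "diam_sum (?G j) < D" and w: "{?p, w} \<in> edges G" "w \<noteq> f j" for w
      proof (rule ccontr)
        assume "\<not> linked (?G q) ?x w"
        then have "gdist G ?x ?p + gdist G ?p w \<le> gdist G ?x w"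
          using gdist_separator[OF simple linkedI[OF ends(1)]] simple_graph_edgeD(2)[OF simple w(1)] by blast
        moreover have "gdist G ?x ?p = q" using f_dist[of 0 q] q by simp
        moreover have "gdist G ?p w \<noteq> 0"
          using gdist_eq_0[of ?p w G] simple_graph_edgeD[OF simple w(1)] linkedI by blast
        ultimately have "j \<le> gdist G ?x w" using q by linarith
        moreover have "linked (?G j) ?x w"
          using xp w p(2) by (rule_tac rtrancl_into_rtrancl) (auto simp: edges_del_vertex[OF simple])
        ultimately have "j + (D - j) \<le> diam_sum (?G j)" using total[of w] by linarith
        then show False using short jD by linarith
      qed
      show ?thesis
      proof (cases "diam_sum (?G j) < D")
        case False
        then show ?thesis using num_free_del(1)[OF j(1) jD] j(1) jD by (intro exI[of _ j]) linarith
      next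
        case short: True
        show ?thesis
        proof (cases "free_vertex (?G j) ?p")
          case True
          then have "num_free G < num_free (?G j)" by (rule num_free_del(2)[OF j(1) jD p(1,2) _ p(3)])
          moreover have "q + (D - j) \<le> diam_sum (?G j)"
            using total[OF xp] f_dist[of 0 q] q by simp
          ultimately show ?thesis using q jD j(1) by (intro exI[of _ j]) linarith
        next
          case False
          then obtain w1 w2 where w': "{w1, ?p} \<in> edges G" "f j \<notin> {w1, ?p}" "{w2, ?p} \<in> edges G" "f j \<notin> {w2, ?p}"
            "w1 \<noteq> w2" "\<not> ({w1, w2} \<in> edges G \<and> f j \<notin> {w1, w2})"
            unfolding free_vertex_iff[OF simple_del_vertex[OF simple]] edges_del_vertex[OF simple] mem_Collect_eq
            by blast
          then have w: "{?p, w1} \<in> edges G" "w1 \<noteq> f j" "{?p, w2} \<in> edges G" "w2 \<noteq> f j"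
            "w1 \<noteq> w2" "{w1, w2} \<notin> edges G"
            by (auto simp: insert_commute[of ?p])
          have wv: "w1 \<in> verts G" "w2 \<in> verts G" "w1 \<noteq> ?p" "w2 \<noteq> ?p"
            using simple_graph_edgeD[OF simple w(1)] simple_graph_edgeD[OF simple w(3)] by auto
          note nears = near[OF short w(1,2)] near[OF short w(3,4)]
          show ?thesis
          proof (cases "q = 1")
            case True
            \<comment> \<open>Two such neighbours that are not adjacent have distance 2; for \<open>j = 2\<close> this is a
              gain of one on the side of \<open>f 0\<close> when \<open>f 1\<close> is deleted.\<close>
            have w12: "linked (?G q) w1 w2" by (rule linked_trans[OF linked_sym[OF nears(1)] nears(2)])
            have "gdist G w1 w2 \<noteq> 0" "gdist G w1 w2 \<noteq> 1"
              using gdist_eq_0[OF linkedI[OF wv(1,2)]] gdist_eq_1[OF linkedI[OF wv(1,2)]] w(5,6) by auto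
            then have "2 \<le> gdist G w1 w2" by linarith
            moreover have "\<not> linked (?G q) w1 ?y"
              using sep[OF q(1,2)] linked_trans[OF nears(1)] by blast
            moreover have "linked (?G q) ?y (f j)"
              by (rule linked_sym, rule segment_avoids) (use q jD in simp_all)
            moreover have "gdist G ?y (f j) = D - j"
              unfolding gdist_sym[of G ?y "f j"] using f_dist[of j D] jD by simp
            ultimately have "2 + (D - j) \<le> diam_sum (?G q)"
              using diam_sum_del_ge[OF q(1,2) _ wv(1,3) w12 ends(2) ends_neq(2)[OF q(1,2)], of "f j"] by simp
            then show ?thesis using True num_free_del(1)[OF q(1,2)] q by (intro exI[of _ q]) linarith
          next
            case False
            \<comment> \<open>Otherwise \<open>f (j - 2)\<close> is interior too, and one of the neighbours differs from it.
              It stays connected to \<open>f D\<close> when \<open>f (j - 2)\<close> is deleted, at a distance that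
              contradicts the choice of \<open>j\<close>.\<close>
            define s where "s = q - 1"
            have s: "0 < s" "s < D" "s < j" "q = Suc s" using False q by (auto simp: s_def)
            obtain w where w': "{?p, w} \<in> edges G" "w \<noteq> f s" "linked (?G q) ?x w" "w \<in> verts G" "w \<noteq> ?p"
              using w(1,3,5) nears wv by metis
            have "linked (?G s) ?y ?p"
              by (rule linked_sym, rule segment_avoids) (use s q in simp_all)
            moreover have "(?p, w) \<in> adj (?G s)"
              using w'(1,2) f_neq[of q s] s q by (auto simp: edges_del_vertex[OF simple])
            ultimately have "linked (?G s) ?y w" by (rule rtrancl_into_rtrancl)
            moreover have "\<not> linked (?G q) ?y w"
              using sep[OF q(1,2)] linked_trans[OF w'(3) linked_sym] by blast
            then have "gdist G ?y ?p + gdist G ?p w \<le> gdist G ?y w"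
              by (rule gdist_separator[OF simple linkedI[OF ends(2) w'(4)]])
            moreover have "gdist G ?y ?p = D - q" unfolding gdist_sym[of G ?y ?p] using f_dist[of q D] q by simp
            moreover have "gdist G ?p w \<noteq> 0" using gdist_eq_0[OF linkedI[OF p(1) w'(4)]] w'(5) by blast
            ultimately have "far s" unfolding far_def using s q by (intro exI[of _ w]) linarith
            then show ?thesis using least[OF s(1,3)] by blast
          qed
        qed
      qed
    qed
  qed
qed

end

section \<open>The d-compatible map\<close>

text \<open>A connected graph that is not complete has diameter at least 2, so a longest geodesic has
  interior vertices.\<close>

lemma connected_incomplete_vertex:
  assumes conn: "connected_graph G" and incomplete: "\<not> is_complete G"
  obtains v where "v \<in> verts G" "\<not> free_vertex G v"
    "graph_bound c G \<le> graph_bound c (del_vertex G v)"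
    "graph_bound c G \<le> graph_bound c (complete_at G v)"
    "graph_bound c G \<le> graph_bound c (del_vertex (complete_at G v) v) + 1"
proof -
  have G: "simple_graph G" and link: "\<And>u v. u \<in> verts G \<Longrightarrow> v \<in> verts G \<Longrightarrow> linked G u v"
    using conn by (auto simp: connected_graph_def)
  obtain u w where uw: "u \<in> verts G" "w \<in> verts G" "u \<noteq> w" "{u, w} \<notin> edges G"
    using incomplete unfolding is_complete_def by blast
  obtain x y where xy: "x \<in> verts G" "y \<in> verts G" "gdist G x y = diam G"
    and diam: "\<And>u v. u \<in> verts G \<Longrightarrow> v \<in> verts G \<Longrightarrow> gdist G u v \<le> diam G"
    using diam_attained[OF conn] by blast
  have "gdist G u w \<noteq> 0" "gdist G u w \<noteq> 1"
    using gdist_eq_0[OF link[OF uw(1,2)]] gdist_eq_1[OF link[OF uw(1,2)]] uw(3,4) by blast+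
  then have D: "2 \<le> diam G" using diam[OF uw(1,2)] by linarith
  obtain f where f: "f 0 = x" "f (diam G) = y" "\<And>i. i < diam G \<Longrightarrow> (f i, f (Suc i)) \<in> adj G"
    using gdist_relpow[OF link[OF xy(1,2)]] unfolding xy(3) relpow_fun_conv by blast
  interpret geodesic G f "diam G"
    by unfold_locales (use conn f xy D in auto)
  obtain i where i: "0 < i" "i < diam G"
    and del: "num_free G + diam G \<le> num_free (del_vertex G (f i)) + diam_sum (del_vertex G (f i))"
    using exists_deletable by blast
  let ?v = "f i"
  have v: "?v \<in> verts G" "\<not> free_vertex G ?v" using f_verts interior_not_free i by auto
  have "x \<in> verts G - {?v}" using xy(1) f(1) f_neq[of 0 i] i by auto
  then have nonempty: "verts (del_vertex G ?v) \<noteq> {}" "verts (del_vertex (complete_at G ?v) ?v) \<noteq> {}"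
    by auto
  have "nbhd G v \<noteq> {}" if "v \<in> verts G" for v
  proof -
    obtain z where z: "z \<in> verts G" "z \<noteq> v" using uw by blast
    have "linked G v z" using link that z by blast
    then obtain b where "{v, b} \<in> edges G"
      using z(2) by (cases rule: converse_rtranclE) auto
    then show ?thesis by (auto simp: nbhd_def insert_commute)
  qed
  then have "{v \<in> verts G. nbhd G v = {}} = {}" by blast
  then have "num_isolated G = 0" by (simp only: num_isolated_def card.empty)
  then have "diam_sum G = diam G" "num_components G = 1"
    using connected_components[OF conn] by (simp_all add: diam_sum_def num_components_def)
  then have G_bound: "graph_bound c G = c + num_free G + diam G" by (simp add: graph_bound_def)
  have K: "simple_graph (complete_at G ?v)" by (rule simple_complete_at[OF G])
  show ?thesis
  proof (rule that[OF v])
    show "graph_bound c G \<le> graph_bound c (del_vertex G ?v)"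
      using graph_bound_ge[OF simple_del_vertex[OF G] nonempty(1), of c] del G_bound by linarith
    show "graph_bound c G \<le> graph_bound c (complete_at G ?v)"
      using graph_bound_ge[OF K, of c] v(1) bound_complete_at(1)[OF i] G_bound by fastforce
    show "graph_bound c G \<le> graph_bound c (del_vertex (complete_at G ?v) ?v) + 1"
      using graph_bound_ge[OF simple_del_vertex[OF K] nonempty(2), of c] bound_complete_at(2)[OF i] G_bound by linarith
  qed
qed

lemma splits_del_vertex:
  assumes "splits G A B" "v \<in> A"
  shows "splits (del_vertex G v) (A - {v}) B"
    "induced_graph (del_vertex G v) (A - {v}) = del_vertex (induced_graph G A) v"
    "induced_graph (del_vertex G v) B = induced_graph G B"
proof -
  have G: "simple_graph G" and V: "verts G = A \<union> B" "A \<inter> B = {}" and e: "\<forall>e\<in>edges G. e \<subseteq> A \<or> e \<subseteq> B"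
    using assms(1) by (auto simp: splits_def)
  have vB: "v \<notin> B" using assms(2) V by blast
  have "e \<subseteq> A - {v} \<or> e \<subseteq> B" if "e \<in> edges (del_vertex G v)" for e
    using that e by (auto simp: edges_del_vertex[OF G])
  then show "splits (del_vertex G v) (A - {v}) B"
    unfolding splits_def using simple_del_vertex[OF G] V vB by auto
  show "induced_graph (del_vertex G v) (A - {v}) = del_vertex (induced_graph G A) v"
    unfolding del_vertex_def induced_graph_def by auto
  show "induced_graph (del_vertex G v) B = induced_graph G B"
    unfolding del_vertex_def induced_graph_def using V vB by auto
qed

lemma splits_complete_at:
  assumes "splits G A B" "v \<in> A"
  shows "splits (complete_at G v) A B"
    "induced_graph (complete_at G v) A = complete_at (induced_graph G A) v"
    "induced_graph (complete_at G v) B = induced_graph G B"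
proof -
  have G: "simple_graph G" and V: "verts G = A \<union> B" "A \<inter> B = {}" and e: "\<forall>e\<in>edges G. e \<subseteq> A \<or> e \<subseteq> B"
    using assms(1) by (auto simp: splits_def)
  let ?new = "{{u, w} | u w. u \<in> nbhd G v \<and> w \<in> nbhd G v \<and> u \<noteq> w}"
  have N: "nbhd G v \<subseteq> A" using splits_edge_in[OF assms] by (auto simp: nbhd_def insert_commute)
  have N': "nbhd (induced_graph G A) v = nbhd G v"
    using splits_edge_iff(2)[OF assms] by (simp add: nbhd_def)
  have newA: "e \<subseteq> A" and newB: "\<not> e \<subseteq> B" if "e \<in> ?new" for e using that N V by blast+
  have E: "edges (complete_at G v) = edges G \<union> ?new" by (simp add: complete_at_def)
  have "e \<subseteq> A \<or> e \<subseteq> B" if "e \<in> edges (complete_at G v)" for e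
    using that e newA unfolding E by blast
  then show "splits (complete_at G v) A B"
    unfolding splits_def using simple_complete_at[OF G] V by simp
  have "{e \<in> edges G \<union> ?new. e \<subseteq> A} = {e \<in> edges G. e \<subseteq> A} \<union> ?new" using newA by blast
  then show "induced_graph (complete_at G v) A = complete_at (induced_graph G A) v"
    unfolding complete_at_def N' by (simp add: induced_graph_def)
  have "{e \<in> edges G \<union> ?new. e \<subseteq> B} = {e \<in> edges G. e \<subseteq> B}" using newB by blast
  then show "induced_graph (complete_at G v) B = induced_graph G B"
    unfolding complete_at_def by (simp add: induced_graph_def)
qed

text \<open>If all components are complete, then their vertex sets are the blocks of a disjoint union of
  complete graphs.\<close>

lemma incomplete_component:
  assumes G: "simple_graph G" and no: "\<nexists>P. complete_union G P"
  obtains u where "u \<in> verts G" "\<not> is_complete (induced_graph G (comp_set G u))"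
proof -
  have "\<exists>u\<in>verts G. \<not> is_complete (induced_graph G (comp_set G u))"
  proof (rule ccontr)
    assume "\<not> ?thesis"
    then have all: "is_complete (induced_graph G (comp_set G u))" if "u \<in> verts G" for u using that by blast
    have complete: "{a, b} \<in> edges G" if u: "u \<in> verts G" "linked G u a" "linked G u b" and "a \<noteq> b" for u a b
    proof -
      let ?H = "induced_graph G (comp_set G u)"
      have "a \<in> verts ?H" "b \<in> verts ?H"
        using u linked_in_verts[OF G u(2,1)] linked_in_verts[OF G u(3,1)] by simp_all
      then have "{a, b} \<in> edges ?H" using all[OF u(1)] \<open>a \<noteq> b\<close> unfolding is_complete_def by blast
      then show ?thesis by simp
    qed
    let ?P = "comp_set G ` verts G"
    have "partition_on (verts G) ?P"
    proof (rule partition_onI)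
      show "\<Union>?P = verts G" using linked_in_verts[OF G] by auto
      show "{} \<notin> ?P" by auto
      fix p q assume "p \<in> ?P" "q \<in> ?P" "p \<noteq> q"
      then obtain u w where uw: "p = comp_set G u" "q = comp_set G w" by blast
      have "comp_set G u = comp_set G w" if "linked G u z" "linked G w z" for z
      proof -
        have "linked G u w" by (rule linked_trans[OF that(1) linked_sym[OF that(2)]])
        then show ?thesis using linked_trans linked_sym[OF \<open>linked G u w\<close>] by blast
      qed
      then show "disjnt p q" using \<open>p \<noteq> q\<close> unfolding uw disjnt_def by blast
    qed
    moreover have "edges G = {{u, v} | u v A. A \<in> ?P \<and> u \<in> A \<and> v \<in> A \<and> u \<noteq> v}"
    proof (intro equalityI subsetI)
      fix e assume e: "e \<in> edges G"
      then obtain a b where ab: "e = {a, b}" "a \<noteq> b" using G by (auto simp: simple_graph_def card_2_iff)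
      have "a \<in> verts G" "linked G a b" using e ab simple_graph_edgeD[OF G, of a b] by auto
      then show "e \<in> {{u, v} | u v A. A \<in> ?P \<and> u \<in> A \<and> v \<in> A \<and> u \<noteq> v}"
        using ab by (intro CollectI exI[of _ a] exI[of _ b] exI[of _ "comp_set G a"]) auto
    next
      fix e assume "e \<in> {{u, v} | u v A. A \<in> ?P \<and> u \<in> A \<and> v \<in> A \<and> u \<noteq> v}"
      then show "e \<in> edges G" using complete by auto
    qed
    ultimately have "complete_union G ?P" unfolding complete_union_def ..
    then have "\<exists>P. complete_union G P" ..
    with no show False ..
  qed
  then show ?thesis using that by blast
qed

lemma connected_component_graph:
  assumes G: "simple_graph G" and u: "u \<in> verts G"
  shows "connected_graph (induced_graph G (comp_set G u))"
  unfolding connected_graph_def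
proof (intro conjI ballI)
  show "simple_graph (induced_graph G (comp_set G u))" by (rule simple_induced[OF G])
  show "verts (induced_graph G (comp_set G u)) \<noteq> {}" using u by auto
  fix a b assume "a \<in> verts (induced_graph G (comp_set G u))" "b \<in> verts (induced_graph G (comp_set G u))"
  then have ab: "linked G u a" "linked G u b" by auto
  have "linked G a b" by (rule linked_trans[OF linked_sym[OF ab(1)] ab(2)])
  then show "linked (induced_graph G (comp_set G u)) a b"
    using splits_linked(1)[OF splits_component[OF G u], of a b] ab by simp
qed

text \<open>By additivity it suffices to treat one component that is not complete: the three operations
  at a vertex of this component leave the rest of the graph unchanged.\<close>

lemma graph_bound_vertex:
  assumes G: "simple_graph G" and no: "\<nexists>P. complete_union G P"
  obtains v where "v \<in> verts G" "\<not> free_vertex G v"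
    "graph_bound c G \<le> graph_bound c (del_vertex G v)"
    "graph_bound c G \<le> graph_bound c (complete_at G v)"
    "graph_bound c G \<le> graph_bound c (del_vertex (complete_at G v) v) + 1"
proof -
  obtain u where u: "u \<in> verts G" "\<not> is_complete (induced_graph G (comp_set G u))"
    using incomplete_component[OF assms] .
  define A B where "A = comp_set G u" and "B = verts G - comp_set G u"
  have split: "splits G A B" unfolding A_def B_def by (rule splits_component[OF G u(1)])
  obtain v where v: "v \<in> verts (induced_graph G A)" "\<not> free_vertex (induced_graph G A) v"
    "graph_bound c (induced_graph G A) \<le> graph_bound c (del_vertex (induced_graph G A) v)"
    "graph_bound c (induced_graph G A) \<le> graph_bound c (complete_at (induced_graph G A) v)"
    "graph_bound c (induced_graph G A) \<le> graph_bound c (del_vertex (complete_at (induced_graph G A) v) v) + 1"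
    using connected_incomplete_vertex[OF connected_component_graph[OF G u(1)] u(2)] unfolding A_def .
  have vA: "v \<in> A" "v \<in> verts G" using v(1) by auto
  note split_K = splits_complete_at[OF split vA(1)]
  note bounds = graph_bound_splits[OF split, of c]
    graph_bound_splits[OF splits_del_vertex(1)[OF split vA(1)], of c, unfolded splits_del_vertex(2,3)[OF split vA(1)]]
    graph_bound_splits[OF split_K(1), of c, unfolded split_K(2,3)]
    graph_bound_splits[OF splits_del_vertex(1)[OF split_K(1) vA(1)], of c,
      unfolded splits_del_vertex(2,3)[OF split_K(1) vA(1)] split_K(2,3)]
  have "\<not> free_vertex G v"
  proof
    assume free: "free_vertex G v"
    have "free_vertex (induced_graph G A) v"
      unfolding free_vertex_iff[OF simple_induced[OF G]]
      using free unfolding free_vertex_iff[OF G] by auto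
    then show False using v(2) by blast
  qed
  then show ?thesis
    by (rule that[OF vA(2)]) (use v(3-5) bounds in linarith)+
qed

lemma graph_bound_complete:
  assumes G: "simple_graph G" and ne: "verts G \<noteq> {}"
    and complete: "\<And>a b. a \<in> verts G \<Longrightarrow> b \<in> verts G \<Longrightarrow> a \<noteq> b \<Longrightarrow> {a, b} \<in> edges G"
  shows "graph_bound c G \<le> c + 1 + card (verts G)"
proof -
  have fin: "finite (verts G)" using G by (simp add: simple_graph_def)
  have near: "(a, b) \<in> adj G ^^ (if a = b then 0 else 1)" if "a \<in> verts G" "b \<in> verts G" for a b
    using complete[OF that] by simp
  then have dist: "gdist G a b \<le> (if a = b then 0 else 1)" if "a \<in> verts G" "b \<in> verts G" for a b
    using that gdist_le by blast
  have conn: "connected_graph G"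
    unfolding connected_graph_def using G ne relpow_imp_rtrancl[OF near] by blast
  obtain x y where xy: "x \<in> verts G" "y \<in> verts G" "gdist G x y = diam G"
    using diam_attained[OF conn] by metis
  have "num_isolated G + diam G \<le> 1"
  proof (cases "verts G = {x}")
    case True
    then have "diam G = 0" using xy by simp
    moreover have "num_isolated G \<le> card (verts G)" unfolding num_isolated_def by (intro card_mono fin) auto
    ultimately show ?thesis using True by simp
  next
    case False
    have "nbhd G v \<noteq> {}" if "v \<in> verts G" for v
    proof -
      obtain z where "z \<in> verts G" "z \<noteq> v" using False xy(1) that by blast
      then show ?thesis using complete[of z v] that by (auto simp: nbhd_def)
    qed
    then have "{v \<in> verts G. nbhd G v = {}} = {}" by blast
    then have "num_isolated G = 0" by (simp only: num_isolated_def card.empty)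
    then show ?thesis using dist[OF xy(1,2)] xy(3) by (auto split: if_splits)
  qed
  moreover have "num_free G \<le> card (verts G)" unfolding num_free_def by (intro card_mono fin) auto
  ultimately show ?thesis
    using connected_components[OF conn] by (simp add: graph_bound_def diam_sum_def num_components_def)
qed

lemma graph_bound_complete_union:
  assumes "finite P" "simple_graph G" "complete_union G P"
  shows "graph_bound c G \<le> card P * (c + 1) + (\<Sum>A\<in>P. card A)"
  using assms
proof (induction P arbitrary: G rule: finite_induct)
  case empty
  then have V: "verts G = {}" by (simp add: complete_union_def partition_on_def)
  then have "components G = {}" by (simp add: components_eq empty.prems)
  then show ?case using V
    by (simp add: graph_bound_def num_components_def num_free_def diam_sum_def num_isolated_def)
next
  case (insert A P)
  have part: "A \<union> \<Union>P = verts G" "disjoint (insert A P)" "{} \<notin> insert A P"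
    and edges: "edges G = {{u, v} | u v C. C \<in> insert A P \<and> u \<in> C \<and> v \<in> C \<and> u \<noteq> v}"
    using insert.prems(2) by (auto simp: complete_union_def partition_on_def)
  have disj: "A \<inter> C = {}" if "C \<in> P" for C using part(2) insert.hyps(2) that by (auto simp: disjoint_def)
  have split: "splits G A (\<Union>P)"
    unfolding splits_def
  proof (intro conjI ballI)
    show "e \<subseteq> A \<or> e \<subseteq> \<Union>P" if "e \<in> edges G" for e using that unfolding edges by blast
  qed (use insert.prems(1) part(1) disj in auto)
  have "complete_union (induced_graph G (\<Union>P)) P"
    unfolding complete_union_def
  proof
    show "partition_on (verts (induced_graph G (\<Union>P))) P"
      using part by (auto simp: partition_on_def disjoint_def)
    have "{e \<in> edges G. e \<subseteq> \<Union>P} = {{u, v} | u v C. C \<in> P \<and> u \<in> C \<and> v \<in> C \<and> u \<noteq> v}"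
    proof (intro equalityI subsetI)
      fix e assume "e \<in> {e \<in> edges G. e \<subseteq> \<Union>P}"
      then have "e \<in> edges G" and sub: "e \<subseteq> \<Union>P" by simp_all
      then obtain u v C where e: "e = {u, v}" "C \<in> insert A P" "u \<in> C" "v \<in> C" "u \<noteq> v"
        unfolding edges by blast
      have "u \<in> \<Union>P" using sub e(1) by simp
      then have "C \<noteq> A" using disj e(3) by blast
      then show "e \<in> {{u, v} | u v C. C \<in> P \<and> u \<in> C \<and> v \<in> C \<and> u \<noteq> v}" using e by blast
    qed (auto simp: edges)
    then show "edges (induced_graph G (\<Union>P)) = {{u, v} | u v C. C \<in> P \<and> u \<in> C \<and> v \<in> C \<and> u \<noteq> v}"
      by simp
  qed
  then have "graph_bound c (induced_graph G (\<Union>P)) \<le> card P * (c + 1) + (\<Sum>A\<in>P. card A)"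
    by (rule insert.IH[OF simple_induced[OF insert.prems(1)]])
  moreover have "graph_bound c (induced_graph G A) \<le> c + 1 + card (verts (induced_graph G A))"
  proof (rule graph_bound_complete[OF simple_induced[OF insert.prems(1)]])
    show "verts (induced_graph G A) \<noteq> {}" using part by auto
    show "{a, b} \<in> edges (induced_graph G A)"
      if "a \<in> verts (induced_graph G A)" "b \<in> verts (induced_graph G A)" "a \<noteq> b" for a b
      using that unfolding edges_induced edges by auto
  qed
  moreover have "verts (induced_graph G A) = A" using part(1) by auto
  ultimately show ?case
    unfolding graph_bound_splits[OF split] using insert.hyps by (simp add: algebra_simps)
qed

theorem graph_bound_d_compatible:
  "d_compatible (\<lambda>H G. (card (verts H) - 2) * num_components G + num_free G + diam_sum G)"
  unfolding d_compatible_def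
proof (intro allI impI conjI)
  fix m :: nat and G assume mG: "2 \<le> m \<and> G \<in> graph_class"
  then have G: "simple_graph G" by (simp add: graph_class_def)
  have card_m: "card (verts (complete_graph m)) = m" by (simp add: complete_graph_def)
  note bound = graph_bound_def[of "m - 2", symmetric]
  show "(card (verts (complete_graph m)) - 2) * num_components G + num_free G + diam_sum G
      \<le> card P * (m - 1) + (\<Sum>A\<in>P. card A)" if P: "complete_union G P" for P
  proof -
    have "finite P" using P G finite_UnionD[of P]
      by (auto simp: complete_union_def partition_on_def simple_graph_def)
    then have "graph_bound (m - 2) G \<le> card P * (m - 2 + 1) + (\<Sum>A\<in>P. card A)"
      by (rule graph_bound_complete_union[OF _ G P])
    moreover have "m - 2 + 1 = m - 1" using mG by linarith
    ultimately show ?thesis unfolding card_m bound by (simp only:)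
  qed
  assume no: "\<nexists>P. complete_union G P"
  show "\<exists>v\<in>verts G. \<not> free_vertex G v \<and>
      (card (verts (complete_graph m)) - 2) * num_components G + num_free G + diam_sum G
      \<le> (card (verts (complete_graph m)) - 2) * num_components (del_vertex G v) + num_free (del_vertex G v) + diam_sum (del_vertex G v) \<and>
      (card (verts (complete_graph m)) - 2) * num_components G + num_free G + diam_sum G
      \<le> (card (verts (complete_graph m)) - 2) * num_components (complete_at G v) + num_free (complete_at G v) + diam_sum (complete_at G v) \<and>
      (card (verts (complete_graph m)) - 2) * num_components G + num_free G + diam_sum G
      \<le> (card (verts (complete_graph m)) - 2) * num_components (del_vertex (complete_at G v) v)
        + num_free (del_vertex (complete_at G v) v) + diam_sum (del_vertex (complete_at G v) v) + 1"
    unfolding card_m bound using graph_bound_vertex[OF G no, of "m - 2"] by blast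
qed

section \<open>The depth of generalized binomial edge ideals\<close>

theorem theorem1p1:
  shows
    "(\<forall>m n G \<Psi>. 2 \<le> m \<and> 1 \<le> n \<and> simple_graph G \<and> verts G = {1..n} \<and> d_compatible \<Psi> \<longrightarrow>
        depth (mpoly_ring m n :: 'k::field mpoly ring) (xvars m n) (edge_quotient m n G)
          \<ge> enat (\<Psi> (complete_graph m) G)) \<and>
     d_compatible (\<lambda>H G. (card (verts H) - 2) * num_components G + num_free G + diam_sum G) \<and>
     (\<forall>m n G. 2 \<le> m \<and> 1 \<le> n \<and> simple_graph G \<and> verts G = {1..n} \<longrightarrow>
        depth (mpoly_ring m n :: 'k mpoly ring) (xvars m n) (edge_quotient m n G)
          \<ge> enat ((m - 2) * num_components G + num_free G + diam_sum G))"
proof (intro conjI allI impI)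
  let ?R = "\<lambda>m n. mpoly_ring m n :: 'k mpoly ring"
  fix m n :: nat and G \<Psi>
  assume "2 \<le> m \<and> 1 \<le> n \<and> simple_graph G \<and> verts G = {1..n} \<and> d_compatible \<Psi>"
  then show "enat (\<Psi> (complete_graph m) G) \<le> depth (?R m n) (xvars m n) (edge_quotient m n G)"
    by (intro depth_edge_quotient_ge) auto
next
  show "d_compatible (\<lambda>H G. (card (verts H) - 2) * num_components G + num_free G + diam_sum G)"
    by (rule graph_bound_d_compatible)
next
  let ?R = "\<lambda>m n. mpoly_ring m n :: 'k mpoly ring"
  fix m n :: nat and G
  assume "2 \<le> m \<and> 1 \<le> n \<and> simple_graph G \<and> verts G = {1..n}"
  then have "enat ((card (verts (complete_graph m)) - 2) * num_components G + num_free G + diam_sum G)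
      \<le> depth (?R m n) (xvars m n) (edge_quotient m n G)"
    by (intro depth_edge_quotient_ge[OF graph_bound_d_compatible]) auto
  then show "enat ((m - 2) * num_components G + num_free G + diam_sum G)
      \<le> depth (?R m n) (xvars m n) (edge_quotient m n G)"
    by (simp add: complete_graph_def)
qed

end
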